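(* Let $n\ge16$, $R_0\ge1$, $f\in L^\infty(\mathbb R^n;\mathbb R^n)$ with $\operatorname{supp}f\subset B_{R_0}(0)$, $0\le\tau\le1$, and let $u$ be a weighted fixed point for the force $\tau f$ with pressure $p$, and $\theta,K,M$ as in the context. Then for every $y\in\mathbb R^n$ $$(-\Delta)^{-1}\theta(y)=\frac1{2\omega_n}\int_{\mathbb R^n}\frac{|u(x)\cdot(x-y)|^2}{|x-y|^n}\,dx+\mathcal F_\tau(y),\qquad \mathcal F_\tau=-\tau\sum_i\partial_i\Psi*f_i,$$ where all displayed integrals converge absolutely. Moreover, $$\|\mathcal F_\tau\|_\infty\le C_nR_0^3\|f\|_\infty\le C_f,\qquad M\le C_f(1+K),$$ where $C_n$ depends only on $n$ and $C_f$ only on $n,R_0,\|f\|_\infty$.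
   Context: Let $\omega_n=|S^{n-1}|$, $U_{ij}(x)=\frac1{2(n-2)\omega_n}\bigl(\delta_{ij}|x|^{2-n}+(n-2)x_ix_j|x|^{-n}\bigr)$, $P_j(x)=\frac{x_j}{\omega_n|x|^n}$, $\Gamma(x)=\frac{|x|^{2-n}}{(n-2)\omega_n}$, $\Psi(x)=\frac{|x|^{4-n}}{2(n-4)(n-2)\omega_n}$, so $-\Delta\Gamma=\delta_0$ and $-\Delta\Psi=\Gamma$; $(-\Delta)^{-1}a=\Gamma*a$. Let $X=\{v\in C^1(\mathbb R^n;\mathbb R^n):\operatorname{div}v=0,\ \|v\|_X<\infty\}$, $\|v\|_X=\sup_x(1+|x|)^{n-3}|v(x)|+\sup_x(1+|x|)^{n-2}|\nabla v(x)|$. A weighted fixed point for the force $\tau f$ is $u\in X$ with $u_i=\sum_jU_{ij}*G_j$, $G=\tau f-(u\cdot\nabla)u$; its (normalized) pressure is $p=\sum_jP_j*G_j$. Then $\theta=p+|u|^2/2$, $\theta_+=\max\{\theta,0\}$, $K=\|(-\Delta)^{-1}\theta_+\|_\infty$, $M=\sup_{z\in\mathbb R^n,\,r>0}r^{2-n}\int_{B_r(z)}|u|^2$. *)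

theory Defs
  imports "HOL-Analysis.Analysis" "HOL-Probability.Essential_Supremum"
begin

text \<open>The surface area of the unit sphere of \<open>\<real>\<^sup>n\<close>, as \<open>n\<close> times the volume of the unit ball.\<close>

definition omega :: "nat \<Rightarrow> real" where
  "omega n = real n * unit_ball_vol (real n)"

text \<open>Kernels on \<open>\<real>\<^sup>n\<close>. Their values at the origin are irrelevant: they only occur inside
  convolutions.\<close>

definition stokes_kernel :: "'n \<Rightarrow> 'n \<Rightarrow> real^'n \<Rightarrow> real" where
  "stokes_kernel i j x =
     1 / (2 * (real CARD('n) - 2) * omega CARD('n)) *
       ((if i = j then 1 else 0) * norm x powi (2 - int CARD('n)) +
        (real CARD('n) - 2) * x $ i * x $ j * norm x powi (- int CARD('n)))"

definition pressure_kernel :: "'n \<Rightarrow> real^'n \<Rightarrow> real" where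
  "pressure_kernel j x = x $ j / (omega CARD('n) * norm x ^ CARD('n))"

definition newton_kernel :: "real^'n \<Rightarrow> real" where
  "newton_kernel x = norm x powi (2 - int CARD('n)) / ((real CARD('n) - 2) * omega CARD('n))"

definition bilaplace_kernel :: "real^'n \<Rightarrow> real" where
  "bilaplace_kernel x = norm x powi (4 - int CARD('n)) /
     (2 * (real CARD('n) - 4) * (real CARD('n) - 2) * omega CARD('n))"

definition partial_deriv :: "'n \<Rightarrow> (real^'n \<Rightarrow> real) \<Rightarrow> real^'n \<Rightarrow> real" where
  "partial_deriv i g x = frechet_derivative g (at x) (axis i 1)"

definition convolution :: "(real^'n \<Rightarrow> real) \<Rightarrow> (real^'n \<Rightarrow> real) \<Rightarrow> real^'n \<Rightarrow> real" where
  "convolution k g y = (LINT x|lebesgue. k (y - x) * g x)"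

definition convolution_converges ::
  "(real^'n \<Rightarrow> real) \<Rightarrow> (real^'n \<Rightarrow> real) \<Rightarrow> real^'n \<Rightarrow> bool" where
  "convolution_converges k g y \<longleftrightarrow> integrable lebesgue (\<lambda>x. k (y - x) * g x)"

abbreviation inv_neg_laplace :: "(real^'n \<Rightarrow> real) \<Rightarrow> real^'n \<Rightarrow> real" where
  "inv_neg_laplace a \<equiv> convolution newton_kernel a"

text \<open>\<open>L\<^sup>\<infinity>\<close> on Lebesgue measure. \<open>esssup\<close> is infinite for non-measurable functions, so \<open>Linfty\<close> with
  its measurability clause is the usual notion; \<open>Linfty_norm\<close> is meaningful on \<open>Linfty\<close> only.\<close>

definition Linfty :: "(real^'n \<Rightarrow> 'b::euclidean_space) \<Rightarrow> bool" where
  "Linfty f \<longleftrightarrow> f \<in> borel_measurable lebesgue \<and> esssup lebesgue (\<lambda>x. ereal (norm (f x))) < \<infinity>"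

definition Linfty_norm :: "(real^'n \<Rightarrow> 'b::euclidean_space) \<Rightarrow> real" where
  "Linfty_norm f = real_of_ereal (esssup lebesgue (\<lambda>x. ereal (norm (f x))))"

text \<open>The support of an almost-everywhere class: the complement of the largest open set on which
  \<open>f\<close> vanishes almost everywhere.\<close>

definition ess_support :: "(real^'n \<Rightarrow> 'b::euclidean_space) \<Rightarrow> (real^'n) set" where
  "ess_support f = {x. \<forall>r>0. \<not> (AE y in lebesgue. y \<in> ball x r \<longrightarrow> f y = 0)}"

text \<open>The norm of a Jacobian is the norm of type \<open>real^'n^'n\<close>, i.e. the Frobenius norm.\<close>

definition X_norm :: "(real^'n \<Rightarrow> real^'n) \<Rightarrow> ereal" where
  "X_norm v =
     (SUP x. ereal ((1 + norm x) powi (int CARD('n) - 3) * norm (v x))) +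
     (SUP x. ereal ((1 + norm x) powi (int CARD('n) - 2) * norm (jacobian v (at x))))"

definition X_space :: "(real^'n \<Rightarrow> real^'n) set" where
  "X_space = {v. v differentiable_on UNIV \<and> continuous_on UNIV (\<lambda>x. jacobian v (at x)) \<and>
                 (\<forall>x. trace (jacobian v (at x)) = 0) \<and> X_norm v < \<infinity>}"

text \<open>\<open>G = g - (u \<cdot> \<nabla>)u\<close> for a force \<open>g\<close>; the \<open>i\<close>-th component of the product
  of the Jacobian with \<open>u\<close> is the sum over \<open>j\<close> of \<open>u\<^sub>j \<partial>\<^sub>j u\<^sub>i\<close>.\<close>

definition source :: "(real^'n \<Rightarrow> real^'n) \<Rightarrow> (real^'n \<Rightarrow> real^'n) \<Rightarrow> real^'n \<Rightarrow> real^'n" where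
  "source g u x = g x - jacobian u (at x) *v u x"

definition weighted_fixed_point :: "(real^'n \<Rightarrow> real^'n) \<Rightarrow> (real^'n \<Rightarrow> real^'n) \<Rightarrow> bool" where
  "weighted_fixed_point g u \<longleftrightarrow> u \<in> X_space \<and>
     (\<forall>x i. u x $ i = (\<Sum>j\<in>UNIV. convolution (stokes_kernel i j) (\<lambda>z. source g u z $ j) x))"

definition pressure :: "(real^'n \<Rightarrow> real^'n) \<Rightarrow> (real^'n \<Rightarrow> real^'n) \<Rightarrow> real^'n \<Rightarrow> real" where
  "pressure g u x = (\<Sum>j\<in>UNIV. convolution (pressure_kernel j) (\<lambda>z. source g u z $ j) x)"

definition theta :: "(real^'n \<Rightarrow> real^'n) \<Rightarrow> (real^'n \<Rightarrow> real^'n) \<Rightarrow> real^'n \<Rightarrow> real" where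
  "theta g u x = pressure g u x + (norm (u x))\<^sup>2 / 2"

definition theta_pos :: "(real^'n \<Rightarrow> real^'n) \<Rightarrow> (real^'n \<Rightarrow> real^'n) \<Rightarrow> real^'n \<Rightarrow> real" where
  "theta_pos g u x = max (theta g u x) 0"

definition K_const :: "(real^'n \<Rightarrow> real^'n) \<Rightarrow> (real^'n \<Rightarrow> real^'n) \<Rightarrow> real" where
  "K_const g u = Linfty_norm (inv_neg_laplace (theta_pos g u))"

definition M_quotients :: "(real^'n \<Rightarrow> real^'n) \<Rightarrow> real set" where
  "M_quotients u =
     {r powi (2 - int CARD('n)) * (LINT x:ball z r|lebesgue. (norm (u x))\<^sup>2) | z r. r > 0}"

definition M_const :: "(real^'n \<Rightarrow> real^'n) \<Rightarrow> real" where
  "M_const u = Sup (M_quotients u)"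

definition force_potential :: "real \<Rightarrow> (real^'n \<Rightarrow> real^'n) \<Rightarrow> real^'n \<Rightarrow> real" where
  "force_potential \<tau> f y =
     - \<tau> * (\<Sum>i\<in>UNIV. convolution (partial_deriv i bilaplace_kernel) (\<lambda>x. f x $ i) y)"

end

(* Idea. Writing P_j = - d_j Gamma, the convolution of Gamma with P_j is y_j Gamma(y) / 2; hence
   Gamma * p is the convolution of y Gamma(y) / 2 with G.  Its convective part is integrated by
   parts using div u = 0, which gives - Gamma * |u|^2 / 2 plus the quadratic integral of the
   statement, and the force part is F_tau.

   The identity Gamma * P_j = y_j Gamma / 2 comes from the representation of both kernels as time
   integrals of the heat kernel g_t: the product g_s(y - x) g_t(x) is g_(s+t)(y) times a Gaussian in
   x centred at t y / (s + t), so everything reduces to an integral over s + t.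

   For the bound on M, the quadratic integral is at most K + |F_tau| almost everywhere and is
   averaged over y in B_r(z): every x in that ball sees a ball of y of radius r / 4 on which
   u(x) . (x - y) is at least |u(x)| r / 4. *)

theory Submission
  imports Defs "HOL-Probability.Distributions"
begin

section \<open>Weakly singular kernels\<close>

text \<open>Two cancellations make the identity exact. The Gaussian mean t y / (s + t) cancels the
  weight 1 / t of the dipole, and the remaining 1 / (s + t) cancels the length of the segment s + t
  = r, which leaves the time integral of g_r(y), the Newton kernel again. And the term -Gamma *
  |u|^2 / 2 of the integration by parts cancels what |u|^2 / 2 contributes to \<theta>; this is why
  the identity is about \<theta> and not about p.

  The rest is absolute convergence. Fubini for Gamma * P_j * G needs a majorant; as |P_j| is at most
  of order |x|^(1-n), it is the convolution of |x|^(2-n) and |x|^(1-n), a multiple of |y|^(3-n),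
  obtained from the same heat integrals with time weight t^(-1/2). Fields in X decay so fast that
  |u|^2 and |u| |Du| are bounded and integrable, hence integrable against every kernel of order
  below n, uniformly in y. Since K is an essential supremum, it controls the quadratic integral for
  almost every y only; averaging over y does not see the exceptional set.\<close>

lemma ennreal_term_le_suminf: "f k \<le> (\<Sum>k. f k)" for f :: "nat \<Rightarrow> ennreal"
  using sum_le_suminf[of f "{k}"] by simp

text \<open>Dyadic shells: on R / 2^(k+1) <= |x| < R / 2^k the integrand is at most (R /
  2^(k+1))^(-m), and covering the shell by its outer ball gives the k-th term of a geometric series
  with ratio 2^(m-n) < 1.\<close>

lemma nn_integral_ball_norm_powr_le:
  fixes m :: real
  assumes m: "0 \<le> m" "m < DIM('a::euclidean_space)"
  shows "\<exists>C\<ge>0. \<forall>R>0. (\<integral>\<^sup>+x. ennreal (norm x powr (-m)) * indicator (ball 0 R) (x::'a) \<partial>lborel)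
                \<le> ennreal (C * R powr (DIM('a) - m))"
proof -
  define V where "V = unit_ball_vol (real DIM('a))"
  define q :: real where "q = 2 powr (m - DIM('a))"
  have V: "0 \<le> V" by (simp add: V_def)
  have "q < 2 powr 0" unfolding q_def using m by (intro powr_less_mono) auto
  then have q: "0 < q" "q < 1" by (auto simp: q_def)
  let ?C = "V * 2 powr m * (1 / (1 - q))"
  have "(\<integral>\<^sup>+x. ennreal (norm x powr (-m)) * indicator (ball 0 R) (x::'a) \<partial>lborel)
           \<le> ennreal (?C * R powr (DIM('a) - m))" if R: "R > 0" for R
  proof -
    let ?b = "\<lambda>k x. ennreal ((R / 2 ^ Suc k) powr (-m)) * indicator (ball 0 (R / 2 ^ k)) (x::'a)"
    have pw: "ennreal (norm x powr (-m)) * indicator (ball 0 R) x \<le> (\<Sum>k. ?b k x)"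
      if x: "x \<noteq> 0" for x :: 'a
    proof (cases "x \<in> ball 0 R")
      case True
      have "\<exists>k. R / 2 ^ Suc k \<le> norm x"
      proof -
        obtain k where "(1/2::real) ^ k < norm x / R"
          using real_arch_pow_inv[of "norm x / R" "1/2"] x R by auto
        then have "R / 2 ^ k < norm x" using R by (simp add: field_simps power_one_over)
        moreover have "R / 2 ^ Suc k \<le> R / 2 ^ k" using R by (simp add: field_simps)
        ultimately show ?thesis by (intro exI[of _ k]) linarith
      qed
      \<comment> \<open>The least such \<open>k\<close> puts \<open>x\<close> outside the inner ball
        of its shell and, by minimality, inside the outer one; for \<open>k = 0\<close> the latter
        is membership in \<open>ball 0 R\<close>.\<close>
      define k where "k = (LEAST k. R / 2 ^ Suc k \<le> norm x)"
      have k1: "R / 2 ^ Suc k \<le> norm x"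
        unfolding k_def using \<open>\<exists>k. R / 2 ^ Suc k \<le> norm x\<close> by (rule LeastI_ex)
      have k2: "norm x < R / 2 ^ k"
      proof (cases k)
        case 0
        then show ?thesis using True by simp
      next
        case (Suc j)
        then have "j < (LEAST k. R / 2 ^ Suc k \<le> norm x)" by (simp add: k_def)
        from not_less_Least[OF this] show ?thesis by (simp add: Suc)
      qed
      have "norm x powr (-m) \<le> (R / 2 ^ Suc k) powr (-m)"
        using k1 R m by (intro powr_mono2') auto
      then have "ennreal (norm x powr (-m)) * indicator (ball 0 R) x \<le> ?b k x"
        using True k2 by (simp add: ennreal_leI)
      also have "\<dots> \<le> (\<Sum>k. ?b k x)" by (rule ennreal_term_le_suminf)
      finally show ?thesis .
    qed simp
    have "(\<integral>\<^sup>+x. ennreal (norm x powr (-m)) * indicator (ball 0 R) (x::'a) \<partial>lborel)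
        \<le> (\<integral>\<^sup>+x. (\<Sum>k. ?b k x) \<partial>lborel)"
      using AE_lborel_singleton[of "0::'a"] by (intro nn_integral_mono_AE, eventually_elim) (rule pw)
    also have "\<dots> = (\<Sum>k. \<integral>\<^sup>+x. ?b k x \<partial>lborel)"
      by (intro nn_integral_suminf borel_measurable_times_ennreal borel_measurable_const borel_measurable_indicator) simp
    also have "\<dots> = (\<Sum>k. ennreal (V * 2 powr m * R powr (DIM('a) - m) * q ^ k))"
    proof (intro suminf_cong)
      fix k
      have "(\<integral>\<^sup>+x. ?b k x \<partial>lborel) = ennreal ((R / 2 ^ Suc k) powr (-m)) * ennreal (V * (R / 2 ^ k) ^ DIM('a))"
        using R by (subst nn_integral_cmult_indicator) (simp_all add: emeasure_ball V_def)
      also have "\<dots> = ennreal ((R / 2 ^ Suc k) powr (-m) * (V * (R / 2 ^ k) ^ DIM('a)))"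
        using R V by (simp add: ennreal_mult)
      also have "(R / 2 ^ Suc k) powr (-m) * (V * (R / 2 ^ k) ^ DIM('a))
          = V * 2 powr m * R powr (DIM('a) - m) * q ^ k"
      proof -
        have p: "(2::real) ^ j = 2 powr real j" for j by (simp add: powr_realpow)
        have "(R / 2 ^ Suc k) powr (-m) = R powr (-m) * 2 powr (m + k * m)"
          unfolding p using R
          by (simp only: powr_divide powr_powr of_nat_Suc) (simp add: divide_inverse algebra_simps flip: powr_minus powr_add)
        moreover have "(R / 2 ^ k) ^ DIM('a) = R powr DIM('a) * 2 powr (- (k * DIM('a)))"
          using R by (subst power_divide) (simp add: powr_realpow[symmetric] powr_powr powr_minus divide_inverse)
        moreover have "q ^ k = 2 powr (k * (m - DIM('a)))"
          by (simp add: q_def powr_power mult.commute)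
        moreover have "R powr (DIM('a) - m) = R powr DIM('a) * R powr (-m)"
          by (simp flip: powr_add)
        moreover have "2 powr m * 2 powr (k * (m - DIM('a))) = 2 powr (m + k * m) * 2 powr (- (k * DIM('a)))"
          unfolding powr_add[symmetric] by (simp add: algebra_simps)
        ultimately show ?thesis by (simp only: mult_ac)
      qed
      finally show "(\<integral>\<^sup>+x. ?b k x \<partial>lborel) = ennreal (V * 2 powr m * R powr (DIM('a) - m) * q ^ k)" .
    qed
    also have "\<dots> = ennreal (\<Sum>k. V * 2 powr m * R powr (DIM('a) - m) * q ^ k)"
      using q V by (intro suminf_ennreal2 summable_mult summable_geometric) auto
    also have "(\<Sum>k. V * 2 powr m * R powr (DIM('a) - m) * q ^ k) = ?C * R powr (DIM('a) - m)"
      using q by (subst suminf_mult) (auto simp: suminf_geometric summable_geometric)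
    finally show ?thesis .
  qed
  then show ?thesis using q V by (intro exI[of _ ?C]) auto
qed

text \<open>The same decomposition outwards, into shells 2^k <= 1 + |x| < 2^(k+1); the ratio is now
  2^(n-p) < 1.\<close>

lemma nn_integral_one_plus_norm_powr_finite:
  fixes p :: real
  assumes p: "p > DIM('a::euclidean_space)"
  shows "(\<integral>\<^sup>+x. ennreal ((1 + norm (x::'a)) powr (-p)) \<partial>lborel) < \<infinity>"
proof -
  define V where "V = unit_ball_vol (real DIM('a))"
  define q :: real where "q = 2 powr (DIM('a) - p)"
  have V: "0 \<le> V" by (simp add: V_def)
  have "q < 2 powr 0" unfolding q_def using p by (intro powr_less_mono) auto
  then have q: "0 < q" "q < 1" by (auto simp: q_def)
  let ?b = "\<lambda>k x. ennreal ((2 ^ k) powr (-p)) * indicator (ball 0 (2 ^ Suc k)) (x::'a)"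
  have pw: "ennreal ((1 + norm x) powr (-p)) \<le> (\<Sum>k. ?b k x)" for x :: 'a
  proof -
    have "\<exists>k. 1 + norm x < 2 ^ Suc k"
    proof -
      obtain k where "1 + norm x < 2 ^ k" using real_arch_pow[of 2 "1 + norm x"] by auto
      then have "1 + norm x < 2 ^ Suc k" using norm_ge_zero[of x] by (simp, linarith)
      then show ?thesis by blast
    qed
    define k where "k = (LEAST k. 1 + norm x < 2 ^ Suc k)"
    have k1: "1 + norm x < 2 ^ Suc k"
      unfolding k_def using \<open>\<exists>k. 1 + norm x < 2 ^ Suc k\<close> by (rule LeastI_ex)
    have k2: "2 ^ k \<le> 1 + norm x"
    proof (cases k)
      case (Suc j)
      then have "j < (LEAST k. 1 + norm x < 2 ^ Suc k)" by (simp add: k_def)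
      from not_less_Least[OF this] show ?thesis by (simp add: Suc)
    qed simp
    have "(1 + norm x) powr (-p) \<le> (2 ^ k) powr (-p)"
      using k2 p by (intro powr_mono2') auto
    then have "ennreal ((1 + norm x) powr (-p)) \<le> ?b k x"
      using k1 by (simp add: ennreal_leI)
    also have "\<dots> \<le> (\<Sum>k. ?b k x)" by (rule ennreal_term_le_suminf)
    finally show ?thesis .
  qed
  have "(\<integral>\<^sup>+x. ennreal ((1 + norm (x::'a)) powr (-p)) \<partial>lborel) \<le> (\<integral>\<^sup>+x. (\<Sum>k. ?b k x) \<partial>lborel)"
    by (intro nn_integral_mono pw)
  also have "\<dots> = (\<Sum>k. \<integral>\<^sup>+x. ?b k x \<partial>lborel)"
    by (intro nn_integral_suminf borel_measurable_times_ennreal borel_measurable_const borel_measurable_indicator) simp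
  also have "\<dots> = (\<Sum>k. ennreal (V * 2 ^ DIM('a) * q ^ k))"
  proof (intro suminf_cong)
    fix k
    have "(\<integral>\<^sup>+x. ?b k x \<partial>lborel) = ennreal ((2 ^ k) powr (-p)) * ennreal (V * (2 ^ Suc k) ^ DIM('a))"
      by (subst nn_integral_cmult_indicator) (simp_all add: emeasure_ball V_def)
    also have "\<dots> = ennreal ((2 ^ k) powr (-p) * (V * (2 ^ Suc k) ^ DIM('a)))"
      using V by (simp add: ennreal_mult)
    also have "(2 ^ k) powr (-p) * (V * (2 ^ Suc k) ^ DIM('a)) = V * 2 ^ DIM('a) * q ^ k"
    proof -
      have "((2::real) ^ k) powr (-p) = 2 powr (- (k * p))"
        by (simp add: powr_realpow[symmetric] powr_powr)
      moreover have "q ^ k = 2 powr (k * (DIM('a) - p))"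
        by (simp add: q_def powr_power mult.commute)
      moreover have "((2::real) ^ Suc k) ^ DIM('a) = 2 ^ DIM('a) * 2 powr (k * DIM('a))"
        by (simp add: power_mult_distrib powr_realpow[symmetric] powr_powr)
      moreover have "2 powr (k * (DIM('a) - p)) = 2 powr (- (k * p)) * 2 powr (k * DIM('a))"
        unfolding powr_add[symmetric] by (simp add: algebra_simps)
      ultimately show ?thesis by (simp only: mult_ac)
    qed
    finally show "(\<integral>\<^sup>+x. ?b k x \<partial>lborel) = ennreal (V * 2 ^ DIM('a) * q ^ k)" .
  qed
  also have "\<dots> = ennreal (\<Sum>k. V * 2 ^ DIM('a) * q ^ k)"
    using q V by (intro suminf_ennreal2 summable_mult summable_geometric) auto
  also have "\<dots> < \<infinity>" by simp
  finally show ?thesis .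
qed

section \<open>The heat kernel\<close>

lemma distr_lborel_reflect: "distr lborel borel (\<lambda>x. y - x) = (lborel :: 'a::euclidean_space measure)"
proof -
  have "(lborel :: 'a measure) = density (distr lborel borel (\<lambda>x. y + (-1) *\<^sub>R x)) (\<lambda>_. ennreal (\<bar>-1\<bar>^DIM('a)))"
    using lborel_affine[of "-1" y] by simp
  then show ?thesis by (simp add: density_1)
qed

lemma nn_integral_lborel_reflect:
  fixes f :: "'a::euclidean_space \<Rightarrow> ennreal"
  assumes "f \<in> borel_measurable borel"
  shows "(\<integral>\<^sup>+x. f (y - x) \<partial>lborel) = (\<integral>\<^sup>+x. f x \<partial>lborel)"
  using assms by (subst (2) distr_lborel_reflect[of y, symmetric], subst nn_integral_distr) auto

lemma nn_integral_lborel_translate: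
  fixes f :: "'a::euclidean_space \<Rightarrow> ennreal"
  assumes "f \<in> borel_measurable borel"
  shows "(\<integral>\<^sup>+x. f (c + x) \<partial>lborel) = (\<integral>\<^sup>+x. f x \<partial>lborel)"
  using assms by (subst (2) lborel_distr_plus[of c, symmetric], subst nn_integral_distr) auto

lemma integrable_lborel_translate:
  fixes f :: "'a::euclidean_space \<Rightarrow> real"
  assumes "integrable lborel f"
  shows "integrable lborel (\<lambda>x. f (c + x))"
  using assms by (subst (asm) lborel_distr_plus[of c, symmetric], subst (asm) integrable_distr_eq) auto

lemma integral_lborel_translate:
  fixes f :: "'a::euclidean_space \<Rightarrow> real"
  assumes [measurable]: "f \<in> borel_measurable borel"
  shows "(\<integral>x. f (c + x) \<partial>lborel) = (\<integral>x. f x \<partial>lborel)"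
  by (subst (2) lborel_distr_plus[of c, symmetric], subst integral_distr) auto

lemma integral_lborel_reflect:
  fixes f :: "'a::euclidean_space \<Rightarrow> real"
  assumes [measurable]: "f \<in> borel_measurable borel"
  shows "(\<integral>x. f (c - x) \<partial>lborel) = (\<integral>x. f x \<partial>lborel)"
  by (subst (2) distr_lborel_reflect[of c, symmetric], subst integral_distr) auto

text \<open>The fundamental solution of the heat equation, set to 0 for \<open>t \<le> 0\<close> so
  that time integrals can run over the whole line without a cut-off.\<close>

definition heat :: "real \<Rightarrow> 'a::euclidean_space \<Rightarrow> real" where
  "heat t x = (if 0 < t then (4 * pi * t) powr (- (DIM('a) / 2)) * exp (- (norm x)\<^sup>2 / (4 * t)) else 0)"

lemma heat_nonneg [simp]: "0 \<le> heat t x"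
  by (simp add: heat_def)

lemma borel_measurable_heat [measurable (raw)]:
  assumes [measurable]: "f \<in> borel_measurable M" "g \<in> borel_measurable M"
  shows "(\<lambda>z. heat (f z) (g z)) \<in> borel_measurable M"
  unfolding heat_def by measurable

text \<open>\<open>heat t\<close> is the joint density of independent centred normal variables of
  variance 2t, one for each basis vector.\<close>

lemma nn_integral_heat:
  assumes t: "0 < t"
  shows "(\<integral>\<^sup>+x. heat t (x::'a::euclidean_space) \<partial>lborel) = 1"
proof -
  let ?N = "normal_density 0 (sqrt (2 * t))"
  have N1: "?N z = (4 * pi * t) powr (- (1 / 2)) * exp (- z\<^sup>2 / (4 * t))" for z
  proof -
    have "(4 * pi * t) powr (- (1 / 2)) = 1 / sqrt (4 * pi * t)"
      using t by (simp only: powr_minus_divide) (simp add: powr_half_sqrt)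
    moreover have "2 * pi * (sqrt (2 * t))\<^sup>2 = 4 * pi * t" "2 * (sqrt (2 * t))\<^sup>2 = 4 * t"
      using t by simp_all
    ultimately show ?thesis by (simp add: normal_density_def)
  qed
  have N: "(\<Prod>b\<in>Basis. ?N (x \<bullet> b)) = heat t x" for x :: 'a
  proof -
    have "(\<Prod>b\<in>Basis. ?N (x \<bullet> b))
        = (\<Prod>b\<in>(Basis::'a set). (4 * pi * t) powr (- (1 / 2))) * exp (\<Sum>b\<in>Basis. - (x \<bullet> b)\<^sup>2 / (4 * t))"
      unfolding N1 by (simp only: prod.distrib exp_sum[OF finite_Basis])
    also have "(\<Sum>b\<in>Basis. - (x \<bullet> b)\<^sup>2 / (4 * t)) = - (norm x)\<^sup>2 / (4 * t)"
      unfolding power2_norm_eq_inner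
      by (subst euclidean_inner) (simp add: sum_negf sum_divide_distrib[symmetric] power2_eq_square)
    also have "(\<Prod>b\<in>(Basis::'a set). (4 * pi * t) powr (- (1 / 2))) = (4 * pi * t) powr (- (DIM('a) / 2))"
      using t by (simp add: powr_power)
    finally show ?thesis using t by (simp add: heat_def)
  qed
  have "(\<integral>\<^sup>+x. heat t (x::'a) \<partial>lborel) = (\<integral>\<^sup>+x. (\<Prod>b\<in>Basis. ennreal (?N (x \<bullet> b))) \<partial>(lborel :: 'a measure))"
    by (simp add: N prod_ennreal)
  also have "\<dots> = (\<Prod>b\<in>(Basis::'a set). \<integral>\<^sup>+x. ennreal (?N x) \<partial>lborel)"
    by (rule nn_integral_lborel_prod) auto
  also have "(\<integral>\<^sup>+x. ennreal (?N x) \<partial>lborel) = 1"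
    using t by (subst nn_integral_eq_integral) auto
  finally show ?thesis by simp
qed

text \<open>Completing the square in \<open>x\<close>. Up to the factor
  \<open>heat (s + t) y\<close> the product is the law at time t of the bridge from 0 to y of
  duration s + t; the normalizing factors agree because s t = (s + t) (s t / (s + t)).\<close>

lemma heat_mult:
  fixes x y :: "'a::euclidean_space"
  assumes s: "0 < s" and t: "0 < t"
  shows "heat s (y - x) * heat t x = heat (s + t) y * heat (s * t / (s + t)) (- ((t / (s + t)) *\<^sub>R y) + x)"
proof -
  have P: "(4 * pi * s) powr p * (4 * pi * t) powr p
      = (4 * pi * (s + t)) powr p * (4 * pi * (s * t / (s + t))) powr p" for p
  proof -
    have "(4 * pi * s) * (4 * pi * t) = (4 * pi * (s + t)) * (4 * pi * (s * t / (s + t)))"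
      using s t by (simp add: field_simps)
    then show ?thesis using s t by (simp only: powr_mult[symmetric])
  qed
  define X Y Z where "X = x \<bullet> x" and "Y = y \<bullet> y" and "Z = x \<bullet> y"
  have E: "(norm (y - x))\<^sup>2 = Y - 2 * Z + X" "(norm x)\<^sup>2 = X" "(norm y)\<^sup>2 = Y"
    "(norm (- ((t / (s + t)) *\<^sub>R y) + x))\<^sup>2 = X - 2 * (t / (s + t)) * Z + (t / (s + t))\<^sup>2 * Y"
    unfolding power2_norm_eq_inner by (simp_all add: inner_simps X_def Y_def Z_def inner_commute power2_eq_square algebra_simps)
  have "- (Y - 2 * Z + X) / (4 * s) + - X / (4 * t) =
     - Y / (4 * (s + t)) + - (X - 2 * (t / (s + t)) * Z + (t / (s + t))\<^sup>2 * Y) / (4 * (s * t / (s + t)))"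
    using s t by (simp add: divide_simps) (simp add: algebra_simps power2_eq_square)
  then have Q: "exp (- (norm (y - x))\<^sup>2 / (4 * s)) * exp (- (norm x)\<^sup>2 / (4 * t)) =
     exp (- (norm y)\<^sup>2 / (4 * (s + t))) * exp (- (norm (- ((t / (s + t)) *\<^sub>R y) + x))\<^sup>2 / (4 * (s * t / (s + t))))"
    unfolding E exp_add[symmetric] by simp
  have "heat s (y - x) * heat t x = ((4 * pi * s) powr (- (DIM('a) / 2)) * (4 * pi * t) powr (- (DIM('a) / 2))) *
     (exp (- (norm (y - x))\<^sup>2 / (4 * s)) * exp (- (norm x)\<^sup>2 / (4 * t)))"
    using s t by (simp add: heat_def)
  also have "\<dots> = heat (s + t) y * heat (s * t / (s + t)) (- ((t / (s + t)) *\<^sub>R y) + x)"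
    unfolding P Q using s t by (simp add: heat_def)
  finally show ?thesis .
qed

text \<open>The semigroup property of the heat flow.\<close>

lemma nn_integral_heat_mult:
  fixes y :: "'a::euclidean_space"
  assumes s: "0 < s" and t: "0 < t"
  shows "(\<integral>\<^sup>+x. heat s (y - x) * heat t x \<partial>lborel) = heat (s + t) y"
proof -
  have "(\<integral>\<^sup>+x. heat s (y - x) * heat t x \<partial>lborel)
     = heat (s + t) y * (\<integral>\<^sup>+x. heat (s * t / (s + t)) (- ((t / (s + t)) *\<^sub>R y) + x) \<partial>lborel)"
    unfolding heat_mult[OF s t] by (simp add: ennreal_mult' nn_integral_cmult)
  also have "(\<integral>\<^sup>+x. heat (s * t / (s + t)) (- ((t / (s + t)) *\<^sub>R y) + x) \<partial>lborel) = 1"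
    using s t by (subst nn_integral_lborel_translate) (auto intro!: nn_integral_heat)
  finally show ?thesis by simp
qed

lemma integrable_heat: "0 < t \<Longrightarrow> integrable lborel (heat t :: 'a::euclidean_space \<Rightarrow> real)"
  by (rule integrableI_nonneg) (auto simp: nn_integral_heat)

lemma integral_heat: "0 < t \<Longrightarrow> (\<integral>x. heat t (x::'a::euclidean_space) \<partial>lborel) = 1"
  by (subst integral_eq_nn_integral) (auto simp: nn_integral_heat)

lemma integrable_heat_moment:
  assumes t: "0 < t"
  shows "integrable lborel (\<lambda>x. heat t (x::'a::euclidean_space) * (x \<bullet> b))"
proof (rule Bochner_Integration.integrable_bound)
  define K where "K = 2 powr (DIM('a) / 2) * norm b * (1 + 8 * t)"
  show "integrable lborel (\<lambda>x. K * heat (2 * t) (x::'a))"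
    using t by (intro integrable_mult_right integrable_heat) simp
  have "norm (heat t x * (x \<bullet> b)) \<le> norm (K * heat (2 * t) x)" for x :: 'a
  proof -
    \<comment> \<open>Half of the Gaussian exponent pays for the factor |x|, by |x| <= 1 + |x|^2 and
      exp z >= 1 + z at z = |x|^2 / (8t); what remains is a heat kernel at time 2t.\<close>
    have *: "norm x \<le> (1 + 8 * t) * exp ((norm x)\<^sup>2 / (8 * t))"
    proof -
      have "1 + (norm x)\<^sup>2 / (8 * t) \<le> exp ((norm x)\<^sup>2 / (8 * t))" by (rule exp_ge_add_one_self)
      then have "(1 + 8 * t) * (1 + (norm x)\<^sup>2 / (8 * t)) \<le> (1 + 8 * t) * exp ((norm x)\<^sup>2 / (8 * t))"
        using t by (intro mult_left_mono) auto
      moreover have "norm x \<le> 1 + (norm x)\<^sup>2"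
        using sum_squares_bound[of "norm x" 1] norm_ge_zero[of x] by (simp; linarith)
      moreover have "(1 + 8 * t) * (1 + (norm x)\<^sup>2 / (8 * t)) = 1 + 8 * t + (norm x)\<^sup>2 / (8 * t) + (norm x)\<^sup>2"
        using t by (simp add: field_simps)
      moreover have "0 \<le> 8 * t + (norm x)\<^sup>2 / (8 * t)" using t by simp
      ultimately show ?thesis by linarith
    qed
    have "norm (heat t x * (x \<bullet> b)) \<le> heat t x * (norm x * norm b)"
      by (simp add: abs_mult mult_left_mono Cauchy_Schwarz_ineq2)
    also have "\<dots> \<le> heat t x * ((1 + 8 * t) * exp ((norm x)\<^sup>2 / (8 * t)) * norm b)"
      by (intro mult_left_mono mult_right_mono *) auto
    also have "\<dots> = K * heat (2 * t) x"
    proof -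
      have "exp (- (norm x)\<^sup>2 / (4 * t)) * exp ((norm x)\<^sup>2 / (8 * t)) = exp (- (norm x)\<^sup>2 / (4 * (2 * t)))"
        unfolding exp_add[symmetric] using t by (simp add: field_simps)
      moreover have "(4 * pi * t) powr (- (DIM('a) / 2)) = 2 powr (DIM('a) / 2) * (4 * pi * (2 * t)) powr (- (DIM('a) / 2))"
      proof -
        have "(4 * pi * (2 * t)) = 2 * (4 * pi * t)" by simp
        then show ?thesis using t by (simp only: powr_mult) (simp add: powr_minus)
      qed
      ultimately show ?thesis using t by (simp add: heat_def K_def)
    qed
    finally show ?thesis by simp
  qed
  then show "AE x in lborel. norm (heat t x * ((x::'a) \<bullet> b)) \<le> norm (K * heat (2 * t) x)" by simp
qed simp

lemma integral_heat_moment: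
  "(\<integral>x. heat t (x::'a::euclidean_space) * (x \<bullet> b) \<partial>lborel) = 0"
proof -
  have "(\<integral>x. heat t (x::'a) * (x \<bullet> b) \<partial>lborel) = (\<integral>x. heat t (0 - x::'a) * ((0 - x) \<bullet> b) \<partial>lborel)"
    by (rule integral_lborel_reflect[symmetric]) simp
  also have "\<dots> = - (\<integral>x. heat t (x::'a) * (x \<bullet> b) \<partial>lborel)"
    by (subst integral_minus[symmetric]) (simp add: heat_def cong: if_cong)
  finally show ?thesis by simp
qed

text \<open>The mean of the Gaussian in \<open>heat_mult\<close>. Its numerator \<open>t\<close> is
  what later absorbs the singular time weight 1 / t of the dipole kernel.\<close>

lemma integral_heat_mult_moment:
  fixes y b :: "'a::euclidean_space"
  assumes s: "0 < s" and t: "0 < t"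
  shows "(\<integral>x. heat s (y - x) * heat t x * (x \<bullet> b) \<partial>lborel) = t / (s + t) * heat (s + t) y * (y \<bullet> b)"
proof -
  define m where "m = t / (s + t)"
  define r where "r = s * t / (s + t)"
  have r: "0 < r" using s t by (simp add: r_def)
  have "(\<integral>x. heat s (y - x) * heat t x * (x \<bullet> b) \<partial>lborel)
     = heat (s + t) y * (\<integral>x. heat r (- (m *\<^sub>R y) + x) * (x \<bullet> b) \<partial>lborel)"
    unfolding heat_mult[OF s t] m_def r_def by (simp add: mult.assoc)
  also have "(\<integral>x. heat r (- (m *\<^sub>R y) + x) * (x \<bullet> b) \<partial>lborel)
     = (\<integral>x. (\<lambda>x. heat r x * (x \<bullet> b) + m * (y \<bullet> b) * heat r x) (- (m *\<^sub>R y) + x) \<partial>lborel)"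
    by (intro Bochner_Integration.integral_cong) (simp_all add: inner_simps algebra_simps)
  also have "\<dots> = (\<integral>x. heat r x * (x \<bullet> b) + m * (y \<bullet> b) * heat r x \<partial>lborel)"
    by (rule integral_lborel_translate) simp
  also have "\<dots> = m * (y \<bullet> b)"
    using r by (subst Bochner_Integration.integral_add)
      (simp_all add: integrable_heat_moment integrable_heat integral_heat integral_heat_moment)
  finally show ?thesis by (simp add: m_def)
qed

text \<open>The substitution t -> |x|^2 / (4t) turns the time integral into Euler's integral for
  Gamma(n/2 - a). The values a = 1, 1/2 and 0 give the Newton kernel, |x|^(1-n) and the weight
  |x|^(-n) of the dipole; a = 3/2 appears after convolution.\<close>

lemma nn_integral_heat_powr:
  fixes x :: "'a::euclidean_space" and a :: real
  assumes x: "x \<noteq> 0" and a: "a < DIM('a) / 2"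
  shows "(\<integral>\<^sup>+t. t powr (a - 1) * heat t x \<partial>lborel)
    = ennreal (4 powr (-a) * pi powr (- (DIM('a) / 2)) * Gamma (DIM('a) / 2 - a) * norm x powr (2 * a - DIM('a)))"
proof -
  define z where "z = DIM('a) / 2 - a"
  define c where "c = (norm x)\<^sup>2 / 4"
  have z: "0 < z" and c: "0 < c" using x a by (simp_all add: z_def c_def)
  let ?f = "\<lambda>t::real. t powr (z - 1) / exp t"
  let ?g = "\<lambda>t::real. c / t"
  \<comment> \<open>The substitution is a bijection of the open half-line only, so the end point 0
    is removed first.\<close>
  have I: "(?f has_integral Gamma z) {0<..}"
  proof -
    have "((\<lambda>t. if t \<in> {0<..} then ?f t else 0) has_integral Gamma z) {0..}"
      by (rule has_integral_spike[OF _ _ Gamma_integral_real[OF z], of "{0}"]) auto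
    then show ?thesis by (subst (asm) has_integral_restrict) auto
  qed
  have "?f absolutely_integrable_on {0<..}"
    using I by (intro nonnegative_absolutely_integrable_1) (auto simp: has_integral_integrable)
  moreover have im: "?g ` {0<..} = {0<..}"
  proof -
    have "t \<in> ?g ` {0<..}" if "0 < t" for t
      using that c by (intro image_eqI[of _ _ "c / t"]) auto
    then show ?thesis using c by auto
  qed
  ultimately have "(\<lambda>t. \<bar>- c / t\<^sup>2\<bar> * ?f (?g t)) absolutely_integrable_on {0<..} \<and>
     integral {0<..} (\<lambda>t. \<bar>- c / t\<^sup>2\<bar> * ?f (?g t)) = Gamma z"
    using I c by (subst has_absolute_integral_change_of_variables_1')
      (auto simp: integral_unique inj_on_def power2_eq_square intro!: derivative_eq_intros)
  then have J: "((\<lambda>t. \<bar>- c / t\<^sup>2\<bar> * ?f (?g t)) has_integral Gamma z) {0<..}"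
    by (metis absolutely_integrable_on_def has_integral_integrable_integral)
  define k where "k = (4 * pi) powr (- (DIM('a) / 2)) * c powr (-z)"
  have "t powr (a - 1) * heat t x = k * (\<bar>- c / t\<^sup>2\<bar> * ?f (?g t))" if t: "0 < t" for t
  proof -
    have "t powr (a - 1) * heat t x = (4 * pi) powr (- (DIM('a) / 2)) * (t powr (a - 1) * t powr (- (DIM('a) / 2))) * exp (- (c / t))"
      using t by (simp add: heat_def c_def powr_mult)
    also have "t powr (a - 1) * t powr (- (DIM('a) / 2)) = t powr (- z - 1)"
      using t by (simp add: powr_add[symmetric] z_def algebra_simps)
    also have "t powr (- z - 1) = c powr (-z) * (c / t\<^sup>2 * (c / t) powr (z - 1))"
    proof -
      have "c powr (-z) * (c / t\<^sup>2 * (c / t) powr (z - 1)) = (c powr (-z) * c powr 1 * c powr (z - 1)) * (t powr (-2) * t powr (1 - z))"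
        using c t by (simp add: powr_divide powr_minus powr_realpow[of t 2, simplified] powr_diff divide_simps)
      also have "c powr (-z) * c powr 1 * c powr (z - 1) = 1"
        using c by (simp only: powr_add[symmetric]) simp
      also have "t powr (-2) * t powr (1 - z) = t powr (- z - 1)"
        by (simp only: powr_add[symmetric], rule arg_cong[where f="\<lambda>p. t powr p"]) simp
      finally show ?thesis by (simp only: mult_1)
    qed
    moreover have "\<bar>- c / t\<^sup>2\<bar> = c / t\<^sup>2" "exp (- (c / t)) = 1 / exp (c / t)"
      using c by (simp_all add: exp_minus inverse_eq_divide)
    ultimately show ?thesis by (simp only: k_def mult.assoc times_divide_eq_right mult_1_right)
  qed
  then have "((\<lambda>t. t powr (a - 1) * heat t x) has_integral k * Gamma z) {0<..}"
    by (intro has_integral_eq[OF _ has_integral_mult_right[OF J, of k]]) auto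
  then have "(\<integral>\<^sup>+t. indicator {0<..} t * (t powr (a - 1) * heat t x) \<partial>lborel) = ennreal (k * Gamma z)"
    by (intro nn_integral_has_integral_lebesgue) auto
  also have "(\<integral>\<^sup>+t. indicator {0<..} t * (t powr (a - 1) * heat t x) \<partial>lborel) = (\<integral>\<^sup>+t. t powr (a - 1) * heat t x \<partial>lborel)"
    by (intro nn_integral_cong) (auto simp: indicator_def heat_def)
  also have "k = 4 powr (-a) * pi powr (- (DIM('a) / 2)) * norm x powr (2 * a - DIM('a))"
  proof -
    have "c powr (-z) = (norm x powr 2) powr (-z) / 4 powr (-z)"
      using x by (simp add: c_def powr_divide)
    also have "\<dots> = norm x powr (2 * a - DIM('a)) * 4 powr z"
      unfolding powr_powr powr_minus[of 4 z] by (simp only: divide_inverse inverse_inverse_eq) (simp add: z_def)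
    finally have c': "c powr (-z) = norm x powr (2 * a - DIM('a)) * 4 powr z" .
    have p': "(4 * pi) powr (- (DIM('a) / 2)) = 4 powr (- (DIM('a) / 2)) * pi powr (- (DIM('a) / 2))"
      by (simp add: powr_mult)
    have q': "4 powr (-a) = 4 powr (- (DIM('a) / 2)) * 4 powr z"
      unfolding powr_add[symmetric] by (simp add: z_def)
    show ?thesis unfolding k_def c' p' q' by (simp only: mult_ac)
  qed
  finally show ?thesis by (simp add: z_def mult_ac)
qed

section \<open>The Newton kernel and its gradient\<close>

lemma nn_integral_powr_Ioo:
  assumes b: "0 < b" and r: "0 \<le> r"
  shows "(\<integral>\<^sup>+t. ennreal (t powr (b - 1)) * indicator {0<..<r} t \<partial>lborel) = ennreal (r powr b / b)"
proof -
  have "((\<lambda>t. t powr (b - 1)) has_integral (r powr b / b)) {0..r}"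
    using has_integral_powr_from_0[of "b - 1" r] b r by simp
  then have "((\<lambda>t. if t \<in> {0<..<r} then t powr (b - 1) else 0) has_integral (r powr b / b)) {0..r}"
    by (rule has_integral_spike[of "{0, r}", rotated 2]) auto
  then have "((\<lambda>t. t powr (b - 1)) has_integral (r powr b / b)) {0<..<r}"
    by (subst (asm) has_integral_restrict) auto
  then show ?thesis by (intro nn_integral_has_integral_lebesgue') auto
qed

text \<open>In the variables r = s + t and t, only the factor t^(b-1) still depends on t, and for
  fixed r the variable t runs over (0, r), which contributes r^b / b.\<close>

lemma nn_integral_powr_times_shift:
  fixes \<phi> :: "real \<Rightarrow> real"
  assumes [measurable]: "\<phi> \<in> borel_measurable borel"
    and nonneg: "\<And>r. 0 \<le> \<phi> r" and zero: "\<And>r. r \<le> 0 \<Longrightarrow> \<phi> r = 0" and b: "0 < b"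
  shows "(\<integral>\<^sup>+t. (\<integral>\<^sup>+s. ennreal (indicator {0<..} t * t powr (b - 1) * (indicator {0<..} s * \<phi> (s + t))) \<partial>lborel) \<partial>lborel)
     = (\<integral>\<^sup>+r. ennreal (r powr b / b * \<phi> r) \<partial>lborel)"
proof -
  have "(\<integral>\<^sup>+s. ennreal (indicator {0<..} t * t powr (b - 1) * (indicator {0<..} s * \<phi> (s + t))) \<partial>lborel)
      = (\<integral>\<^sup>+r. ennreal (indicator {0<..} t * t powr (b - 1) * (indicator {t<..} r * \<phi> r)) \<partial>lborel)" for t
    by (subst nn_integral_lborel_translate[of _ t, symmetric])
       (auto intro!: nn_integral_cong simp: indicator_def add.commute)
  then have "(\<integral>\<^sup>+t. (\<integral>\<^sup>+s. ennreal (indicator {0<..} t * t powr (b - 1) * (indicator {0<..} s * \<phi> (s + t))) \<partial>lborel) \<partial>lborel)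
     = (\<integral>\<^sup>+t. (\<integral>\<^sup>+r. ennreal (indicator {0<..} t * t powr (b - 1) * (indicator {t<..} r * \<phi> r)) \<partial>lborel) \<partial>lborel)"
    by simp
  also have "\<dots> = (\<integral>\<^sup>+r. (\<integral>\<^sup>+t. ennreal (indicator {0<..} t * t powr (b - 1) * (indicator {t<..} r * \<phi> r)) \<partial>lborel) \<partial>lborel)"
  proof (rule lborel_pair.Fubini')
    have [measurable]: "Measurable.pred (borel \<Otimes>\<^sub>M borel) (\<lambda>p::real\<times>real. fst p < snd p)" by measurable
    have "(\<lambda>p::real\<times>real. indicator {fst p<..} (snd p)::real) = (\<lambda>p. if fst p < snd p then 1 else 0)"
      by (auto simp: indicator_def)
    then have [measurable]: "(\<lambda>p::real\<times>real. indicator {fst p<..} (snd p)::real) \<in> borel_measurable (borel \<Otimes>\<^sub>M borel)"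
      by simp
    show "(\<lambda>(r, t). ennreal (indicator {0<..} t * t powr (b - 1) * (indicator {t<..} r * \<phi> r)))
        \<in> borel_measurable (lborel \<Otimes>\<^sub>M lborel)"
    proof -
      have "(\<lambda>(r, t). ennreal (indicator {0<..} t * t powr (b - 1) * (indicator {t<..} r * \<phi> r)))
        = (\<lambda>p. ennreal (indicator {0<..} (snd p) * snd p powr (b - 1) * ((if snd p < fst p then 1 else 0) * \<phi> (fst p))))"
        by (auto simp: fun_eq_iff indicator_def)
      then show ?thesis by simp
    qed
  qed
  also have "\<dots> = (\<integral>\<^sup>+r. ennreal (r powr b / b * \<phi> r) \<partial>lborel)"
  proof (intro nn_integral_cong)
    fix r :: real
    show "(\<integral>\<^sup>+t. ennreal (indicator {0<..} t * t powr (b - 1) * (indicator {t<..} r * \<phi> r)) \<partial>lborel)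
       = ennreal (r powr b / b * \<phi> r)"
    proof (cases "0 < r")
      case True
      have "(\<integral>\<^sup>+t. ennreal (indicator {0<..} t * t powr (b - 1) * (indicator {t<..} r * \<phi> r)) \<partial>lborel)
         = (\<integral>\<^sup>+t. (ennreal (t powr (b - 1)) * indicator {0<..<r} t) * ennreal (\<phi> r) \<partial>lborel)"
        by (intro nn_integral_cong) (auto simp: indicator_def ennreal_mult nonneg)
      also have "\<dots> = ennreal (r powr b / b) * ennreal (\<phi> r)"
        using True by (subst nn_integral_multc) (auto simp: nn_integral_powr_Ioo[OF b])
      also have "\<dots> = ennreal (r powr b / b * \<phi> r)" by (rule ennreal_mult''[symmetric]) (rule nonneg)
      finally show ?thesis .
    next
      case False
      then show ?thesis by (simp add: zero)
    qed
  qed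
  finally show ?thesis .
qed

lemma measurable_fst_borel [measurable]: "fst \<in> (borel :: ('a::second_countable_topology \<times> 'b::second_countable_topology) measure) \<rightarrow>\<^sub>M borel"
  by (intro borel_measurable_continuous_onI continuous_intros)

lemma measurable_snd_borel [measurable]: "snd \<in> (borel :: ('a::second_countable_topology \<times> 'b::second_countable_topology) measure) \<rightarrow>\<^sub>M borel"
  by (intro borel_measurable_continuous_onI continuous_intros)

text \<open>The coefficient found in \<open>nn_integral_heat_powr\<close>, for dimension
  \<open>n\<close>.\<close>

definition heat_const :: "nat \<Rightarrow> real \<Rightarrow> real" where
  "heat_const n a = 4 powr (-a) * pi powr (- (n / 2)) * Gamma (n / 2 - a)"

lemma heat_const_pos: "a < n / 2 \<Longrightarrow> 0 < heat_const n a"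
  by (simp add: heat_const_def Gamma_real_pos)

text \<open>Both kernels at once as a single integral over pairs of times; in this form an integral
  over x can be moved inside.\<close>

lemma nn_integral_heat_newton_pair:
  fixes x y :: "'a::euclidean_space" and a :: real
  assumes n: "2 < DIM('a)" and xy: "x \<noteq> 0" "y \<noteq> x" and a: "a < DIM('a) / 2"
  shows "(\<integral>\<^sup>+(s, t). ennreal (heat s (y - x) * (t powr (a - 1) * heat t x)) \<partial>lborel)
    = ennreal (heat_const DIM('a) 1 * norm (y - x) powr (2 - real DIM('a)) *
              (heat_const DIM('a) a * norm x powr (2 * a - DIM('a))))"
proof -
  have "(\<integral>\<^sup>+(s, t). ennreal (heat s (y - x) * (t powr (a - 1) * heat t x)) \<partial>(lborel :: (real \<times> real) measure))
     = (\<integral>\<^sup>+s. \<integral>\<^sup>+t. ennreal (heat s (y - x) * (t powr (a - 1) * heat t x)) \<partial>lborel \<partial>lborel)"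
    unfolding lborel_prod[symmetric] by (subst lborel.nn_integral_fst[symmetric]) auto
  also have "\<dots> = (\<integral>\<^sup>+s. ennreal (s powr (1 - 1) * heat s (y - x)) *
       ennreal (heat_const DIM('a) a * norm x powr (2 * a - DIM('a))) \<partial>lborel)"
  proof (intro nn_integral_cong)
    fix s
    have "(\<integral>\<^sup>+t. ennreal (heat s (y - x) * (t powr (a - 1) * heat t x)) \<partial>lborel)
        = ennreal (heat s (y - x)) * (\<integral>\<^sup>+t. ennreal (t powr (a - 1) * heat t x) \<partial>lborel)"
      by (subst nn_integral_cmult[symmetric]) (auto simp: ennreal_mult')
    also have "(\<integral>\<^sup>+t. ennreal (t powr (a - 1) * heat t x) \<partial>lborel)
        = ennreal (heat_const DIM('a) a * norm x powr (2 * a - DIM('a)))"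
      unfolding heat_const_def using xy a by (intro nn_integral_heat_powr)
    finally have E: "(\<integral>\<^sup>+t. ennreal (heat s (y - x) * (t powr (a - 1) * heat t x)) \<partial>lborel)
      = ennreal (heat s (y - x)) * ennreal (heat_const DIM('a) a * norm x powr (2 * a - DIM('a)))" .
    \<comment> \<open>\<open>0 powr 0\<close> is 0, which does no harm because \<open>heat 0\<close>
      vanishes.\<close>
    have h: "s powr (1 - 1) * heat s (y - x) = heat s (y - x)"
      by (simp add: heat_def)
    show "(\<integral>\<^sup>+t. ennreal (heat s (y - x) * (t powr (a - 1) * heat t x)) \<partial>lborel)
      = ennreal (s powr (1 - 1) * heat s (y - x)) *
       ennreal (heat_const DIM('a) a * norm x powr (2 * a - DIM('a)))"
      by (simp only: E h)
  qed
  also have "\<dots> = (\<integral>\<^sup>+s. ennreal (s powr (1 - 1) * heat s (y - x)) \<partial>lborel) *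
       ennreal (heat_const DIM('a) a * norm x powr (2 * a - DIM('a)))"
    by (rule nn_integral_multc) measurable
  also have "(\<integral>\<^sup>+s. ennreal (s powr (1 - 1) * heat s (y - x)) \<partial>lborel)
      = ennreal (heat_const DIM('a) 1 * norm (y - x) powr (2 * 1 - real DIM('a)))"
    unfolding heat_const_def using xy n by (intro nn_integral_heat_powr) auto
  finally show ?thesis
    using heat_const_pos[of 1 "DIM('a)"] n by (simp add: ennreal_mult')
qed

text \<open>A case of the composition law of Riesz kernels, and the majorant for the dipole
  convolution. In time variables the integral over x is the semigroup property, and integrating
  t^(-1/2) over s + t = r leaves 2 r^(1/2) \<open>heat r y\<close>, so the time exponent becomes a =
  3/2; n > 3 makes this value admissible.\<close>

lemma nn_integral_newton_mult_powr:
  assumes n: "3 < DIM('a::euclidean_space)"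
  shows "\<exists>C\<ge>0. \<forall>y::'a. y \<noteq> 0 \<longrightarrow>
    (\<integral>\<^sup>+x. norm (y - x) powr (2 - real DIM('a)) * norm x powr (1 - real DIM('a)) \<partial>lborel) = ennreal (C * norm y powr (3 - real DIM('a)))"
proof -
  define c where "c = heat_const DIM('a) 1 * heat_const DIM('a) (1/2)"
  define d where "d = 2 * heat_const DIM('a) (3/2)"
  have c: "0 < c" and d: "0 < d"
    using n by (auto simp: c_def d_def intro!: mult_pos_pos heat_const_pos)
  have "(\<integral>\<^sup>+x. norm (y - x) powr (2 - real DIM('a)) * norm x powr (1 - real DIM('a)) \<partial>lborel) = ennreal (d / c * norm y powr (3 - real DIM('a)))"
    if y: "y \<noteq> 0" for y :: 'a
  proof -
    let ?I = "\<integral>\<^sup>+x. norm (y - x) powr (2 - real DIM('a)) * norm x powr (1 - real DIM('a)) \<partial>lborel"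
    have "ennreal c * ?I = (\<integral>\<^sup>+x. \<integral>\<^sup>+(s, t). ennreal (heat s (y - x) * (t powr (1/2 - 1) * heat t x)) \<partial>lborel \<partial>lborel)"
    proof (subst nn_integral_cmult[symmetric], simp, intro nn_integral_cong_AE)
      show "AE x in lborel. ennreal c * ennreal (norm (y - x) powr (2 - real DIM('a)) * norm x powr (1 - real DIM('a)))
         = (\<integral>\<^sup>+(s, t). ennreal (heat s (y - x) * (t powr (1/2 - 1) * heat t x)) \<partial>lborel)"
        using AE_lborel_singleton[of "0::'a"] AE_lborel_singleton[of y]
      proof eventually_elim
        case (elim x)
        then show ?case using n c
          by (subst nn_integral_heat_newton_pair) (auto simp: c_def ennreal_mult'[symmetric] mult_ac)
      qed
    qed
    also have "\<dots> = (\<integral>\<^sup>+(s, t). \<integral>\<^sup>+x. ennreal (heat s (y - x) * (t powr (1/2 - 1) * heat t x)) \<partial>lborel \<partial>lborel)"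
      by (subst lborel_pair.Fubini') (auto simp: case_prod_beta')
    also have "\<dots> = (\<integral>\<^sup>+(s, t). ennreal (indicator {0<..} t * t powr (1/2 - 1) * (indicator {0<..} s * heat (s + t) y)) \<partial>lborel)"
    proof (intro nn_integral_cong, clarify)
      fix s t :: real
      show "(\<integral>\<^sup>+x. ennreal (heat s (y - x) * (t powr (1/2 - 1) * heat t x)) \<partial>lborel)
         = ennreal (indicator {0<..} t * t powr (1/2 - 1) * (indicator {0<..} s * heat (s + t) y))"
      proof (cases "0 < s \<and> 0 < t")
        case True
        have "(\<integral>\<^sup>+x. ennreal (heat s (y - x) * (t powr (1/2 - 1) * heat t x)) \<partial>lborel)
          = ennreal (t powr (1/2 - 1)) * (\<integral>\<^sup>+x. heat s (y - x) * heat t x \<partial>lborel)"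
          by (subst nn_integral_cmult[symmetric]) (auto simp: ennreal_mult'[symmetric] mult_ac)
        also have "(\<integral>\<^sup>+x. heat s (y - x) * heat t x \<partial>lborel) = heat (s + t) y"
          using True by (intro nn_integral_heat_mult) auto
        finally show ?thesis using True by (simp add: ennreal_mult')
      qed (auto simp: heat_def)
    qed
    also have "\<dots> = (\<integral>\<^sup>+t. \<integral>\<^sup>+s. ennreal (indicator {0<..} t * t powr (1/2 - 1) * (indicator {0<..} s * heat (s + t) y)) \<partial>lborel \<partial>lborel)"
      unfolding lborel_prod[symmetric] by (subst lborel_pair.nn_integral_snd[symmetric]) auto
    also have "\<dots> = (\<integral>\<^sup>+r. ennreal (r powr (1/2) / (1/2) * heat r y) \<partial>lborel)"
      by (rule nn_integral_powr_times_shift) (auto simp: heat_def)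
    also have "\<dots> = ennreal 2 * (\<integral>\<^sup>+r. ennreal (r powr (3/2 - 1) * heat r y) \<partial>lborel)"
      by (subst nn_integral_cmult[symmetric]) (simp_all add: ennreal_mult' mult_ac)
    also have "(\<integral>\<^sup>+r. ennreal (r powr (3/2 - 1) * heat r y) \<partial>lborel) = ennreal (heat_const DIM('a) (3/2) * norm y powr (2 * (3/2) - DIM('a)))"
      unfolding heat_const_def using y n by (intro nn_integral_heat_powr) auto
    also have "ennreal 2 * \<dots> = ennreal c * ennreal (d / c * norm y powr (3 - real DIM('a)))"
      using c d by (simp add: d_def ennreal_mult'[symmetric] ennreal_mult''[symmetric] del: ennreal_numeral flip: ennreal_numeral)
    finally have "ennreal c * ?I = ennreal c * ennreal (d / c * norm y powr (3 - real DIM('a)))" .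
    then show ?thesis using c by (simp add: ennreal_mult_cancel_left)
  qed
  then show ?thesis using c d by (intro exI[of _ "d / c"]) auto
qed

text \<open>The one constant whose value matters: in the dipole convolution
  \<open>heat_const n 1\<close> occurs on both sides and cancels.\<close>

lemma heat_const_0: "0 < n \<Longrightarrow> heat_const n 0 = 2 / omega n"
proof -
  assume n: "0 < n"
  have "Gamma (real n / 2 + 1) = real n / 2 * Gamma (real n / 2)"
    using n by (intro Gamma_plus1) auto
  moreover have "Gamma (real n / 2) > 0" using n by (intro Gamma_real_pos) auto
  ultimately show ?thesis
    using n by (simp add: heat_const_def omega_def unit_ball_vol_def powr_minus field_simps)
qed

text \<open>The signed kernel has the time weight 1 / t, from a = 0. By
  \<open>integral_heat_mult_moment\<close> the integral over x turns this weight into 1 / (s + t),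
  and the segment s + t = r has length r, so only the time integral of \<open>heat r y\<close>
  remains. With the normalizing factors restored this is Gamma * P_j = y_j Gamma / 2.\<close>

lemma newton_convolution_dipole:
  fixes y b :: "'a::euclidean_space"
  assumes n: "3 < DIM('a)" and y: "y \<noteq> 0"
  defines "g \<equiv> \<lambda>x. norm (y - x) powr (2 - real DIM('a)) * (norm x powr (- real DIM('a)) * (x \<bullet> b))"
  shows "integrable lborel g"
    and "(\<integral>x. g x \<partial>lborel) = omega DIM('a) / 2 * (norm y powr (2 - real DIM('a)) * (y \<bullet> b))"
proof -
  define c1 c0 where "c1 = heat_const DIM('a) 1" and "c0 = heat_const DIM('a) 0"
  have c: "0 < c1" "0 < c0" using n by (auto simp: c1_def c0_def intro!: heat_const_pos)
  define F where "F x p = heat (fst p) (y - x) * (snd p powr (0 - 1) * heat (snd p) x) * (x \<bullet> b)" for x p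
  have [measurable]: "(\<lambda>z. F (fst z) (snd z)) \<in> borel_measurable (lborel \<Otimes>\<^sub>M lborel)"
    "F x \<in> borel_measurable borel" "(\<lambda>x. F x p) \<in> borel_measurable borel" for x p
    unfolding F_def by measurable
  have P: "(\<integral>\<^sup>+p. ennreal (heat (fst p) (y - x) * (snd p powr (0 - 1) * heat (snd p) x)) \<partial>lborel)
      = ennreal (c1 * norm (y - x) powr (2 - real DIM('a)) * (c0 * norm x powr (- real DIM('a))))"
    if "x \<noteq> 0" "x \<noteq> y" for x
    using nn_integral_heat_newton_pair[of x y 0] that n by (simp add: c1_def c0_def case_prod_beta')
  have I: "(\<integral>p. F x p \<partial>lborel) = c1 * c0 * g x" if "x \<noteq> 0" "x \<noteq> y" for x
  proof -
    have "(\<integral>p. heat (fst p) (y - x) * (snd p powr (0 - 1) * heat (snd p) x) \<partial>lborel)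
      = c1 * norm (y - x) powr (2 - real DIM('a)) * (c0 * norm x powr (- real DIM('a)))"
    proof -
      have "(\<integral>p. heat (fst p) (y - x) * (snd p powr (0 - 1) * heat (snd p) x) \<partial>lborel)
        = enn2real (\<integral>\<^sup>+p. ennreal (heat (fst p) (y - x) * (snd p powr (0 - 1) * heat (snd p) x)) \<partial>lborel)"
        by (rule integral_eq_nn_integral) auto
      then show ?thesis unfolding P[OF that] using c by simp
    qed
    then show ?thesis unfolding F_def g_def by (simp only: integral_mult_left_zero) (simp add: mult_ac)
  qed
  \<comment> \<open>The factor |x| from |x . b| <= |x| |b| lowers the singularity |x|^(-n), which is
    not integrable at 0, to |x|^(1-n).\<close>
  have fin: "(\<integral>\<^sup>+z. norm (F (fst z) (snd z)) \<partial>(lborel \<Otimes>\<^sub>M lborel)) < \<infinity>"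
  proof -
    obtain C where C: "C \<ge> 0" "(\<integral>\<^sup>+x. norm (y - x) powr (2 - real DIM('a)) * norm x powr (1 - real DIM('a)) \<partial>lborel) = ennreal (C * norm y powr (3 - real DIM('a)))"
      using nn_integral_newton_mult_powr[where 'a='a] n y by blast
    have "(\<integral>\<^sup>+z. norm (F (fst z) (snd z)) \<partial>(lborel \<Otimes>\<^sub>M lborel)) = (\<integral>\<^sup>+x. \<integral>\<^sup>+p. norm (F x p) \<partial>lborel \<partial>lborel)"
      by (subst lborel.nn_integral_fst[symmetric]) auto
    also have "\<dots> \<le> (\<integral>\<^sup>+x. ennreal (c1 * c0 * norm b) * ennreal (norm (y - x) powr (2 - real DIM('a)) * norm x powr (1 - real DIM('a))) \<partial>lborel)"
    proof (intro nn_integral_mono_AE)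
      show "AE x in lborel. (\<integral>\<^sup>+p. norm (F x p) \<partial>lborel)
        \<le> ennreal (c1 * c0 * norm b) * ennreal (norm (y - x) powr (2 - real DIM('a)) * norm x powr (1 - real DIM('a)))"
        using AE_lborel_singleton[of "0::'a"] AE_lborel_singleton[of y]
      proof eventually_elim
        case (elim x)
        have "(\<integral>\<^sup>+p. norm (F x p) \<partial>lborel)
          = (\<integral>\<^sup>+p. ennreal (heat (fst p) (y - x) * (snd p powr (0 - 1) * heat (snd p) x)) * ennreal \<bar>x \<bullet> b\<bar> \<partial>lborel)"
          by (intro nn_integral_cong, subst ennreal_mult''[symmetric]) (simp_all add: F_def abs_mult)
        also have "\<dots> = (\<integral>\<^sup>+p. ennreal (heat (fst p) (y - x) * (snd p powr (0 - 1) * heat (snd p) x)) \<partial>lborel) * ennreal \<bar>x \<bullet> b\<bar>"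
          by (rule nn_integral_multc) measurable
        also have "\<dots> = ennreal (c1 * norm (y - x) powr (2 - real DIM('a)) * (c0 * norm x powr (- real DIM('a)))) * ennreal \<bar>x \<bullet> b\<bar>"
          by (simp only: P[OF elim])
        also have "\<dots> = ennreal (c1 * norm (y - x) powr (2 - real DIM('a)) * (c0 * norm x powr (- real DIM('a))) * \<bar>x \<bullet> b\<bar>)"
          by (rule ennreal_mult''[symmetric]) simp
        also have "\<dots> \<le> ennreal (c1 * norm (y - x) powr (2 - real DIM('a)) * (c0 * norm x powr (- real DIM('a))) * (norm x * norm b))"
          using c by (intro ennreal_leI mult_left_mono Cauchy_Schwarz_ineq2) auto
        also have "c1 * norm (y - x) powr (2 - real DIM('a)) * (c0 * norm x powr (- real DIM('a))) * (norm x * norm b)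
          = (c1 * c0 * norm b) * (norm (y - x) powr (2 - real DIM('a)) * norm x powr (1 - real DIM('a)))"
        proof -
          have "norm x powr (1 - real DIM('a)) = norm x powr (- real DIM('a)) * norm x"
            using elim powr_add[of "norm x" "- real DIM('a)" 1] by simp
          then show ?thesis by (simp add: mult_ac)
        qed
        also have "ennreal \<dots> = ennreal (c1 * c0 * norm b) * ennreal (norm (y - x) powr (2 - real DIM('a)) * norm x powr (1 - real DIM('a)))"
          by (rule ennreal_mult'') simp
        finally show ?case .
      qed
    qed
    also have "\<dots> = ennreal (c1 * c0 * norm b) * ennreal (C * norm y powr (3 - real DIM('a)))"
      by (subst nn_integral_cmult) (auto simp: C)
    also have "\<dots> < \<infinity>" by (simp add: ennreal_mult_less_top)
    finally show ?thesis .
  qed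
  then have int: "integrable (lborel \<Otimes>\<^sub>M lborel) (\<lambda>z. F (fst z) (snd z))"
    by (intro integrableI_bounded) auto
  then have int': "integrable (lborel \<Otimes>\<^sub>M lborel) (case_prod F)"
    by (simp add: case_prod_beta')
  have AE: "AE x in lborel. (\<integral>p. F x p \<partial>lborel) = c1 * c0 * g x"
    using AE_lborel_singleton[of "0::'a"] AE_lborel_singleton[of y] by eventually_elim (rule I)
  have gm [measurable]: "g \<in> borel_measurable borel" unfolding g_def by measurable
  have "integrable lborel (\<lambda>x. \<integral>p. F x p \<partial>lborel)"
    using lborel_pair.integrable_fst[OF int'] by simp
  then have "integrable lborel (\<lambda>x. c1 * c0 * g x)"
    using AE by (subst (asm) integrable_cong_AE) auto
  then show "integrable lborel g" using c by simp
  have "c1 * c0 * (\<integral>x. g x \<partial>lborel) = (\<integral>x. (\<integral>p. F x p \<partial>lborel) \<partial>lborel)"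
    using AE by (subst integral_mult_right_zero[symmetric], intro integral_cong_AE) (auto intro: borel_measurable_integrable lborel_pair.integrable_fst[OF int'])
  also have "\<dots> = (\<integral>p. (\<integral>x. F x p \<partial>lborel) \<partial>lborel)"
    by (rule lborel_pair.Fubini_integral[OF int', symmetric])
  also have "\<dots> = (\<integral>p. (indicator {0<..} (snd p) * snd p powr (1 - 1) * (indicator {0<..} (fst p) * (heat (fst p + snd p) y / (fst p + snd p)))) * (y \<bullet> b) \<partial>lborel)"
  proof (intro Bochner_Integration.integral_cong refl)
    fix p :: "real \<times> real"
    obtain s t where p: "p = (s, t)" by (cases p)
    show "(\<integral>x. F x p \<partial>lborel) = (indicator {0<..} (snd p) * snd p powr (1 - 1) * (indicator {0<..} (fst p) * (heat (fst p + snd p) y / (fst p + snd p)))) * (y \<bullet> b)"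
    proof (cases "0 < s \<and> 0 < t")
      case True
      have "(\<integral>x. F x p \<partial>lborel) = (\<integral>x. t powr (0 - 1) * (heat s (y - x) * heat t x * (x \<bullet> b)) \<partial>lborel)"
        by (simp add: F_def p mult_ac)
      also have "\<dots> = t powr (0 - 1) * (t / (s + t) * heat (s + t) y * (y \<bullet> b))"
        using True by (simp add: integral_heat_mult_moment)
      also have "t powr (0 - 1) = 1 / t" using True by (simp add: powr_minus_divide)
      finally show ?thesis using True by (simp add: p)
    qed (auto simp: F_def p heat_def)
  qed
  also have "\<dots> = c1 * norm y powr (2 - real DIM('a)) * (y \<bullet> b)"
  proof -
    let ?h = "\<lambda>p. indicator {0<..} (snd p) * snd p powr (1 - 1) * (indicator {0<..} (fst p) * (heat (fst p + snd p) y / (fst p + snd p)))"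
    have "(\<integral>\<^sup>+p. ennreal (?h p) \<partial>lborel)
      = (\<integral>\<^sup>+t. \<integral>\<^sup>+s. ennreal (indicator {0<..} t * t powr (1 - 1) * (indicator {0<..} s * (heat (s + t) y / (s + t)))) \<partial>lborel \<partial>lborel)"
      unfolding lborel_prod[symmetric] by (subst lborel_pair.nn_integral_snd[symmetric]) auto
    also have "\<dots> = (\<integral>\<^sup>+r. ennreal (r powr 1 / 1 * (heat r y / r)) \<partial>lborel)"
      by (rule nn_integral_powr_times_shift) (auto simp: heat_def)
    also have "\<dots> = (\<integral>\<^sup>+r. ennreal (r powr (1 - 1) * heat r y) \<partial>lborel)"
      by (intro nn_integral_cong) (auto simp: heat_def)
    also have "\<dots> = ennreal (c1 * norm y powr (2 * 1 - real DIM('a)))"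
      unfolding c1_def heat_const_def using y n by (intro nn_integral_heat_powr) auto
    finally have "(\<integral>p. ?h p \<partial>lborel) = c1 * norm y powr (2 - real DIM('a))"
      using c by (subst integral_eq_nn_integral) (auto simp: heat_def)
    then show ?thesis by (simp only: integral_mult_left_zero)
  qed
  finally show "(\<integral>x. g x \<partial>lborel) = omega DIM('a) / 2 * (norm y powr (2 - real DIM('a)) * (y \<bullet> b))"
    using c n heat_const_0[of "DIM('a)"] by (simp add: c0_def field_simps)
qed

section \<open>Riesz potentials, uniformly in the base point\<close>

lemma borel_measurable_indicator_ball [measurable (raw)]:
  assumes "f \<in> borel_measurable M"
  shows "(\<lambda>x. indicator (ball c R) (f x) :: ennreal) \<in> borel_measurable M"
    and "(\<lambda>x. indicator (ball c R) (f x) :: real) \<in> borel_measurable M"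
  by (rule measurable_compose[OF assms borel_measurable_indicator], simp)+

text \<open>Within distance 1 of y the bound \<open>A\<close> and the local integrability of the
  kernel are used; outside, the kernel is at most 1 and the L^1 norm of \<open>g\<close> suffices.
  Neither estimate depends on y.\<close>

lemma nn_integral_riesz_bounded:
  fixes g :: "'a::euclidean_space \<Rightarrow> real" and m :: real
  assumes m: "0 \<le> m" "m < DIM('a)" and g: "\<And>x. \<bar>g x\<bar> \<le> A" and int: "integrable lborel g"
  shows "\<exists>B\<ge>0. \<forall>y. (\<integral>\<^sup>+x. norm (y - x) powr (- m) * \<bar>g x\<bar> \<partial>lborel) \<le> ennreal B"
proof -
  have [measurable]: "g \<in> borel_measurable borel" using int by (simp add: borel_measurable_integrable)
  have A: "0 \<le> A" using g[of 0] by linarith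
  obtain C where C: "C \<ge> 0" "\<And>R. R > 0 \<Longrightarrow>
      (\<integral>\<^sup>+x. ennreal (norm x powr (-m)) * indicator (ball 0 R) (x::'a) \<partial>lborel) \<le> ennreal (C * R powr (DIM('a) - m))"
    using nn_integral_ball_norm_powr_le[where 'a='a, OF m] by blast
  define L where "L = (\<integral>x. \<bar>g x\<bar> \<partial>lborel)"
  have L: "0 \<le> L" "(\<integral>\<^sup>+x. \<bar>g x\<bar> \<partial>lborel) = ennreal L"
    unfolding L_def using int by (auto intro: nn_integral_eq_integral)
  have "(\<integral>\<^sup>+x. norm (y - x) powr (- m) * \<bar>g x\<bar> \<partial>lborel) \<le> ennreal (A * C + L)" for y
  proof -
    have "(\<integral>\<^sup>+x. norm (y - x) powr (- m) * \<bar>g x\<bar> \<partial>lborel)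
      \<le> (\<integral>\<^sup>+x. ennreal A * (ennreal (norm (y - x) powr (-m)) * indicator (ball 0 1) (y - x)) + ennreal \<bar>g x\<bar> \<partial>lborel)"
    proof (intro nn_integral_mono)
      fix x
      show "ennreal (norm (y - x) powr (- m) * \<bar>g x\<bar>)
        \<le> ennreal A * (ennreal (norm (y - x) powr (-m)) * indicator (ball 0 1) (y - x)) + ennreal \<bar>g x\<bar>"
      proof (cases "norm (y - x) < 1")
        case True
        have "norm (y - x) powr (- m) * \<bar>g x\<bar> \<le> norm (y - x) powr (- m) * A"
          by (intro mult_left_mono g) auto
        also have "\<dots> \<le> A * norm (y - x) powr (- m) + \<bar>g x\<bar>" by simp
        finally show ?thesis using True A
          by (simp add: ennreal_mult'[symmetric] ennreal_plus[symmetric] ennreal_leI del: ennreal_plus)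
      next
        case False
        then have "norm (y - x) powr (- m) \<le> 1 powr (- m)" using m by (intro powr_mono2') auto
        then have "norm (y - x) powr (- m) * \<bar>g x\<bar> \<le> 1 * \<bar>g x\<bar>" by (intro mult_right_mono) auto
        then show ?thesis using False by (simp add: ennreal_leI)
      qed
    qed
    also have "\<dots> = ennreal A * (\<integral>\<^sup>+x. ennreal (norm (y - x) powr (-m)) * indicator (ball 0 1) (y - x) \<partial>lborel) + ennreal L"
      by (subst nn_integral_add) (auto simp: nn_integral_cmult L)
    also have "(\<integral>\<^sup>+x. ennreal (norm (y - x) powr (-m)) * indicator (ball 0 1) (y - x) \<partial>lborel)
       = (\<integral>\<^sup>+x. ennreal (norm x powr (-m)) * indicator (ball 0 1) (x::'a) \<partial>lborel)"
      by (rule nn_integral_lborel_reflect) simp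
    also have "ennreal A * \<dots> + ennreal L \<le> ennreal A * ennreal C + ennreal L"
      using C(2)[of 1] by (intro add_mono mult_left_mono) auto
    finally have "(\<integral>\<^sup>+x. norm (y - x) powr (- m) * \<bar>g x\<bar> \<partial>lborel) \<le> ennreal A * ennreal C + ennreal L" .
    then show ?thesis using A C(1) L(1) by (simp add: ennreal_mult'[symmetric] ennreal_plus[symmetric] del: ennreal_plus)
  qed
  then show ?thesis using A C(1) L(1) by (intro exI[of _ "A * C + L"]) auto
qed

text \<open>Either |y - x| < R, and the contribution is at most that of a ball around y, or |x| < R
  <= |y - x|, and moving the pole from y to 0 only increases the integrand. Each case costs one
  centred integral, hence the factor 2.\<close>

lemma nn_integral_riesz_ball_le:
  fixes m :: real
  assumes m: "0 \<le> m" "m < DIM('a::euclidean_space)"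
  shows "\<exists>C\<ge>0. \<forall>R>0. \<forall>y. (\<integral>\<^sup>+x. ennreal (norm (y - x) powr (-m)) * indicator (ball 0 R) (x::'a) \<partial>lborel)
                \<le> ennreal (C * R powr (DIM('a) - m))"
proof -
  obtain C where C: "C \<ge> 0" "\<And>R. R > 0 \<Longrightarrow>
      (\<integral>\<^sup>+x. ennreal (norm x powr (-m)) * indicator (ball 0 R) (x::'a) \<partial>lborel) \<le> ennreal (C * R powr (DIM('a) - m))"
    using nn_integral_ball_norm_powr_le[where 'a='a, OF m] by blast
  have "(\<integral>\<^sup>+x. ennreal (norm (y - x) powr (-m)) * indicator (ball 0 R) (x::'a) \<partial>lborel)
      \<le> ennreal (2 * C * R powr (DIM('a) - m))" if R: "R > 0" for R y
  proof -
    have "(\<integral>\<^sup>+x. ennreal (norm (y - x) powr (-m)) * indicator (ball 0 R) (x::'a) \<partial>lborel)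
      \<le> (\<integral>\<^sup>+x. ennreal (norm (y - x) powr (-m)) * indicator (ball 0 R) (y - x)
          + ennreal (norm x powr (-m)) * indicator (ball 0 R) x \<partial>lborel)"
    proof (intro nn_integral_mono_AE)
      show "AE x in lborel. ennreal (norm (y - x) powr (-m)) * indicator (ball 0 R) x
        \<le> ennreal (norm (y - x) powr (-m)) * indicator (ball 0 R) (y - x) + ennreal (norm x powr (-m)) * indicator (ball 0 R) x"
        using AE_lborel_singleton[of "0::'a"]
      proof eventually_elim
        case (elim x)
        show ?case
        proof (cases "norm (y - x) < R \<or> R \<le> norm x")
          case True
          then show ?thesis by (auto simp: indicator_def intro: order_trans[OF _ add_increasing2])
        next
          case False
          then have "norm (y - x) powr (- m) \<le> norm x powr (- m)"
            using m elim R by (intro powr_mono2') auto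
          then show ?thesis using False by (auto simp: ennreal_leI)
        qed
      qed
    qed
    also have "\<dots> = (\<integral>\<^sup>+x. ennreal (norm (y - x) powr (-m)) * indicator (ball 0 R) (y - x) \<partial>lborel)
        + (\<integral>\<^sup>+x. ennreal (norm x powr (-m)) * indicator (ball 0 R) (x::'a) \<partial>lborel)"
      by (rule nn_integral_add) auto
    also have "(\<integral>\<^sup>+x. ennreal (norm (y - x) powr (-m)) * indicator (ball 0 R) (y - x) \<partial>lborel)
       = (\<integral>\<^sup>+x. ennreal (norm x powr (-m)) * indicator (ball 0 R) (x::'a) \<partial>lborel)"
      by (rule nn_integral_lborel_reflect) simp
    also have "\<dots> + \<dots> \<le> ennreal (C * R powr (DIM('a) - m)) + ennreal (C * R powr (DIM('a) - m))"
      using R by (intro add_mono C(2))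
    also have "\<dots> = ennreal (2 * C * R powr (DIM('a) - m))"
      using C(1) by (simp add: ennreal_plus[symmetric] del: ennreal_plus)
    finally show ?thesis .
  qed
  then show ?thesis using C(1) by (intro exI[of _ "2 * C"]) auto
qed

text \<open>By translation invariance the integral of \<open>h'\<close> is that of its average over a unit segment in
  direction \<open>e\<close>, i.e. of \<open>h (x + e) - h x\<close>. Only almost every line has to avoid the singularities of
  \<open>h\<close>, so an isolated one does no harm and no boundary term appears.\<close>

lemma integral_directional_derivative_eq_0:
  fixes h h' :: "'a::euclidean_space \<Rightarrow> real"
  assumes h: "integrable lborel h" and h': "integrable lborel h'"
    and deriv: "AE x in lborel. \<forall>t\<in>{0..1}. ((\<lambda>t. h (x + t *\<^sub>R e)) has_real_derivative h' (x + t *\<^sub>R e)) (at t)"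
  shows "(\<integral>x. h' x \<partial>lborel) = 0"
proof -
  have [measurable]: "h \<in> borel_measurable borel" "h' \<in> borel_measurable borel"
    using h h' by (simp_all add: borel_measurable_integrable)
  define F where "F x t = indicator {0..1} t * h' (x + t *\<^sub>R e)" for x and t :: real
  have [measurable]: "(\<lambda>z. F (fst z) (snd z)) \<in> borel_measurable (lborel \<Otimes>\<^sub>M lborel)"
    unfolding F_def by measurable
  have shift: "h' (x + c) = h' (c + x)" for x c by (simp add: add.commute)
  have "(\<integral>\<^sup>+z. norm (F (fst z) (snd z)) \<partial>(lborel \<Otimes>\<^sub>M lborel)) = (\<integral>\<^sup>+t. \<integral>\<^sup>+x. norm (F x t) \<partial>lborel \<partial>lborel)"
    by (subst lborel_pair.nn_integral_snd[symmetric]) auto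
  also have "\<dots> = (\<integral>\<^sup>+t. (\<integral>\<^sup>+x. norm (h' x) \<partial>lborel) * indicator {0..1} (t::real) \<partial>lborel)"
  proof (intro nn_integral_cong)
    fix t :: real
    have "(\<integral>\<^sup>+x. norm (h' (t *\<^sub>R e + x)) \<partial>lborel) = (\<integral>\<^sup>+x. norm (h' x) \<partial>lborel)"
      by (rule nn_integral_lborel_translate) simp
    then show "(\<integral>\<^sup>+x. norm (F x t) \<partial>lborel) = (\<integral>\<^sup>+x. norm (h' x) \<partial>lborel) * indicator {0..1} t"
      by (auto simp: F_def shift indicator_def)
  qed
  also have "\<dots> < \<infinity>"
    using h' by (simp add: nn_integral_cmult_indicator integrable_iff_bounded)
  finally have "integrable (lborel \<Otimes>\<^sub>M lborel) (\<lambda>z. F (fst z) (snd z))"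
    by (intro integrableI_bounded) auto
  then have int: "integrable (lborel \<Otimes>\<^sub>M lborel) (case_prod F)" by (simp add: case_prod_beta')
  have "(\<integral>x. h' x \<partial>lborel) = (\<integral>t. indicator {0..1} t * (\<integral>x. h' x \<partial>lborel) \<partial>(lborel :: real measure))"
    by simp
  also have "\<dots> = (\<integral>t. (\<integral>x. F x t \<partial>lborel) \<partial>lborel)"
  proof (intro Bochner_Integration.integral_cong refl)
    fix t :: real
    have "(\<integral>x. h' (t *\<^sub>R e + x) \<partial>lborel) = (\<integral>x. h' x \<partial>lborel)"
      by (rule integral_lborel_translate) simp
    then show "indicator {0..1} t * (\<integral>x. h' x \<partial>lborel) = (\<integral>x. F x t \<partial>lborel)"
      by (simp add: F_def shift)
  qed
  also have "\<dots> = (\<integral>x. (\<integral>t. F x t \<partial>lborel) \<partial>lborel)"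
    by (rule lborel_pair.Fubini_integral[OF int])
  also have "\<dots> = (\<integral>x. h (e + x) - h x \<partial>lborel)"
  proof (rule integral_cong_AE)
    show "(\<lambda>x. \<integral>t. F x t \<partial>lborel) \<in> borel_measurable lborel"
      using lborel_pair.integrable_fst[OF int] by (rule borel_measurable_integrable)
    have "AE x in lborel. integrable lborel (F x)"
      using lborel_pair.AE_integrable_fst[OF int] by simp
    with deriv show "AE x in lborel. (\<integral>t. F x t \<partial>lborel) = h (e + x) - h x"
    proof eventually_elim
      case (elim x)
      have "((\<lambda>t. h' (x + t *\<^sub>R e)) has_integral h (x + 1 *\<^sub>R e) - h (x + 0 *\<^sub>R e)) {0..1}"
        using elim(1) by (intro fundamental_theorem_of_calculus)
          (auto simp: has_real_derivative_iff_has_vector_derivative[symmetric] intro: has_field_derivative_at_within)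
      moreover have "set_integrable lborel {0..1} (\<lambda>t. h' (x + t *\<^sub>R e))"
        using elim(2) by (simp add: set_integrable_def F_def[abs_def])
      from set_borel_integral_eq_integral(2)[OF this]
      have "(\<integral>t. F x t \<partial>lborel) = integral {0..1} (\<lambda>t. h' (x + t *\<^sub>R e))"
        by (simp add: set_lebesgue_integral_def F_def)
      ultimately show ?case by (simp add: integral_unique add.commute)
    qed
  qed simp
  also have "\<dots> = 0"
    using h by (subst Bochner_Integration.integral_diff)
      (auto intro: integrable_lborel_translate simp: integral_lborel_translate)
  finally show ?thesis .
qed

text \<open>Fubini for the double integral of \<open>H y x z\<close>: for fixed z the integral over
  x is the dipole convolution at y - z. Its absolute version is at most a multiple of |y - z|^(3-n)
  |G z|, whose integral over z is bounded uniformly in y. This uniform bound is what later makes the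
  potential of \<theta> essentially bounded.\<close>

lemma newton_convolution_pressure:
  fixes G :: "'a::euclidean_space \<Rightarrow> real" and b :: 'a
  assumes n: "3 < DIM('a)" and G: "\<And>x. \<bar>G x\<bar> \<le> A" and int: "integrable lborel G"
  defines "p \<equiv> \<lambda>x. \<integral>z. (norm (x - z) powr (- real DIM('a)) * ((x - z) \<bullet> b)) * G z \<partial>lborel"
  shows "p \<in> borel_measurable borel"
    and "\<And>y. integrable lborel (\<lambda>x. norm (y - x) powr (2 - real DIM('a)) * p x)"
    and "\<exists>B\<ge>0. \<forall>y. (\<integral>\<^sup>+x. norm (y - x) powr (2 - real DIM('a)) * \<bar>p x\<bar> \<partial>lborel) \<le> ennreal B"
    and "\<And>y. (\<integral>x. norm (y - x) powr (2 - real DIM('a)) * p x \<partial>lborel)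
      = omega DIM('a) / 2 * (\<integral>z. norm (y - z) powr (2 - real DIM('a)) * ((y - z) \<bullet> b) * G z \<partial>lborel)"
proof -
  have [measurable]: "G \<in> borel_measurable borel" using int by (simp add: borel_measurable_integrable)
  show pm [measurable]: "p \<in> borel_measurable borel"
    unfolding p_def by measurable
  define H where "H y x z = norm (y - x) powr (2 - real DIM('a)) * (norm (x - z) powr (- real DIM('a)) * ((x - z) \<bullet> b) * G z)" for y x z :: 'a
  have Hm [measurable]: "(\<lambda>q. H y (fst q) (snd q)) \<in> borel_measurable (lborel \<Otimes>\<^sub>M lborel)" for y
    unfolding H_def by measurable
  obtain C where C: "C \<ge> 0" "\<And>y::'a. y \<noteq> 0 \<Longrightarrow>
     (\<integral>\<^sup>+x. norm (y - x) powr (2 - real DIM('a)) * norm x powr (1 - real DIM('a)) \<partial>lborel) = ennreal (C * norm y powr (3 - real DIM('a)))"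
    using nn_integral_newton_mult_powr[where 'a='a] n by blast
  obtain B where B: "B \<ge> 0" "\<And>y. (\<integral>\<^sup>+x. norm (y - x) powr (- (real DIM('a) - 3)) * \<bar>G x\<bar> \<partial>lborel) \<le> ennreal B"
    using nn_integral_riesz_bounded[of "real DIM('a) - 3" G A] n G int by auto
  define D where "D = norm b * C * B"
  have D: "0 \<le> D" using C(1) B(1) by (simp add: D_def)
  have bound: "(\<integral>\<^sup>+z. \<integral>\<^sup>+x. norm (H y x z) \<partial>lborel \<partial>lborel) \<le> ennreal D" for y
  proof -
    have "(\<integral>\<^sup>+z. \<integral>\<^sup>+x. norm (H y x z) \<partial>lborel \<partial>lborel)
      \<le> (\<integral>\<^sup>+z. ennreal (norm b * C) * ennreal (norm (y - z) powr (- (real DIM('a) - 3)) * \<bar>G z\<bar>) \<partial>lborel)"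
    proof (intro nn_integral_mono_AE)
      show "AE z in lborel. (\<integral>\<^sup>+x. norm (H y x z) \<partial>lborel)
         \<le> ennreal (norm b * C) * ennreal (norm (y - z) powr (- (real DIM('a) - 3)) * \<bar>G z\<bar>)"
        using AE_lborel_singleton[of y]
      proof eventually_elim
        case (elim z)
        have "(\<integral>\<^sup>+x. norm (H y x z) \<partial>lborel) = (\<integral>\<^sup>+x. norm (H y (z + x) z) \<partial>lborel)"
          by (rule nn_integral_lborel_translate[symmetric]) (simp add: H_def)
        also have "\<dots> \<le> (\<integral>\<^sup>+x. ennreal (norm b * \<bar>G z\<bar>) *
            ennreal (norm ((y - z) - x) powr (2 - real DIM('a)) * norm x powr (1 - real DIM('a))) \<partial>lborel)"
        proof (intro nn_integral_mono)
          fix x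
          have "norm (H y (z + x) z) = norm ((y - z) - x) powr (2 - real DIM('a)) * norm x powr (- real DIM('a)) * \<bar>x \<bullet> b\<bar> * \<bar>G z\<bar>"
            by (simp add: H_def abs_mult algebra_simps)
          also have "\<dots> \<le> norm ((y - z) - x) powr (2 - real DIM('a)) * norm x powr (- real DIM('a)) * (norm x * norm b) * \<bar>G z\<bar>"
            by (intro mult_left_mono mult_right_mono Cauchy_Schwarz_ineq2) auto
          also have "\<dots> = norm b * \<bar>G z\<bar> * (norm ((y - z) - x) powr (2 - real DIM('a)) * norm x powr (1 - real DIM('a)))"
          proof -
            have "norm x powr (1 - real DIM('a)) = norm x powr (- real DIM('a)) * norm x"
              using powr_add[of "norm x" "- real DIM('a)" 1] by simp
            then show ?thesis by (simp add: mult_ac)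
          qed
          finally show "ennreal (norm (H y (z + x) z)) \<le> ennreal (norm b * \<bar>G z\<bar>) *
            ennreal (norm ((y - z) - x) powr (2 - real DIM('a)) * norm x powr (1 - real DIM('a)))"
            by (subst ennreal_mult''[symmetric]) (auto intro: ennreal_leI)
        qed
        also have "\<dots> = ennreal (norm b * \<bar>G z\<bar>) * ennreal (C * norm (y - z) powr (3 - real DIM('a)))"
          using elim by (subst nn_integral_cmult) (auto simp: C)
        also have "\<dots> = ennreal (norm b * C) * ennreal (norm (y - z) powr (- (real DIM('a) - 3)) * \<bar>G z\<bar>)"
          using C(1) by (simp add: ennreal_mult'[symmetric] ennreal_mult''[symmetric] mult_ac)
        finally show ?case .
      qed
    qed
    also have "\<dots> = ennreal (norm b * C) * (\<integral>\<^sup>+z. ennreal (norm (y - z) powr (- (real DIM('a) - 3)) * \<bar>G z\<bar>) \<partial>lborel)"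
      by (rule nn_integral_cmult) measurable
    also have "\<dots> \<le> ennreal (norm b * C) * ennreal B"
      by (intro mult_left_mono B) auto
    also have "\<dots> = ennreal D" using C(1) B(1) by (simp add: D_def ennreal_mult'[symmetric])
    finally show ?thesis .
  qed
  have Hint: "integrable (lborel \<Otimes>\<^sub>M lborel) (case_prod (H y))" for y
  proof -
    have "(\<integral>\<^sup>+q. norm (H y (fst q) (snd q)) \<partial>(lborel \<Otimes>\<^sub>M lborel)) = (\<integral>\<^sup>+z. \<integral>\<^sup>+x. norm (H y x z) \<partial>lborel \<partial>lborel)"
      by (subst lborel_pair.nn_integral_snd[symmetric]) auto
    also have "\<dots> < \<infinity>" using bound[of y] by (rule order.strict_trans1) simp
    finally have "integrable (lborel \<Otimes>\<^sub>M lborel) (\<lambda>q. H y (fst q) (snd q))"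
      by (intro integrableI_bounded) auto
    then show ?thesis by (simp add: case_prod_beta')
  qed
  have Hp: "(\<integral>z. H y x z \<partial>lborel) = norm (y - x) powr (2 - real DIM('a)) * p x" for y x
    unfolding H_def p_def by (rule integral_mult_right_zero)
  show "integrable lborel (\<lambda>x. norm (y - x) powr (2 - real DIM('a)) * p x)" for y
    using lborel_pair.integrable_fst[OF Hint[of y]] by (simp add: Hp)
  have "(\<integral>\<^sup>+x. norm (y - x) powr (2 - real DIM('a)) * \<bar>p x\<bar> \<partial>lborel) \<le> ennreal D" for y
  proof -
    have "(\<integral>\<^sup>+x. norm (y - x) powr (2 - real DIM('a)) * \<bar>p x\<bar> \<partial>lborel) = (\<integral>\<^sup>+x. norm (\<integral>z. H y x z \<partial>lborel) \<partial>lborel)"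
      by (simp add: Hp abs_mult)
    also have "\<dots> \<le> (\<integral>\<^sup>+x. (\<integral>\<^sup>+z. norm (H y x z) \<partial>lborel) \<partial>lborel)"
    proof (intro nn_integral_mono)
      fix x
      \<comment> \<open>Where \<open>H y x\<close> is not integrable, the Bochner integral on the
        left is 0 by convention.\<close>
      show "ennreal (norm (\<integral>z. H y x z \<partial>lborel)) \<le> (\<integral>\<^sup>+z. norm (H y x z) \<partial>lborel)"
        using integral_norm_bound_ennreal[of lborel "H y x"]
        by (cases "integrable lborel (H y x)") (auto simp: not_integrable_integral_eq)
    qed
    also have "\<dots> = (\<integral>\<^sup>+z. \<integral>\<^sup>+x. norm (H y x z) \<partial>lborel \<partial>lborel)"
      by (rule lborel_pair.Fubini') (simp add: case_prod_beta' H_def)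
    also have "\<dots> \<le> ennreal D" by (rule bound)
    finally show ?thesis .
  qed
  then show "\<exists>B\<ge>0. \<forall>y. (\<integral>\<^sup>+x. norm (y - x) powr (2 - real DIM('a)) * \<bar>p x\<bar> \<partial>lborel) \<le> ennreal B"
    using D by blast
  show "(\<integral>x. norm (y - x) powr (2 - real DIM('a)) * p x \<partial>lborel)
      = omega DIM('a) / 2 * (\<integral>z. norm (y - z) powr (2 - real DIM('a)) * ((y - z) \<bullet> b) * G z \<partial>lborel)" for y
  proof -
    have "(\<integral>x. norm (y - x) powr (2 - real DIM('a)) * p x \<partial>lborel) = (\<integral>x. (\<integral>z. H y x z \<partial>lborel) \<partial>lborel)"
      by (simp add: Hp)
    also have "\<dots> = (\<integral>z. (\<integral>x. H y x z \<partial>lborel) \<partial>lborel)"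
      by (rule lborel_pair.Fubini_integral[OF Hint, symmetric])
    also have "\<dots> = (\<integral>z. omega DIM('a) / 2 * (norm (y - z) powr (2 - real DIM('a)) * ((y - z) \<bullet> b) * G z) \<partial>lborel)"
    proof (rule integral_cong_AE)
      show "(\<lambda>z. \<integral>x. H y x z \<partial>lborel) \<in> borel_measurable lborel"
        using lborel_pair.integrable_snd[OF Hint] by (rule borel_measurable_integrable)
      show "AE z in lborel. (\<integral>x. H y x z \<partial>lborel) = omega DIM('a) / 2 * (norm (y - z) powr (2 - real DIM('a)) * ((y - z) \<bullet> b) * G z)"
        using AE_lborel_singleton[of y]
      proof eventually_elim
        case (elim z)
        have "(\<integral>x. H y x z \<partial>lborel) = (\<integral>x. H y (z + x) z \<partial>lborel)"
          by (rule integral_lborel_translate[symmetric]) (simp add: H_def)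
        also have "\<dots> = (\<integral>x. (norm ((y - z) - x) powr (2 - real DIM('a)) * (norm x powr (- real DIM('a)) * (x \<bullet> b))) * G z \<partial>lborel)"
          by (intro Bochner_Integration.integral_cong refl) (simp add: H_def algebra_simps)
        also have "\<dots> = omega DIM('a) / 2 * (norm (y - z) powr (2 - real DIM('a)) * ((y - z) \<bullet> b)) * G z"
          using elim n by (subst integral_mult_left_zero, subst newton_convolution_dipole(2)) auto
        finally show ?case by (simp add: mult_ac)
      qed
    qed simp
    also have "\<dots> = omega DIM('a) / 2 * (\<integral>z. norm (y - z) powr (2 - real DIM('a)) * ((y - z) \<bullet> b) * G z \<partial>lborel)"
      by (rule integral_mult_right_zero)
    finally show ?thesis .
  qed
qed

section \<open>Integration by parts for decaying solenoidal fields\<close>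

text \<open>The exponent n + 1 exceeds n, hence integrability at infinity, while |u|^2 and |u| |Du|
  for a field in X still lie below a multiple of this weight; see
  \<open>X_space_decaying_solenoidal\<close>.\<close>

definition decay_weight :: "'a::euclidean_space \<Rightarrow> real" where
  "decay_weight x = (1 + norm x) powr (- (real DIM('a) + 1))"

lemma decay_weight_nonneg [simp]: "0 \<le> decay_weight x"
  by (simp add: decay_weight_def)

lemma decay_weight_le_1: "decay_weight x \<le> 1"
  using powr_mono2'[of "- (real DIM('a) + 1)" 1 "1 + norm x"] by (simp add: decay_weight_def)

lemma borel_measurable_decay_weight [measurable]: "decay_weight \<in> borel_measurable borel"
  unfolding decay_weight_def by measurable

lemma integrable_decay_weight: "integrable lborel (decay_weight :: 'a::euclidean_space \<Rightarrow> real)"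
  using nn_integral_one_plus_norm_powr_finite[where 'a='a and p="real DIM('a) + 1"]
  by (intro integrableI_nonneg) (auto simp: decay_weight_def)

lemma integrable_le_decay_weight:
  fixes g :: "'a::euclidean_space \<Rightarrow> real"
  assumes "g \<in> borel_measurable borel" "\<And>x. \<bar>g x\<bar> \<le> A * decay_weight x"
  shows "integrable lborel g"
  by (rule Bochner_Integration.integrable_bound[of _ "\<lambda>x. A * decay_weight x"])
     (use assms integrable_decay_weight in \<open>auto intro!: always_eventually order_trans[OF assms(2)]\<close>)

lemma integrable_riesz_decay_weight:
  fixes g :: "'a::euclidean_space \<Rightarrow> real" and m :: real
  assumes m: "0 \<le> m" "m < DIM('a)"
    and [measurable]: "g \<in> borel_measurable borel"
    and g: "\<And>x. \<bar>g x\<bar> \<le> A * (norm (y - x) powr (- m) * decay_weight x)"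
  shows "integrable lborel g"
proof -
  obtain B where B: "(\<integral>\<^sup>+x. norm (y - x) powr (- m) * \<bar>decay_weight x\<bar> \<partial>lborel) \<le> ennreal B"
    using nn_integral_riesz_bounded[OF m, of decay_weight 1] integrable_decay_weight[where 'a='a]
      decay_weight_le_1[where 'a='a] by auto
  have "(\<integral>\<^sup>+x. norm (y - x) powr (- m) * decay_weight x \<partial>lborel) < \<infinity>"
    using B by (auto intro: order.strict_trans1)
  then have "integrable lborel (\<lambda>x. norm (y - x) powr (- m) * decay_weight x)"
    by (intro integrableI_nonneg) auto
  then have "integrable lborel (\<lambda>x. A * (norm (y - x) powr (- m) * decay_weight x))" by simp
  then show ?thesis
    by (rule Bochner_Integration.integrable_bound) (use g in \<open>auto intro!: always_eventually order_trans[OF g]\<close>)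
qed

lemma AE_lborel_inner_neq:
  fixes b :: "'a::euclidean_space"
  assumes "b \<in> Basis"
  shows "AE x in lborel. x \<bullet> b \<noteq> c"
proof -
  have "negligible {x. x \<bullet> b = c}" using assms by (rule negligible_standard_hyperplane)
  then have "{x. x \<bullet> b = c} \<in> null_sets lebesgue" by (simp add: negligible_iff_null_sets)
  then have "{x. x \<bullet> b = c} \<in> null_sets lborel"
    by (subst (asm) null_sets_completion_iff) (auto intro: borel_closed closed_hyperplane simp: closed_hyperplane inner_commute)
  then show ?thesis by (rule AE_I') auto
qed

lemma powr_mult_self: "(x::real) powr a * x = x powr (a + 1)" if "0 \<le> x"
  using that powr_add[of x a 1] by simp

text \<open>Only products of u with itself and with its derivative enter the integrals, so decay is
  assumed for |u|^2 and |u| |Du| rather than for the factors. \<open>A\<close> may depend on u: it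
  serves absolute convergence, and no final bound contains it.\<close>

locale decaying_solenoidal =
  fixes u :: "'a::euclidean_space \<Rightarrow> 'a" and u' :: "'a \<Rightarrow> 'a \<Rightarrow> 'a" and A :: real
  assumes dim: "3 < DIM('a)"
    and deriv: "\<And>x. (u has_derivative u' x) (at x)"
    and u'_measurable [measurable]: "\<And>e. (\<lambda>x. u' x e) \<in> borel_measurable borel"
    and divergence_free: "\<And>x. (\<Sum>b\<in>Basis. u' x b \<bullet> b) = 0"
    and u_decay: "\<And>x. (norm (u x))\<^sup>2 \<le> A * decay_weight x"
    and u'_decay: "\<And>x e. norm (u x) * norm (u' x e) \<le> A * decay_weight x * norm e"
begin

lemma continuous_u: "continuous_on UNIV u"
  using deriv by (auto intro!: continuous_at_imp_continuous_on has_derivative_continuous)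

lemma u_measurable [measurable]: "u \<in> borel_measurable borel"
  by (rule borel_measurable_continuous_onI[OF continuous_u])

lemma linear_u': "linear (u' x)"
  using deriv has_derivative_linear by blast

lemma u'_u: "u' x (u x) = (\<Sum>b\<in>Basis. (u x \<bullet> b) *\<^sub>R u' x b)"
proof -
  have "u' x (u x) = u' x (\<Sum>b\<in>Basis. (u x \<bullet> b) *\<^sub>R b)" by (simp add: euclidean_representation)
  also have "\<dots> = (\<Sum>b\<in>Basis. (u x \<bullet> b) *\<^sub>R u' x b)"
    by (simp add: linear_sum[OF linear_u'] linear_scale[OF linear_u'] o_def)
  finally show ?thesis .
qed

lemma convection_measurable [measurable]: "(\<lambda>x. u' x (u x)) \<in> borel_measurable borel"
  unfolding u'_u by measurable

text \<open>The majorant with a pole of order n - 2 against |u|^2. The next two have an additional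
  factor |y - z|, hence order n - 3; together they cover the flux of the integration by parts and
  all terms of its derivative.\<close>

lemma integrable_quadratic:
  assumes [measurable]: "g \<in> borel_measurable borel"
    and g: "\<And>z. \<bar>g z\<bar> \<le> norm (y - z) powr (2 - real DIM('a)) * (norm (u z) * norm (u z))"
  shows "integrable lborel g"
proof (rule integrable_riesz_decay_weight)
  show "0 \<le> real DIM('a) - 2" "real DIM('a) - 2 < real DIM('a)" using dim by auto
  fix z
  have "\<bar>g z\<bar> \<le> norm (y - z) powr (2 - real DIM('a)) * (norm (u z))\<^sup>2" using g[of z] by (simp add: power2_eq_square)
  also have "\<dots> \<le> norm (y - z) powr (2 - real DIM('a)) * (A * decay_weight z)"
    by (intro mult_left_mono u_decay) auto
  finally show "\<bar>g z\<bar> \<le> A * (norm (y - z) powr (- (real DIM('a) - 2)) * decay_weight z)" by (simp add: mult_ac)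
qed simp

lemma integrable_convective:
  assumes [measurable]: "g \<in> borel_measurable borel"
    and g: "\<And>z. \<bar>g z\<bar> \<le> norm (y - z) powr (2 - real DIM('a)) * norm (y - z) * (norm (u z) * norm (u' z b))"
  shows "integrable lborel g"
proof (rule integrable_riesz_decay_weight)
  show "0 \<le> real DIM('a) - 3" "real DIM('a) - 3 < real DIM('a)" using dim by auto
  fix z
  have "\<bar>g z\<bar> \<le> norm (y - z) powr (3 - real DIM('a)) * (norm (u z) * norm (u' z b))"
    using g[of z] by (simp add: powr_mult_self)
  also have "\<dots> \<le> norm (y - z) powr (3 - real DIM('a)) * (A * decay_weight z * norm b)"
    by (intro mult_left_mono u'_decay) auto
  finally show "\<bar>g z\<bar> \<le> A * norm b * (norm (y - z) powr (- (real DIM('a) - 3)) * decay_weight z)" by (simp add: mult_ac)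
qed simp

lemma integrable_flux:
  assumes [measurable]: "g \<in> borel_measurable borel"
    and g: "\<And>z. \<bar>g z\<bar> \<le> norm (y - z) powr (2 - real DIM('a)) * norm (y - z) * (norm (u z) * norm (u z))"
  shows "integrable lborel g"
proof (rule integrable_riesz_decay_weight)
  show "0 \<le> real DIM('a) - 3" "real DIM('a) - 3 < real DIM('a)" using dim by auto
  fix z
  have "\<bar>g z\<bar> \<le> norm (y - z) powr (3 - real DIM('a)) * (norm (u z))\<^sup>2"
    using g[of z] by (simp add: powr_mult_self power2_eq_square)
  also have "\<dots> \<le> norm (y - z) powr (3 - real DIM('a)) * (A * decay_weight z)"
    by (intro mult_left_mono u_decay) auto
  finally show "\<bar>g z\<bar> \<le> A * (norm (y - z) powr (- (real DIM('a) - 3)) * decay_weight z)" by (simp add: mult_ac)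
qed simp

text \<open>Product rule for the component along \<open>b\<close> of the flux |y - z|^(2-n) ((y - z)
  . u) u, away from the pole. Summed over the basis, the four terms become the quadratic integrand,
  the term with |u|^2, the convective term and a multiple of div u.\<close>

lemma flux_derivative:
  fixes x y b :: 'a
  assumes neq: "x + t *\<^sub>R b \<noteq> y"
  defines "z \<equiv> x + t *\<^sub>R b"
  shows "((\<lambda>t. norm (y - (x + t *\<^sub>R b)) powr (2 - real DIM('a)) * ((y - (x + t *\<^sub>R b)) \<bullet> u (x + t *\<^sub>R b)) * (u (x + t *\<^sub>R b) \<bullet> b))
    has_real_derivative
      (real DIM('a) - 2) * (norm (y - z) powr (- real DIM('a)) * ((y - z) \<bullet> b) * ((y - z) \<bullet> u z) * (u z \<bullet> b))
      - norm (y - z) powr (2 - real DIM('a)) * (u z \<bullet> b) * (u z \<bullet> b)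
      + norm (y - z) powr (2 - real DIM('a)) * ((y - z) \<bullet> u' z b) * (u z \<bullet> b)
      + norm (y - z) powr (2 - real DIM('a)) * ((y - z) \<bullet> u z) * (u' z b \<bullet> b)) (at t)"
proof -
  have N: "norm v powr p = (v \<bullet> v) powr (p / 2)" for v :: 'a and p
    by (simp add: norm_eq_sqrt_inner powr_half_sqrt[symmetric] powr_powr)
  have dU: "((\<lambda>t. u (x + t *\<^sub>R b)) has_derivative (\<lambda>h. h *\<^sub>R u' z b)) (at t)"
  proof -
    have "((\<lambda>t. u (x + t *\<^sub>R b)) has_derivative (\<lambda>h. u' z (h *\<^sub>R b))) (at t)"
      unfolding z_def by (rule has_derivative_compose[OF _ deriv]) (auto intro!: derivative_eq_intros)
    then show ?thesis by (simp add: linear_scale[OF linear_u'])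
  qed
  have dw: "((\<lambda>t. y - (x + t *\<^sub>R b)) has_derivative (\<lambda>h. - (h *\<^sub>R b))) (at t)"
    by (auto intro!: derivative_eq_intros)
  have d1: "((\<lambda>t. (y - (x + t *\<^sub>R b)) \<bullet> (y - (x + t *\<^sub>R b))) has_real_derivative - 2 * ((y - z) \<bullet> b)) (at t)"
    unfolding has_field_derivative_def
    by (rule has_derivative_eq_rhs[OF has_derivative_inner[OF dw dw]])
      (auto simp: z_def fun_eq_iff inner_commute algebra_simps)
  have pos: "0 < (y - z) \<bullet> (y - z)" using neq by (simp add: z_def)
  have d2: "((\<lambda>t. norm (y - (x + t *\<^sub>R b)) powr (2 - real DIM('a))) has_real_derivative
      (real DIM('a) - 2) * norm (y - z) powr (- real DIM('a)) * ((y - z) \<bullet> b)) (at t)"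
  proof -
    have e: "(2 - real DIM('a)) / 2 - of_nat 1 = - real DIM('a) / 2" by (simp add: field_simps)
    have a: "(2 - r) / 2 * X * (- 2 * W) = (r - 2) * X * W" for r X W :: real by (simp add: field_simps)
    show ?thesis
      unfolding N using pos
      by (intro DERIV_cong[OF DERIV_fun_powr[OF d1, of "(2 - real DIM('a)) / 2"]])
        (simp_all only: e a z_def[symmetric])
  qed
  have d3: "((\<lambda>t. (y - (x + t *\<^sub>R b)) \<bullet> u (x + t *\<^sub>R b)) has_real_derivative - (u z \<bullet> b) + (y - z) \<bullet> u' z b) (at t)"
    unfolding has_field_derivative_def
    by (rule has_derivative_eq_rhs[OF has_derivative_inner[OF dw dU]])
      (auto simp: z_def fun_eq_iff inner_commute algebra_simps)
  have d4: "((\<lambda>t. u (x + t *\<^sub>R b) \<bullet> b) has_real_derivative u' z b \<bullet> b) (at t)"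
    unfolding has_field_derivative_def
    by (rule has_derivative_eq_rhs[OF has_derivative_inner_left[OF dU]]) (auto simp: fun_eq_iff)
  show ?thesis
    by (rule DERIV_cong[OF DERIV_mult[OF DERIV_mult[OF d2 d3] d4]]) (simp add: z_def algebra_simps)
qed

text \<open>The components of the flux in \<open>flux_derivative\<close> and their derivatives are
  integrable, so each derivative has integral 0, with no contribution from the pole or from
  infinity. The sum over the basis is the stated identity, the last term vanishing with div
  u.\<close>

lemma convective_potential:
  fixes y :: 'a
  shows "integrable lborel (\<lambda>z. norm (y - z) powr (- real DIM('a)) * ((y - z) \<bullet> u z)\<^sup>2)"
    and "integrable lborel (\<lambda>z. norm (y - z) powr (2 - real DIM('a)) * (norm (u z))\<^sup>2)"
    and "integrable lborel (\<lambda>z. norm (y - z) powr (2 - real DIM('a)) * ((y - z) \<bullet> u' z (u z)))"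
    and "(\<integral>z. norm (y - z) powr (2 - real DIM('a)) * ((y - z) \<bullet> u' z (u z)) \<partial>lborel)
       = (\<integral>z. norm (y - z) powr (2 - real DIM('a)) * (norm (u z))\<^sup>2 \<partial>lborel)
         - (real DIM('a) - 2) * (\<integral>z. norm (y - z) powr (- real DIM('a)) * ((y - z) \<bullet> u z)\<^sup>2 \<partial>lborel)"
proof -
  define q where "q z = norm (y - z) powr (2 - real DIM('a))" for z
  have [measurable]: "q \<in> borel_measurable borel" unfolding q_def by measurable
  have q: "0 \<le> q z" for z by (simp add: q_def)
  define T1 where "T1 b z = norm (y - z) powr (- real DIM('a)) * ((y - z) \<bullet> b) * ((y - z) \<bullet> u z) * (u z \<bullet> b)" for b z
  define T2 where "T2 b z = q z * (u z \<bullet> b) * (u z \<bullet> b)" for b z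
  define T3 where "T3 b z = q z * ((y - z) \<bullet> u' z b) * (u z \<bullet> b)" for b z
  define T4 where "T4 b z = q z * ((y - z) \<bullet> u z) * (u' z b \<bullet> b)" for b z
  define h where "h b z = q z * ((y - z) \<bullet> u z) * (u z \<bullet> b)" for b z
  have [measurable]: "T1 b \<in> borel_measurable borel" "T2 b \<in> borel_measurable borel" "T3 b \<in> borel_measurable borel"
    "T4 b \<in> borel_measurable borel" "h b \<in> borel_measurable borel" for b
    unfolding T1_def T2_def T3_def T4_def h_def by measurable
  note cs = Cauchy_Schwarz_ineq2
  have B: "\<bar>v \<bullet> b\<bar> \<le> norm v" if "b \<in> Basis" for v b :: 'a
    using cs[of v b] that by simp
  have iT1: "integrable lborel (T1 b)" if b: "b \<in> Basis" for b
  proof (rule integrable_quadratic)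
    fix z
    have "\<bar>T1 b z\<bar> \<le> norm (y - z) powr (- real DIM('a)) * norm (y - z) * (norm (y - z) * norm (u z)) * norm (u z)"
      unfolding T1_def abs_mult by (intro mult_mono B b cs) auto
    also have "\<dots> = (norm (y - z) powr (- real DIM('a)) * norm (y - z) * norm (y - z)) * (norm (u z) * norm (u z))"
      by (simp add: mult_ac)
    also have "norm (y - z) powr (- real DIM('a)) * norm (y - z) * norm (y - z) = norm (y - z) powr (2 - real DIM('a))"
      by (simp add: powr_mult_self)
    finally show "\<bar>T1 b z\<bar> \<le> norm (y - z) powr (2 - real DIM('a)) * (norm (u z) * norm (u z))" .
  qed simp
  have iT2: "integrable lborel (T2 b)" if b: "b \<in> Basis" for b
  proof (rule integrable_quadratic)
    fix z
    have "\<bar>T2 b z\<bar> \<le> \<bar>q z\<bar> * norm (u z) * norm (u z)"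
      unfolding T2_def abs_mult by (intro mult_mono B b) auto
    then show "\<bar>T2 b z\<bar> \<le> norm (y - z) powr (2 - real DIM('a)) * (norm (u z) * norm (u z))"
      by (simp add: q_def mult_ac)
  qed simp
  have iT3: "integrable lborel (T3 b)" if b: "b \<in> Basis" for b
  proof (rule integrable_convective)
    fix z
    have "\<bar>T3 b z\<bar> \<le> \<bar>q z\<bar> * (norm (y - z) * norm (u' z b)) * norm (u z)"
      unfolding T3_def abs_mult by (intro mult_mono B b cs) auto
    then show "\<bar>T3 b z\<bar> \<le> norm (y - z) powr (2 - real DIM('a)) * norm (y - z) * (norm (u z) * norm (u' z b))"
      by (simp add: q_def mult_ac)
  qed simp
  have iT4: "integrable lborel (T4 b)" if b: "b \<in> Basis" for b
  proof (rule integrable_convective)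
    fix z
    have "\<bar>T4 b z\<bar> \<le> \<bar>q z\<bar> * (norm (y - z) * norm (u z)) * norm (u' z b)"
      unfolding T4_def abs_mult by (intro mult_mono B b cs) auto
    then show "\<bar>T4 b z\<bar> \<le> norm (y - z) powr (2 - real DIM('a)) * norm (y - z) * (norm (u z) * norm (u' z b))"
      by (simp add: q_def mult_ac)
  qed simp
  have ih: "integrable lborel (h b)" if b: "b \<in> Basis" for b
  proof (rule integrable_flux)
    fix z
    have "\<bar>h b z\<bar> \<le> \<bar>q z\<bar> * (norm (y - z) * norm (u z)) * norm (u z)"
      unfolding h_def abs_mult by (intro mult_mono B b cs) auto
    then show "\<bar>h b z\<bar> \<le> norm (y - z) powr (2 - real DIM('a)) * norm (y - z) * (norm (u z) * norm (u z))"
      by (simp add: q_def mult_ac)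
  qed simp
  have zero: "(\<integral>z. (real DIM('a) - 2) * T1 b z - T2 b z + T3 b z + T4 b z \<partial>lborel) = 0" if b: "b \<in> Basis" for b
  proof (rule integral_directional_derivative_eq_0[OF ih[OF b]])
    show "integrable lborel (\<lambda>z. (real DIM('a) - 2) * T1 b z - T2 b z + T3 b z + T4 b z)"
      using b by (intro Bochner_Integration.integrable_add Bochner_Integration.integrable_diff integrable_mult_right iT1 iT2 iT3 iT4)
    \<comment> \<open>A line in direction \<open>b\<close> through y lies in the hyperplane on which
      another coordinate \<open>c\<close> equals that of y. Such a \<open>c\<close> exists in
      dimension at least 2, and almost every x is off this hyperplane.\<close>
    have "\<not> Basis \<subseteq> {b}"
    proof
      assume "Basis \<subseteq> {b}"
      then have "DIM('a) \<le> card {b}" by (rule card_mono[rotated]) simp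
      then show False using dim by simp
    qed
    then obtain c where c: "c \<in> Basis" "c \<noteq> b" by blast
    show "AE x in lborel. \<forall>t\<in>{0..1}. ((\<lambda>t. h b (x + t *\<^sub>R b)) has_real_derivative
        (real DIM('a) - 2) * T1 b (x + t *\<^sub>R b) - T2 b (x + t *\<^sub>R b) + T3 b (x + t *\<^sub>R b) + T4 b (x + t *\<^sub>R b)) (at t)"
      using AE_lborel_inner_neq[OF c(1), of "y \<bullet> c"]
    proof eventually_elim
      case (elim x)
      have "x + t *\<^sub>R b \<noteq> y" for t
      proof
        assume "x + t *\<^sub>R b = y"
        then have "x \<bullet> c = y \<bullet> c" using b c by (auto simp: inner_simps inner_not_same_Basis)
        then show False using elim by simp
      qed
      then show ?case
        unfolding h_def T1_def T2_def T3_def T4_def q_def by (intro ballI flux_derivative)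
    qed
  qed
  have s1: "(\<Sum>b\<in>Basis. T1 b z) = norm (y - z) powr (- real DIM('a)) * ((y - z) \<bullet> u z)\<^sup>2" for z
  proof -
    have "(\<Sum>b\<in>Basis. T1 b z) = norm (y - z) powr (- real DIM('a)) * ((y - z) \<bullet> u z) * (\<Sum>b\<in>Basis. ((y - z) \<bullet> b) * (u z \<bullet> b))"
      by (simp add: T1_def sum_distrib_left mult_ac)
    then show ?thesis by (simp only: euclidean_inner[symmetric] power2_eq_square mult.assoc)
  qed
  have s2: "(\<Sum>b\<in>Basis. T2 b z) = q z * (norm (u z))\<^sup>2" for z
    unfolding power2_norm_eq_inner by (subst euclidean_inner) (simp add: T2_def sum_distrib_left mult_ac)
  have s3: "(\<Sum>b\<in>Basis. T3 b z) = q z * ((y - z) \<bullet> u' z (u z))" for z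
    unfolding u'_u by (simp add: T3_def inner_sum_right sum_distrib_left mult_ac)
  have s4: "(\<Sum>b\<in>Basis. T4 b z) = 0" for z
    using divergence_free[of z] by (simp add: T4_def sum_distrib_left[symmetric])
  show i1: "integrable lborel (\<lambda>z. norm (y - z) powr (- real DIM('a)) * ((y - z) \<bullet> u z)\<^sup>2)"
    unfolding s1[symmetric] by (intro Bochner_Integration.integrable_sum iT1)
  have "integrable lborel (\<lambda>z. q z * (norm (u z))\<^sup>2)"
    unfolding s2[symmetric] by (intro Bochner_Integration.integrable_sum iT2)
  then show i2: "integrable lborel (\<lambda>z. norm (y - z) powr (2 - real DIM('a)) * (norm (u z))\<^sup>2)"
    by (simp add: q_def)
  have "integrable lborel (\<lambda>z. q z * ((y - z) \<bullet> u' z (u z)))"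
    unfolding s3[symmetric] by (intro Bochner_Integration.integrable_sum iT3)
  then show i3: "integrable lborel (\<lambda>z. norm (y - z) powr (2 - real DIM('a)) * ((y - z) \<bullet> u' z (u z)))"
    by (simp add: q_def)
  have "0 = (\<Sum>b\<in>Basis. (\<integral>z. (real DIM('a) - 2) * T1 b z - T2 b z + T3 b z + T4 b z \<partial>lborel))"
    by (simp add: zero)
  also have "\<dots> = (\<integral>z. (\<Sum>b\<in>Basis. (real DIM('a) - 2) * T1 b z - T2 b z + T3 b z + T4 b z) \<partial>lborel)"
    by (rule Bochner_Integration.integral_sum[symmetric])
      (intro Bochner_Integration.integrable_add Bochner_Integration.integrable_diff integrable_mult_right iT1 iT2 iT3 iT4)
  also have "\<dots> = (\<integral>z. (real DIM('a) - 2) * (norm (y - z) powr (- real DIM('a)) * ((y - z) \<bullet> u z)\<^sup>2)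
        - norm (y - z) powr (2 - real DIM('a)) * (norm (u z))\<^sup>2
        + norm (y - z) powr (2 - real DIM('a)) * ((y - z) \<bullet> u' z (u z)) \<partial>lborel)"
    by (intro Bochner_Integration.integral_cong refl)
      (simp only: sum.distrib sum_subtractf sum_distrib_left[symmetric] s1 s2 s3 s4, simp add: q_def)
  also have "\<dots> = (real DIM('a) - 2) * (\<integral>z. norm (y - z) powr (- real DIM('a)) * ((y - z) \<bullet> u z)\<^sup>2 \<partial>lborel)
        - (\<integral>z. norm (y - z) powr (2 - real DIM('a)) * (norm (u z))\<^sup>2 \<partial>lborel)
        + (\<integral>z. norm (y - z) powr (2 - real DIM('a)) * ((y - z) \<bullet> u' z (u z)) \<partial>lborel)"
    using i1 i2 i3 by simp
  finally show "(\<integral>z. norm (y - z) powr (2 - real DIM('a)) * ((y - z) \<bullet> u' z (u z)) \<partial>lborel)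
       = (\<integral>z. norm (y - z) powr (2 - real DIM('a)) * (norm (u z))\<^sup>2 \<partial>lborel)
         - (real DIM('a) - 2) * (\<integral>z. norm (y - z) powr (- real DIM('a)) * ((y - z) \<bullet> u z)\<^sup>2 \<partial>lborel)"
    by simp
qed

end

section \<open>Energy on balls\<close>

text \<open>The centre \<open>c\<close> is \<open>z\<close> moved by r / 2 along the line of
  \<open>v\<close>, on the side away from \<open>x\<close>: the sign \<open>s\<close> makes (z - x)
  . e add to the displacement. For y within r / 4 of \<open>c\<close> a component of at least r / 2
  - r / 4 along e survives, and y stays in the ball since r / 2 + r / 4 < r. As |y - x| <= 2r, the
  kernel is at least (2r)^(-n).\<close>

lemma kernel_lower_bound:
  fixes x z v :: "'a::euclidean_space"
  assumes r: "0 < r" and x: "x \<in> ball z r"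
  shows "\<exists>c. ball c (r / 4) \<subseteq> ball z r \<and>
    (\<forall>y\<in>ball c (r / 4). (2 * r) powr (- real DIM('a)) * ((norm v)\<^sup>2 * (r\<^sup>2 / 16)) \<le> norm (y - x) powr (- real DIM('a)) * ((y - x) \<bullet> v)\<^sup>2)"
proof (cases "v = 0")
  case True
  have "ball z (r / 4) \<subseteq> ball z r" using r by (intro subset_ball) simp
  then show ?thesis using True by (intro exI[of _ z]) auto
next
  case False
  define e where "e = v /\<^sub>R norm v"
  have e: "norm e = 1" "v = norm v *\<^sub>R e" using False by (simp_all add: e_def)
  define s :: real where "s = (if 0 \<le> (z - x) \<bullet> e then 1 else - 1)"
  have s: "0 \<le> s * ((z - x) \<bullet> e)" "\<bar>s\<bar> = 1" by (auto simp: s_def)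
  have ss: "s * s = 1" by (simp add: s_def)
  define c where "c = z + (s * r / 2) *\<^sub>R e"
  have cz: "dist z c = r / 2" using r e s by (simp add: c_def dist_norm abs_mult)
  have sub: "ball c (r / 4) \<subseteq> ball z r"
  proof
    fix y assume "y \<in> ball c (r / 4)"
    then show "y \<in> ball z r" using dist_triangle[of z y c] cz r by simp
  qed
  have "(2 * r) powr (- real DIM('a)) * ((norm v)\<^sup>2 * (r\<^sup>2 / 16)) \<le> norm (y - x) powr (- real DIM('a)) * ((y - x) \<bullet> v)\<^sup>2"
    if y: "y \<in> ball c (r / 4)" for y
  proof -
    have "\<bar>(y - c) \<bullet> e\<bar> \<le> norm (y - c)" using Cauchy_Schwarz_ineq2[of "y - c" e] e by simp
    then have "\<bar>(y - c) \<bullet> e\<bar> \<le> r / 4" using y by (simp add: dist_norm norm_minus_commute)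
    then have "- (r / 4) \<le> s * ((y - c) \<bullet> e)" by (auto simp: s_def)
    moreover have "s * ((y - x) \<bullet> e) = s * ((y - c) \<bullet> e) + s * ((z - x) \<bullet> e) + r / 2"
    proof -
      have "(y - x) \<bullet> e = ((y - c) + (z - x) + (s * r / 2) *\<^sub>R e) \<bullet> e" by (simp add: c_def)
      then have "(y - x) \<bullet> e = (y - c) \<bullet> e + (z - x) \<bullet> e + s * r / 2"
        by (simp only: inner_add_left inner_scaleR_left dot_square_norm e(1)) simp
      then have "s * ((y - x) \<bullet> e) = s * ((y - c) \<bullet> e) + s * ((z - x) \<bullet> e) + (s * s) * r / 2"
        by (simp add: algebra_simps)
      then show ?thesis by (simp add: ss)
    qed
    ultimately have lower: "r / 4 \<le> s * ((y - x) \<bullet> e)" using s by linarith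
    then have "r / 4 \<le> \<bar>(y - x) \<bullet> e\<bar>" by (auto simp: s_def split: if_splits)
    then have "(r / 4)\<^sup>2 \<le> ((y - x) \<bullet> e)\<^sup>2" using r by (simp add: abs_le_square_iff[symmetric])
    then have "(norm v)\<^sup>2 * (r / 4)\<^sup>2 \<le> (norm v)\<^sup>2 * ((y - x) \<bullet> e)\<^sup>2" by (intro mult_left_mono) auto
    also have "\<dots> = ((y - x) \<bullet> v)\<^sup>2"
      by (subst (2) e(2)) (simp add: power_mult_distrib)
    finally have sq: "(norm v)\<^sup>2 * (r\<^sup>2 / 16) \<le> ((y - x) \<bullet> v)\<^sup>2" by (simp add: power_divide)
    have "y \<noteq> x" using lower r by auto
    moreover have "norm (y - x) \<le> 2 * r"
      using sub y x dist_triangle[of y x z] by (auto simp: dist_norm[symmetric] dist_commute)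
    ultimately have "(2 * r) powr (- real DIM('a)) \<le> norm (y - x) powr (- real DIM('a))"
      by (intro powr_mono2') auto
    then show ?thesis using sq by (intro mult_mono) auto
  qed
  then show ?thesis using sub by blast
qed

text \<open>Tonelli for the kernel, with y restricted to \<open>ball z r\<close>. For each x in the
  ball the integral over y is at least \<open>a\<close> |u(x)|^2, where \<open>a\<close> is the
  volume of the small ball times the lower bound of \<open>kernel_lower_bound\<close>; from above
  the double integral is at most \<open>D\<close> times the volume of the ball. The volume of the
  unit ball cancels, and 8 is the quotient of 2r and r / 4.\<close>

lemma ball_energy_le:
  fixes u :: "'a::euclidean_space \<Rightarrow> 'a"
  assumes [measurable]: "u \<in> borel_measurable borel" and D: "0 \<le> D"
    and bound: "AE y in lborel. (\<integral>\<^sup>+x. norm (y - x) powr (- real DIM('a)) * ((y - x) \<bullet> u x)\<^sup>2 \<partial>lborel) \<le> ennreal D"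
    and r: "0 < r"
  shows "(\<integral>\<^sup>+x. ennreal ((norm (u x))\<^sup>2) * indicator (ball z r) x \<partial>lborel) \<le> ennreal (16 * 8 ^ DIM('a) * D * r powr (real DIM('a) - 2))"
proof -
  define V where "V = unit_ball_vol (real DIM('a))"
  have V: "0 < V" by (simp add: V_def)
  define k where "k y x = norm (y - x) powr (- real DIM('a)) * ((y - x) \<bullet> u x)\<^sup>2" for y x
  have k0: "0 \<le> k y x" for y x by (simp add: k_def)
  have [measurable]: "(\<lambda>q. k (fst q) (snd q)) \<in> borel_measurable (lborel \<Otimes>\<^sub>M lborel)"
    "(\<lambda>q. k (snd q) (fst q)) \<in> borel_measurable (lborel \<Otimes>\<^sub>M lborel)"
    "k y \<in> borel_measurable borel" "(\<lambda>y. k y x) \<in> borel_measurable borel" for y x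
    unfolding k_def by measurable
  define a where "a = V * (r / 4) ^ DIM('a) * ((2 * r) powr (- real DIM('a)) * (r\<^sup>2 / 16))"
  have a: "a = V * r\<^sup>2 / (16 * 8 ^ DIM('a))" "0 < a"
  proof -
    have "(r / 4) ^ DIM('a) * (2 * r) powr (- real DIM('a)) = 1 / 8 ^ DIM('a)"
    proof -
      have "(2 * r) powr (- real DIM('a)) = 1 / (2 * r) ^ DIM('a)"
        using r by (simp add: powr_minus_divide powr_realpow)
      then have "(r / 4) ^ DIM('a) * (2 * r) powr (- real DIM('a)) = ((r / 4) / (2 * r)) ^ DIM('a)"
        by (simp only: power_divide times_divide_eq_right mult_1_right)
      also have "(r / 4) / (2 * r) = 1 / 8" using r by simp
      finally show ?thesis by (simp add: power_one_over)
    qed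
    then show "a = V * r\<^sup>2 / (16 * 8 ^ DIM('a))" by (simp add: a_def algebra_simps)
    then show "0 < a" using V r by simp
  qed
  have "ennreal a * (\<integral>\<^sup>+x. ennreal ((norm (u x))\<^sup>2) * indicator (ball z r) x \<partial>lborel)
    = (\<integral>\<^sup>+x. ennreal a * (ennreal ((norm (u x))\<^sup>2) * indicator (ball z r) x) \<partial>lborel)"
    by (rule nn_integral_cmult[symmetric]) measurable
  also have "\<dots> \<le> (\<integral>\<^sup>+x. (\<integral>\<^sup>+y. ennreal (k y x) * indicator (ball z r) y \<partial>lborel) \<partial>lborel)"
  proof (intro nn_integral_mono)
    fix x
    show "ennreal a * (ennreal ((norm (u x))\<^sup>2) * indicator (ball z r) x) \<le> (\<integral>\<^sup>+y. ennreal (k y x) * indicator (ball z r) y \<partial>lborel)"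
    proof (cases "x \<in> ball z r")
      case True
      define m where "m = (2 * r) powr (- real DIM('a)) * ((norm (u x))\<^sup>2 * (r\<^sup>2 / 16))"
      have m: "0 \<le> m" using r by (simp add: m_def)
      obtain c where c: "ball c (r / 4) \<subseteq> ball z r" "\<And>y. y \<in> ball c (r / 4) \<Longrightarrow> m \<le> k y x"
        using kernel_lower_bound[OF r True, of "u x"] unfolding k_def m_def by blast
      have "ennreal a * (ennreal ((norm (u x))\<^sup>2) * indicator (ball z r) x) = ennreal m * ennreal (V * (r / 4) ^ DIM('a))"
        using True V r a(2) m by (simp add: ennreal_mult'[symmetric] ennreal_mult''[symmetric] a_def m_def mult_ac)
      also have "\<dots> = (\<integral>\<^sup>+y. ennreal m * indicator (ball c (r / 4)) y \<partial>lborel)"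
        using r by (subst nn_integral_cmult_indicator) (simp_all add: emeasure_ball V_def)
      also have "\<dots> \<le> (\<integral>\<^sup>+y. ennreal (k y x) * indicator (ball z r) y \<partial>lborel)"
        using c by (intro nn_integral_mono) (auto simp: indicator_def intro: ennreal_leI)
      finally show ?thesis .
    qed simp
  qed
  also have "\<dots> = (\<integral>\<^sup>+y. (\<integral>\<^sup>+x. ennreal (k y x) * indicator (ball z r) y \<partial>lborel) \<partial>lborel)"
    by (rule lborel_pair.Fubini') (simp add: case_prod_beta')
  also have "\<dots> = (\<integral>\<^sup>+y. (\<integral>\<^sup>+x. ennreal (k y x) \<partial>lborel) * indicator (ball z r) y \<partial>lborel)"
    by (intro nn_integral_cong nn_integral_multc) simp
  also have "\<dots> \<le> (\<integral>\<^sup>+y. ennreal D * indicator (ball z r) y \<partial>lborel)"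
  proof (intro nn_integral_mono_AE)
    show "AE y in lborel. (\<integral>\<^sup>+x. ennreal (k y x) \<partial>lborel) * indicator (ball z r) y \<le> ennreal D * indicator (ball z r) y"
      using bound by eventually_elim (unfold k_def, rule mult_right_mono, simp_all)
  qed
  also have "\<dots> = ennreal D * ennreal (V * r ^ DIM('a))"
    using r by (subst nn_integral_cmult_indicator) (simp_all add: emeasure_ball V_def)
  also have "\<dots> = ennreal a * ennreal (16 * 8 ^ DIM('a) * D * r powr (real DIM('a) - 2))"
  proof -
    have "r ^ DIM('a) = r\<^sup>2 * r powr (real DIM('a) - 2)"
      using r powr_add[of r 2 "real DIM('a) - 2"] by (simp add: powr_realpow)
    then have "D * (V * r ^ DIM('a)) = a * (16 * 8 ^ DIM('a) * D * r powr (real DIM('a) - 2))"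
      unfolding a(1) by simp
    then show ?thesis using D V r a(2) by (simp add: ennreal_mult'[symmetric] ennreal_mult''[symmetric])
  qed
  finally show ?thesis using a(2) by (subst (asm) ennreal_mult_le_mult_iff) auto
qed

section \<open>The Newton potential of the Bernoulli function \<theta>\<close>

context decaying_solenoidal
begin

lemma A_nonneg: "0 \<le> A"
  using order_trans[OF zero_le_power2 u_decay[of 0]] by (simp add: decay_weight_def)

text \<open>Take \<open>u'_decay\<close> in direction \<open>u x\<close> and cancel one factor |u
  x|.\<close>

lemma convection_decay: "norm (u' x (u x)) \<le> A * decay_weight x"
proof (cases "u x = 0")
  case True
  then show ?thesis using A_nonneg linear_0[OF linear_u'] by simp
next
  case False
  then have "norm (u x) * norm (u' x (u x)) \<le> norm (u x) * (A * decay_weight x)"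
    using u'_decay[of x "u x"] by (simp add: mult_ac)
  then show ?thesis using False by (simp add: mult_le_cancel_left)
qed

text \<open>\<open>newton_convolution_pressure\<close> is applied to each component of the source,
  then \<open>convective_potential\<close> to its convective part; the integral of |u|^2 produced
  there cancels the one from the term |u|^2 / 2 of \<open>\<theta>\<close>. The Newton kernel is
  taken without its factor 1 / ((n - 2) omega).\<close>

lemma bernoulli_potential:
  fixes \<phi> :: "'a \<Rightarrow> 'a" and F :: real
  assumes \<phi>: "integrable lborel \<phi>" "\<And>x. norm (\<phi> x) \<le> F"
  defines "p \<equiv> \<lambda>x. \<Sum>b\<in>Basis. \<integral>z. (norm (x - z) powr (- real DIM('a)) * ((x - z) \<bullet> b)) * ((\<phi> z - u' z (u z)) \<bullet> b) \<partial>lborel"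
  defines "\<theta> \<equiv> \<lambda>x. p x / omega DIM('a) + (norm (u x))\<^sup>2 / 2"
  shows "\<theta> \<in> borel_measurable borel"
    and "\<And>y. integrable lborel (\<lambda>x. norm (y - x) powr (2 - real DIM('a)) * \<theta> x)"
    and "\<exists>B\<ge>0. \<forall>y. (\<integral>\<^sup>+x. norm (y - x) powr (2 - real DIM('a)) * \<bar>\<theta> x\<bar> \<partial>lborel) \<le> ennreal B"
    and "\<And>y. (\<integral>x. norm (y - x) powr (2 - real DIM('a)) * \<theta> x \<partial>lborel)
      = ((\<integral>z. norm (y - z) powr (2 - real DIM('a)) * ((y - z) \<bullet> \<phi> z) \<partial>lborel)
         + (real DIM('a) - 2) * (\<integral>z. norm (y - z) powr (- real DIM('a)) * ((y - z) \<bullet> u z)\<^sup>2 \<partial>lborel)) / 2"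
proof -
  have om: "0 < omega DIM('a)" by (simp add: omega_def)
  have [measurable]: "\<phi> \<in> borel_measurable borel" using \<phi> by (simp add: borel_measurable_integrable)
  define G where "G b z = (\<phi> z - u' z (u z)) \<bullet> b" for b z
  define P where "P b x = (\<integral>z. (norm (x - z) powr (- real DIM('a)) * ((x - z) \<bullet> b)) * G b z \<partial>lborel)" for b x
  define q where "q y x = norm (y - x) powr (2 - real DIM('a))" for y x :: 'a
  have [measurable]: "q y \<in> borel_measurable borel" for y unfolding q_def by measurable
  have q0: "0 \<le> q y x" for y x by (simp add: q_def)
  have p: "p x = (\<Sum>b\<in>Basis. P b x)" for x by (simp add: p_def P_def G_def)
  have Gb: "\<bar>G b x\<bar> \<le> F + A" if b: "b \<in> Basis" for b x
  proof -
    have "\<bar>G b x\<bar> \<le> norm (\<phi> x - u' x (u x))" unfolding G_def using b by (rule Basis_le_norm)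
    also have "\<dots> \<le> norm (\<phi> x) + norm (u' x (u x))" by (rule norm_triangle_ineq4)
    also have "norm (u' x (u x)) \<le> A * 1"
      using convection_decay[of x] mult_left_mono[OF decay_weight_le_1[of x] A_nonneg] by linarith
    finally show ?thesis using \<phi>(2)[of x] by simp
  qed
  have conv: "integrable lborel (\<lambda>x. u' x (u x))"
    by (rule Bochner_Integration.integrable_bound[OF integrable_mult_right[OF integrable_decay_weight, of A]])
       (use convection_decay A_nonneg in auto)
  have Gi: "integrable lborel (G b)" for b
    unfolding G_def[abs_def] using \<phi>(1) conv by (intro integrable_inner_left Bochner_Integration.integrable_diff)
  have np: "P b \<in> borel_measurable borel"
      "\<And>y. integrable lborel (\<lambda>x. q y x * P b x)"
      "\<exists>B\<ge>0. \<forall>y. (\<integral>\<^sup>+x. q y x * \<bar>P b x\<bar> \<partial>lborel) \<le> ennreal B"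
      "\<And>y. (\<integral>x. q y x * P b x \<partial>lborel) = omega DIM('a) / 2 * (\<integral>z. q y z * ((y - z) \<bullet> b) * G b z \<partial>lborel)"
    if b: "b \<in> Basis" for b
    unfolding P_def[abs_def] q_def by (rule newton_convolution_pressure[OF dim Gb[OF b] Gi])+
  note Pm [measurable] = np(1) and qP = np(2)
  show \<theta>m [measurable]: "\<theta> \<in> borel_measurable borel"
    unfolding \<theta>_def p by measurable
  have qu: "integrable lborel (\<lambda>x. q y x * (norm (u x))\<^sup>2)" for y
    using convective_potential(2)[of y] by (simp add: q_def)
  have q\<theta>: "q y x * \<theta> x = (\<Sum>b\<in>Basis. q y x * P b x) / omega DIM('a) + q y x * (norm (u x))\<^sup>2 / 2" for y x
    by (simp add: \<theta>_def p sum_distrib_left ring_distribs)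
  show "integrable lborel (\<lambda>x. norm (y - x) powr (2 - real DIM('a)) * \<theta> x)" for y
    unfolding q_def[symmetric] q\<theta>
    by (intro Bochner_Integration.integrable_add integrable_divide_zero Bochner_Integration.integrable_sum qP qu)
  have "\<forall>b\<in>Basis. \<exists>B. 0 \<le> B \<and> (\<forall>y. (\<integral>\<^sup>+x. q y x * \<bar>P b x\<bar> \<partial>lborel) \<le> ennreal B)"
    using np(3) by simp
  from bchoice[OF this] obtain B where B: "\<And>b. b \<in> Basis \<Longrightarrow> 0 \<le> B b"
     "\<And>b y. b \<in> Basis \<Longrightarrow> (\<integral>\<^sup>+x. q y x * \<bar>P b x\<bar> \<partial>lborel) \<le> ennreal (B b)" by blast
  have "\<bar>(norm (u x))\<^sup>2\<bar> \<le> A" for x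
    using u_decay[of x] mult_left_mono[OF decay_weight_le_1[of x] A_nonneg] by simp
  moreover have "integrable lborel (\<lambda>x. (norm (u x))\<^sup>2)"
    by (rule integrable_le_decay_weight[of _ A]) (use u_decay in auto)
  ultimately have "\<exists>B\<ge>0. \<forall>y. (\<integral>\<^sup>+x. norm (y - x) powr (- (real DIM('a) - 2)) * \<bar>(norm (u x))\<^sup>2\<bar> \<partial>lborel) \<le> ennreal B"
    using dim by (intro nn_integral_riesz_bounded) auto
  then obtain B' where B': "0 \<le> B'" "\<And>y. (\<integral>\<^sup>+x. q y x * (norm (u x))\<^sup>2 \<partial>lborel) \<le> ennreal B'"
    by (auto simp: q_def)
  define S where "S = (\<Sum>b\<in>Basis. B b) / omega DIM('a) + B'"
  have S: "0 \<le> S" using B(1) B'(1) om by (auto simp: S_def intro!: add_nonneg_nonneg divide_nonneg_pos sum_nonneg)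
  have "(\<integral>\<^sup>+x. q y x * \<bar>\<theta> x\<bar> \<partial>lborel) \<le> ennreal S" for y
  proof -
    have "(\<integral>\<^sup>+x. q y x * \<bar>\<theta> x\<bar> \<partial>lborel)
      \<le> (\<integral>\<^sup>+x. ennreal (1 / omega DIM('a)) * (\<Sum>b\<in>Basis. ennreal (q y x * \<bar>P b x\<bar>)) + ennreal (q y x * (norm (u x))\<^sup>2) \<partial>lborel)"
    proof (intro nn_integral_mono)
      fix x
      have "q y x * \<bar>\<theta> x\<bar> = \<bar>q y x * \<theta> x\<bar>" using q0 by (simp add: abs_mult)
      also have "\<dots> \<le> \<bar>(\<Sum>b\<in>Basis. q y x * P b x) / omega DIM('a)\<bar> + \<bar>q y x * (norm (u x))\<^sup>2 / 2\<bar>"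
        unfolding q\<theta> by (rule abs_triangle_ineq)
      also have "\<bar>(\<Sum>b\<in>Basis. q y x * P b x) / omega DIM('a)\<bar> \<le> 1 / omega DIM('a) * (\<Sum>b\<in>Basis. q y x * \<bar>P b x\<bar>)"
      proof -
        have "\<bar>\<Sum>b\<in>Basis. q y x * P b x\<bar> \<le> (\<Sum>b\<in>Basis. q y x * \<bar>P b x\<bar>)"
          using sum_abs[of "\<lambda>b. q y x * P b x" Basis] q0 by (simp add: abs_mult)
        then show ?thesis using om by (simp add: divide_right_mono)
      qed
      also have "\<bar>q y x * (norm (u x))\<^sup>2 / 2\<bar> \<le> q y x * (norm (u x))\<^sup>2"
        using q0[of y x] by (simp add: abs_mult)
      finally have "q y x * \<bar>\<theta> x\<bar> \<le> 1 / omega DIM('a) * (\<Sum>b\<in>Basis. q y x * \<bar>P b x\<bar>) + q y x * (norm (u x))\<^sup>2" by simp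
      then have "ennreal (q y x * \<bar>\<theta> x\<bar>) \<le> ennreal (1 / omega DIM('a) * (\<Sum>b\<in>Basis. q y x * \<bar>P b x\<bar>) + q y x * (norm (u x))\<^sup>2)"
        by (rule ennreal_leI)
      also have "\<dots> = ennreal (1 / omega DIM('a)) * (\<Sum>b\<in>Basis. ennreal (q y x * \<bar>P b x\<bar>)) + ennreal (q y x * (norm (u x))\<^sup>2)"
      proof -
        have "(\<Sum>b\<in>Basis. ennreal (q y x * \<bar>P b x\<bar>)) = ennreal (\<Sum>b\<in>Basis. q y x * \<bar>P b x\<bar>)"
          using q0 by (intro sum_ennreal) simp
        then show ?thesis
          using om q0 by (simp only: ennreal_mult'[symmetric] zero_le_divide_1_iff less_imp_le)
            (intro ennreal_plus mult_nonneg_nonneg sum_nonneg, auto)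
      qed
      finally show "ennreal (q y x * \<bar>\<theta> x\<bar>) \<le> \<dots>" .
    qed
    also have "\<dots> = ennreal (1 / omega DIM('a)) * (\<Sum>b\<in>Basis. (\<integral>\<^sup>+x. ennreal (q y x * \<bar>P b x\<bar>) \<partial>lborel)) + (\<integral>\<^sup>+x. ennreal (q y x * (norm (u x))\<^sup>2) \<partial>lborel)"
      by (subst nn_integral_add) (auto simp: nn_integral_cmult nn_integral_sum)
    also have "\<dots> \<le> ennreal (1 / omega DIM('a)) * (\<Sum>b\<in>Basis. ennreal (B b)) + ennreal B'"
      by (intro add_mono mult_left_mono sum_mono B B') auto
    also have "\<dots> = ennreal S"
      using om B(1) B'(1) by (simp add: S_def sum_ennreal ennreal_mult'[symmetric] sum_nonneg ennreal_plus[symmetric] del: ennreal_plus)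
    finally show ?thesis .
  qed
  then show "\<exists>B\<ge>0. \<forall>y. (\<integral>\<^sup>+x. norm (y - x) powr (2 - real DIM('a)) * \<bar>\<theta> x\<bar> \<partial>lborel) \<le> ennreal B"
    using S by (auto simp: q_def)
  show "(\<integral>x. norm (y - x) powr (2 - real DIM('a)) * \<theta> x \<partial>lborel)
      = ((\<integral>z. norm (y - z) powr (2 - real DIM('a)) * ((y - z) \<bullet> \<phi> z) \<partial>lborel)
         + (real DIM('a) - 2) * (\<integral>z. norm (y - z) powr (- real DIM('a)) * ((y - z) \<bullet> u z)\<^sup>2 \<partial>lborel)) / 2" for y
  proof -
    have K: "integrable lborel (\<lambda>z. q y z * ((y - z) \<bullet> b) * G b z)" if b: "b \<in> Basis" for b
    proof -
      obtain B where "(\<integral>\<^sup>+x. norm (y - x) powr (- (real DIM('a) - 3)) * \<bar>G b x\<bar> \<partial>lborel) \<le> ennreal B"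
        using nn_integral_riesz_bounded[of "real DIM('a) - 3" "G b", OF _ _ Gb[OF b] Gi] dim by auto
      then have fin: "(\<integral>\<^sup>+x. norm (y - x) powr (- (real DIM('a) - 3)) * \<bar>G b x\<bar> \<partial>lborel) < \<infinity>"
        by (auto intro: order.strict_trans1)
      have [measurable]: "G b \<in> borel_measurable borel" using Gi by (simp add: borel_measurable_integrable)
      have "integrable lborel (\<lambda>x. norm (y - x) powr (- (real DIM('a) - 3)) * \<bar>G b x\<bar>)"
        using fin by (intro integrableI_nonneg) auto
      then show ?thesis
      proof (rule Bochner_Integration.integrable_bound)
        have "\<bar>q y z * ((y - z) \<bullet> b) * G b z\<bar> \<le> q y z * norm (y - z) * \<bar>G b z\<bar>" for z
          unfolding abs_mult using Basis_le_norm[OF b, of "y - z"] q0[of y z] by (intro mult_right_mono mult_mono) auto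
        then show "AE z in lborel. norm (q y z * ((y - z) \<bullet> b) * G b z) \<le> norm (norm (y - z) powr (- (real DIM('a) - 3)) * \<bar>G b z\<bar>)"
          by (simp add: q_def powr_mult_self abs_mult)
      qed simp
    qed
    have wG: "(\<Sum>b\<in>Basis. q y z * ((y - z) \<bullet> b) * G b z) = q y z * ((y - z) \<bullet> \<phi> z) - q y z * ((y - z) \<bullet> u' z (u z))" for z
    proof -
      have "(\<Sum>b\<in>Basis. q y z * ((y - z) \<bullet> b) * G b z) = q y z * ((y - z) \<bullet> (\<phi> z - u' z (u z)))"
        by (subst euclidean_inner) (simp add: G_def sum_distrib_left mult.assoc)
      then show ?thesis by (simp add: inner_diff_right algebra_simps)
    qed
    have iw: "integrable lborel (\<lambda>z. q y z * ((y - z) \<bullet> u' z (u z)))"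
      using convective_potential(3)[of y] by (simp add: q_def)
    have "integrable lborel (\<lambda>z. (\<Sum>b\<in>Basis. q y z * ((y - z) \<bullet> b) * G b z) + q y z * ((y - z) \<bullet> u' z (u z)))"
      by (intro Bochner_Integration.integrable_add Bochner_Integration.integrable_sum K iw)
    then have i\<phi>: "integrable lborel (\<lambda>z. q y z * ((y - z) \<bullet> \<phi> z))" by (simp add: wG)
    have "(\<integral>x. q y x * \<theta> x \<partial>lborel) = (\<Sum>b\<in>Basis. \<integral>x. q y x * P b x \<partial>lborel) / omega DIM('a) + (\<integral>x. q y x * (norm (u x))\<^sup>2 \<partial>lborel) / 2"
      unfolding q\<theta>
      by (subst Bochner_Integration.integral_add)
        (auto intro!: integrable_divide_zero Bochner_Integration.integrable_sum qP qu simp: Bochner_Integration.integral_sum qP)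
    also have "(\<Sum>b\<in>Basis. \<integral>x. q y x * P b x \<partial>lborel) = (\<Sum>b\<in>Basis. omega DIM('a) / 2 * (\<integral>z. q y z * ((y - z) \<bullet> b) * G b z \<partial>lborel))"
      by (intro sum.cong refl np(4))
    also have "\<dots> = omega DIM('a) / 2 * (\<integral>z. (\<Sum>b\<in>Basis. q y z * ((y - z) \<bullet> b) * G b z) \<partial>lborel)"
      by (subst Bochner_Integration.integral_sum) (auto intro: K simp: sum_distrib_left)
    also have "(\<integral>z. (\<Sum>b\<in>Basis. q y z * ((y - z) \<bullet> b) * G b z) \<partial>lborel)
      = (\<integral>z. q y z * ((y - z) \<bullet> \<phi> z) \<partial>lborel) - (\<integral>z. q y z * ((y - z) \<bullet> u' z (u z)) \<partial>lborel)"
      unfolding wG using i\<phi> iw by (rule Bochner_Integration.integral_diff)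
    also have "(\<integral>z. q y z * ((y - z) \<bullet> u' z (u z)) \<partial>lborel) = (\<integral>z. q y z * (norm (u z))\<^sup>2 \<partial>lborel)
         - (real DIM('a) - 2) * (\<integral>z. norm (y - z) powr (- real DIM('a)) * ((y - z) \<bullet> u z)\<^sup>2 \<partial>lborel)"
      using convective_potential(4)[of y] by (simp add: q_def)
    finally have "(\<integral>x. q y x * \<theta> x \<partial>lborel) = omega DIM('a) / 2 * ((\<integral>z. q y z * ((y - z) \<bullet> \<phi> z) \<partial>lborel)
      - ((\<integral>z. q y z * (norm (u z))\<^sup>2 \<partial>lborel)
         - (real DIM('a) - 2) * (\<integral>z. norm (y - z) powr (- real DIM('a)) * ((y - z) \<bullet> u z)\<^sup>2 \<partial>lborel))) / omega DIM('a)
      + (\<integral>z. q y z * (norm (u z))\<^sup>2 \<partial>lborel) / 2" .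
    \<comment> \<open>\<open>Z\<close> stands for the integral of |u|^2 against the kernel, which
      drops out here.\<close>
    moreover have "omega DIM('a) / 2 * (X - (Z - W)) / omega DIM('a) + Z / 2 = (X + W) / 2" for X Z W
      using om by (simp add: field_simps)
    ultimately show ?thesis by (simp only: q_def)
  qed
qed

end

section \<open>Weighted fixed points\<close>

text \<open>Cauchy-Schwarz in each row: the Frobenius norm dominates the operator norm.\<close>

lemma norm_matrix_vector_mult_le: "norm (A *v x) \<le> norm A * norm x" for A :: "real^'n^'m"
proof -
  have "\<bar>(A *v x) $ i\<bar> \<le> norm (A $ i) * norm x" for i
    using Cauchy_Schwarz_ineq2[of "A $ i" x] by (simp add: matrix_vector_mul_component)
  then have "L2_set (\<lambda>i. norm ((A *v x) $ i)) UNIV \<le> L2_set (\<lambda>i. norm (A $ i) * norm x) UNIV"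
    by (intro L2_set_mono) auto
  then show ?thesis by (simp add: norm_vec_def L2_set_left_distrib)
qed

lemma sum_Basis_vec: "(\<Sum>b\<in>Basis. f b) = (\<Sum>i\<in>UNIV. f (axis i 1))" for f :: "real^'n \<Rightarrow> real"
proof -
  have B: "(Basis :: (real^'n) set) = range (\<lambda>i. axis i 1)" by (auto simp: Basis_vec_def)
  have "inj (\<lambda>i::'n. axis i (1::real))" by (auto simp: inj_on_def axis_eq_axis)
  then show ?thesis unfolding B by (simp add: sum.reindex)
qed

lemma powi_eq_powr: "0 < x \<Longrightarrow> x powi k = x powr (real_of_int k)" for x :: real
  by (simp add: powr_real_of_int')

text \<open>At the origin both sides are 0: \<open>inverse 0\<close> is 0, and so is
  \<open>0 powr a\<close>.\<close>

lemma norm_powi_eq_powr: "k < 0 \<Longrightarrow> norm x powi k = norm x powr (real_of_int k)"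
  for x :: "'a::real_normed_vector"
  by (cases "x = 0") (auto simp: powi_eq_powr)

section \<open>Decay of the fields in X\<close>

lemma SUP_add_SUP_finite_bounds:
  fixes f g :: "'a \<Rightarrow> real"
  assumes "\<And>x. 0 \<le> f x" "\<And>x. 0 \<le> g x" and fin: "(SUP x. ereal (f x)) + (SUP x. ereal (g x)) < \<infinity>"
  shows "\<exists>A\<ge>0. \<forall>x. f x \<le> A \<and> g x \<le> A"
proof -
  have f: "ereal (f x) \<le> (SUP x. ereal (f x))" and g: "ereal (g x) \<le> (SUP x. ereal (g x))" for x
    by (intro SUP_upper; simp)+
  have "0 \<le> (SUP x. ereal (f x))" "0 \<le> (SUP x. ereal (g x))"
    using order_trans[OF _ f] order_trans[OF _ g] assms(1,2) by (metis ereal_less_eq(5))+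
  with fin obtain a b where ab: "(SUP x. ereal (f x)) = ereal a" "(SUP x. ereal (g x)) = ereal b"
    by (cases "(SUP x. ereal (f x))"; cases "(SUP x. ereal (g x))") auto
  have le: "f x \<le> a" "g x \<le> b" for x using f[of x] g[of x] ab by auto
  have "0 \<le> max a b" using le(1) assms(1) by (meson max.coboundedI1 order_trans)
  with le show ?thesis by (intro exI[of _ "max a b"]) (auto intro: max.coboundedI1 max.coboundedI2)
qed

lemma X_space_decay:
  fixes u :: "real^'n \<Rightarrow> real^'n"
  assumes "u \<in> X_space"
  shows "\<exists>A\<ge>0. \<forall>x. norm (u x) \<le> A * (1 + norm x) powr (3 - real CARD('n)) \<and>
     norm (jacobian u (at x)) \<le> A * (1 + norm x) powr (2 - real CARD('n))"
proof -
  let ?f = "\<lambda>x. (1 + norm x) powi (int CARD('n) - 3) * norm (u x)"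
  let ?g = "\<lambda>x. (1 + norm x) powi (int CARD('n) - 2) * norm (jacobian u (at x))"
  obtain A where A: "A \<ge> 0" "\<And>x. ?f x \<le> A" "\<And>x. ?g x \<le> A"
    using SUP_add_SUP_finite_bounds[of ?f ?g] assms by (auto simp: X_space_def X_norm_def)
  have *: "a \<le> A * (1 + norm x) powr (- q)" if "(1 + norm x) powr q * a \<le> A" for a q and x :: "real^'n"
  proof -
    have "(1 + norm x) powr q * (1 + norm x) powr (- q) = 1"
      unfolding powr_add[symmetric] by (simp add: add_nonneg_eq_0_iff)
    then have "a = ((1 + norm x) powr q * a) * (1 + norm x) powr (- q)" by (simp add: mult_ac)
    also have "\<dots> \<le> A * (1 + norm x) powr (- q)" using that by (intro mult_right_mono) auto
    finally show ?thesis .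
  qed
  have p: "0 < 1 + norm x" for x :: "real^'n" by (simp add: add_pos_nonneg)
  have "norm (u x) \<le> A * (1 + norm x) powr (3 - real CARD('n))" for x
    using A(2)[of x] *[of x "real CARD('n) - 3" "norm (u x)"] p[of x] by (simp add: powi_eq_powr)
  moreover have "norm (jacobian u (at x)) \<le> A * (1 + norm x) powr (2 - real CARD('n))" for x
    using A(3)[of x] *[of x "real CARD('n) - 2" "norm (jacobian u (at x))"] p[of x] by (simp add: powi_eq_powr)
  ultimately show ?thesis using A(1) by blast
qed

text \<open>The two products decay with exponents 6 - 2n and 5 - 2n, and 6 - 2n <= -(n + 1) holds
  from n = 7 on.\<close>

lemma X_space_decaying_solenoidal:
  fixes u :: "real^'n \<Rightarrow> real^'n"
  assumes n: "CARD('n) \<ge> 7" and u: "u \<in> X_space"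
  shows "\<exists>A. decaying_solenoidal u (\<lambda>x e. jacobian u (at x) *v e) A"
proof -
  obtain A where A: "A \<ge> 0" "\<And>x. norm (u x) \<le> A * (1 + norm x) powr (3 - real CARD('n))"
     "\<And>x. norm (jacobian u (at x)) \<le> A * (1 + norm x) powr (2 - real CARD('n))"
    using X_space_decay[OF u] by blast
  have p: "1 \<le> 1 + norm x" for x :: "real^'n" by simp
  have "decaying_solenoidal u (\<lambda>x e. jacobian u (at x) *v e) (A * A)"
  proof
    show "3 < DIM(real^'n)" using n by simp
    show "(u has_derivative (*v) (jacobian u (at x))) (at x)" for x
      using u by (subst jacobian_works[symmetric]) (auto simp: X_space_def differentiable_on_def)
    show "(\<lambda>x. jacobian u (at x) *v e) \<in> borel_measurable borel" for e
    proof (rule borel_measurable_continuous_onI)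
      have "continuous_on UNIV (\<lambda>x. jacobian u (at x))" using u by (simp add: X_space_def)
      then show "continuous_on UNIV (\<lambda>x. jacobian u (at x) *v e)"
        unfolding matrix_vector_mult_def by (intro continuous_intros)
    qed
    show "(\<Sum>b\<in>Basis. (jacobian u (at x) *v b) \<bullet> b) = 0" for x
      using u unfolding sum_Basis_vec
      by (simp add: inner_axis matrix_vector_mult_basis column_def X_space_def trace_def)
    show "(norm (u x))\<^sup>2 \<le> A * A * decay_weight x" for x
    proof -
      have "(norm (u x))\<^sup>2 \<le> (A * (1 + norm x) powr (3 - real CARD('n)))\<^sup>2"
        using A(2)[of x] by (intro power_mono) auto
      also have "\<dots> = A * A * (1 + norm x) powr (2 * (3 - real CARD('n)))"
        by (simp add: power_mult_distrib power2_eq_square powr_add[symmetric])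
      also have "(1 + norm x) powr (2 * (3 - real CARD('n))) \<le> (1 + norm x) powr (- (real DIM(real^'n) + 1))"
        using n by (intro powr_mono p) simp
      finally show ?thesis using A(1) by (simp add: decay_weight_def mult_left_mono)
    qed
    show "norm (u x) * norm (jacobian u (at x) *v e) \<le> A * A * decay_weight x * norm e" for x e
    proof -
      have "norm (u x) * norm (jacobian u (at x) *v e) \<le> norm (u x) * (norm (jacobian u (at x)) * norm e)"
        by (intro mult_left_mono norm_matrix_vector_mult_le) auto
      also have "\<dots> \<le> (A * (1 + norm x) powr (3 - real CARD('n))) * (A * (1 + norm x) powr (2 - real CARD('n)) * norm e)"
        using A by (intro mult_mono) auto
      also have "\<dots> = A * A * (1 + norm x) powr (5 - 2 * real CARD('n)) * norm e"
        by (simp add: powr_add[symmetric])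
      also have "\<dots> \<le> A * A * decay_weight x * norm e"
        unfolding decay_weight_def using n A(1) by (intro mult_right_mono mult_left_mono powr_mono p) auto
      finally show ?thesis .
    qed
  qed
  then show ?thesis by blast
qed

section \<open>Essential bounds and Borel representatives\<close>

lemma emeasure_lebesgue_space_nonzero: "emeasure lebesgue (space (lebesgue :: (real^'n) measure)) \<noteq> 0"
  by (simp add: emeasure_lborel_UNIV)

text \<open>Rules out the value -\<infinity>, which \<open>real_of_ereal\<close> would send to
  0.\<close>

lemma esssup_norm_nonneg:
  fixes g :: "real^'n \<Rightarrow> 'b::euclidean_space"
  assumes "g \<in> borel_measurable lebesgue"
  shows "0 \<le> esssup lebesgue (\<lambda>x. ereal (norm (g x)))"
proof -
  have "esssup lebesgue (\<lambda>x::real^'n. 0::ereal) \<le> esssup lebesgue (\<lambda>x. ereal (norm (g x)))"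
    by (rule esssup_mono) auto
  then show ?thesis by (simp add: esssup_const[OF emeasure_lebesgue_space_nonzero])
qed

lemma Linfty_norm_bound:
  assumes g: "Linfty g"
  shows "0 \<le> Linfty_norm g" "AE x in lebesgue. norm (g x) \<le> Linfty_norm g"
proof -
  have "0 \<le> esssup lebesgue (\<lambda>x. ereal (norm (g x)))" "esssup lebesgue (\<lambda>x. ereal (norm (g x))) < \<infinity>"
    using g by (auto simp: Linfty_def intro: esssup_norm_nonneg)
  then obtain r where r: "esssup lebesgue (\<lambda>x. ereal (norm (g x))) = ereal r" "0 \<le> r"
    by (cases "esssup lebesgue (\<lambda>x. ereal (norm (g x)))") auto
  show "0 \<le> Linfty_norm g" using r by (simp add: Linfty_norm_def)
  show "AE x in lebesgue. norm (g x) \<le> Linfty_norm g"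
    using esssup_AE[of "\<lambda>x. ereal (norm (g x))" lebesgue] r by (simp add: Linfty_norm_def)
qed

lemma Linfty_bounded:
  assumes g: "g \<in> borel_measurable lebesgue" and b: "\<And>x. norm (g x) \<le> c"
  shows "Linfty g" "Linfty_norm g \<le> c"
proof -
  have le: "esssup lebesgue (\<lambda>x. ereal (norm (g x))) \<le> ereal c"
    using g b by (intro esssup_I) auto
  then show "Linfty g" using g by (auto simp: Linfty_def intro: order.strict_trans1)
  show "Linfty_norm g \<le> c"
    using le esssup_norm_nonneg[OF g]
    by (cases "esssup lebesgue (\<lambda>x. ereal (norm (g x)))") (auto simp: Linfty_norm_def)
qed

text \<open>The complement of the essential support is a union of balls on each of which
  \<open>f\<close> vanishes almost everywhere. By Lindelof countably many of them cover it, so the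
  exceptional sets add up to a null set.\<close>

lemma AE_zero_outside_ess_support:
  fixes f :: "real^'n \<Rightarrow> 'b::euclidean_space"
  shows "AE x in lebesgue. x \<notin> ess_support f \<longrightarrow> f x = 0"
proof -
  define F where "F = {ball x r |x r. 0 < r \<and> (AE y in lebesgue. y \<in> ball x r \<longrightarrow> f y = 0)}"
  have "\<And>S. S \<in> F \<Longrightarrow> open S" by (auto simp: F_def)
  then obtain F' where F': "F' \<subseteq> F" "countable F'" "\<Union>F' = \<Union>F" by (rule Lindelof)
  have AE: "AE x in lebesgue. \<forall>S\<in>F'. x \<in> S \<longrightarrow> f x = 0"
    using F' by (subst AE_ball_countable) (auto simp: F_def)
  have "x \<in> \<Union>F'" if "x \<notin> ess_support f" for x
  proof -
    obtain r where "r > 0" "AE y in lebesgue. y \<in> ball x r \<longrightarrow> f y = 0"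
      using \<open>x \<notin> ess_support f\<close> by (auto simp: ess_support_def)
    then have "ball x r \<in> F" "x \<in> ball x r" by (auto simp: F_def)
    then show ?thesis unfolding F'(3) by blast
  qed
  then show ?thesis by (intro eventually_mono[OF AE]) blast
qed

text \<open>Setting a Borel version to 0 outside the ball and where its norm exceeds the essential
  bound changes it on a null set only, and makes the bound hold at every point.\<close>

lemma Linfty_borel_representative:
  fixes f :: "real^'n \<Rightarrow> real^'m"
  assumes f: "Linfty f" and supp: "ess_support f \<subseteq> ball 0 R"
  shows "\<exists>f'\<in>borel_measurable borel. (AE x in lebesgue. f x = f' x) \<and>
    (\<forall>x. norm (f' x) \<le> Linfty_norm f * indicator (ball 0 R) x)"
proof -
  have "\<forall>i. \<exists>h\<in>borel_measurable lborel. AE x in lborel. f x $ i = h x"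
  proof (intro allI completion_ex_borel_measurable_real)
    fix i
    have "(\<lambda>v::real^'m. v $ i) \<in> borel_measurable borel"
      by (intro borel_measurable_continuous_onI continuous_intros)
    then show "(\<lambda>x. f x $ i) \<in> borel_measurable lebesgue"
      using f by (auto simp: Linfty_def intro: measurable_compose)
  qed
  then obtain h where h: "\<And>i. h i \<in> borel_measurable lborel" "\<And>i. AE x in lborel. f x $ i = h i x" by metis
  define h' where "h' x = (\<chi> i. h i x)" for x
  have [measurable]: "h' \<in> borel_measurable borel"
    using h(1) by (subst borel_measurable_euclidean_space) (auto simp: h'_def Basis_vec_def inner_axis)
  have "AE x in lborel. \<forall>i. f x $ i = h i x" using h(2) by (simp add: AE_all_countable)
  then have "AE x in lebesgue. f x = h' x"
    by (intro AE_completion) (simp add: h'_def vec_eq_iff)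
  define f' where "f' x = (if norm (h' x) \<le> Linfty_norm f \<and> norm x < R then h' x else 0)" for x
  have "f' \<in> borel_measurable borel"
    unfolding f'_def[abs_def] by measurable
  moreover have "AE x in lebesgue. f x = f' x"
    using \<open>AE x in lebesgue. f x = h' x\<close> Linfty_norm_bound(2)[OF f] AE_zero_outside_ess_support[of f]
    by eventually_elim (use supp in \<open>auto simp: f'_def\<close>)
  moreover have "norm (f' x) \<le> Linfty_norm f * indicator (ball 0 R) x" for x
    using Linfty_norm_bound(1)[OF f] by (auto simp: f'_def indicator_def)
  ultimately show ?thesis by (intro bexI[of _ f'] conjI allI)
qed

section \<open>The kernels as real powers of the norm, and the passage to
  \<open>lborel\<close>\<close>

lemma newton_kernel_powr:
  "CARD('n) > 2 \<Longrightarrow> newton_kernel (w :: real^'n) = norm w powr (2 - real CARD('n)) / ((real CARD('n) - 2) * omega CARD('n))"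
  by (simp add: newton_kernel_def norm_powi_eq_powr)

lemma pressure_kernel_powr:
  "pressure_kernel j (w :: real^'n) = norm w powr (- real CARD('n)) * (w \<bullet> axis j 1) / omega CARD('n)"
  by (cases "w = 0") (simp_all add: pressure_kernel_def inner_axis powr_minus_divide powr_realpow mult.commute)

lemma has_derivative_norm_powr:
  fixes w :: "'a::euclidean_space"
  assumes w: "w \<noteq> 0"
  shows "((\<lambda>v. norm v powr p) has_derivative (\<lambda>e. p * norm w powr (p - 2) * (w \<bullet> e))) (at w)"
proof -
  have N: "norm v powr q = (v \<bullet> v) powr (q / 2)" for v :: 'a and q
    by (simp add: norm_eq_sqrt_inner powr_half_sqrt[symmetric] powr_powr)
  have d1: "((\<lambda>v. v \<bullet> v) has_derivative (\<lambda>e. w \<bullet> e + e \<bullet> w)) (at w)"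
    by (rule has_derivative_inner[OF has_derivative_ident has_derivative_ident])
  have pos: "0 < w \<bullet> w" using w by simp
  have d2: "((\<lambda>s. s powr (p / 2)) has_derivative (\<lambda>h. (p / 2 * (w \<bullet> w) powr (p / 2 - 1)) * h)) (at (w \<bullet> w))"
    using has_real_derivative_powr[OF pos] by (rule has_field_derivative_imp_has_derivative)
  have e: "p / 2 - 1 = (p - 2) / 2" by (simp add: field_simps)
  show ?thesis
    unfolding N by (rule has_derivative_eq_rhs[OF has_derivative_compose[OF d1 d2]])
      (simp add: e inner_commute fun_eq_iff)
qed

text \<open>Differentiating |w|^(4-n) yields the factor 4 - n, which cancels the n - 4 of the
  kernel. Hence -d_i \<Psi> = x_i \<Gamma> / 2, which is also \<Gamma> * P_i; this is how the force
  part of the pressure potential becomes \<open>force_potential\<close>.\<close>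

lemma partial_deriv_bilaplace_kernel:
  fixes w :: "real^'n"
  assumes n: "CARD('n) > 4" and w: "w \<noteq> 0"
  shows "partial_deriv i bilaplace_kernel w
    = - (norm w powr (2 - real CARD('n)) * (w $ i)) / (2 * (real CARD('n) - 2) * omega CARD('n))"
proof -
  define c where "c = 2 * (real CARD('n) - 4) * (real CARD('n) - 2) * omega CARD('n)"
  have b: "bilaplace_kernel = (\<lambda>v::real^'n. norm v powr (4 - real CARD('n)) / c)"
    using n by (simp add: fun_eq_iff bilaplace_kernel_def norm_powi_eq_powr c_def)
  have "(bilaplace_kernel has_derivative (\<lambda>e. (4 - real CARD('n)) * norm w powr (4 - real CARD('n) - 2) * (w \<bullet> e) / c)) (at w)"
    unfolding b divide_inverse by (intro has_derivative_mult_left has_derivative_norm_powr w)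
  from frechet_derivative_at[OF this, symmetric]
  have "partial_deriv i bilaplace_kernel w = (4 - real CARD('n)) * norm w powr (2 - real CARD('n)) * (w $ i) / c"
    by (simp add: partial_deriv_def inner_axis)
  also have "\<dots> = - (norm w powr (2 - real CARD('n)) * (w $ i)) / (2 * (real CARD('n) - 2) * omega CARD('n))"
  proof -
    have "omega CARD('n) > 0" by (simp add: omega_def)
    then show ?thesis using n by (simp add: c_def divide_simps) (simp add: algebra_simps)
  qed
  finally show ?thesis .
qed

text \<open>The definitions integrate over the completed measure, the analysis takes place on
  \<open>lborel\<close>. Completeness makes \<open>g\<close> measurable as soon as it agrees almost
  everywhere with a Borel function.\<close>

lemma lebesgue_integral_AE_borel:
  fixes g h :: "'a::euclidean_space \<Rightarrow> real"
  assumes h: "h \<in> borel_measurable borel" and eq: "AE x in lebesgue. g x = h x"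
  shows "integrable lebesgue g \<longleftrightarrow> integrable lborel h"
    and "(\<integral>x. g x \<partial>lebesgue) = (\<integral>x. h x \<partial>lborel)"
proof -
  have h': "h \<in> borel_measurable lebesgue" using h by (intro measurable_completion) simp
  have g: "g \<in> borel_measurable lebesgue"
    by (rule borel_measurable_AE[OF h']) (use eq in \<open>auto elim: eventually_mono\<close>)
  have "integrable lebesgue g \<longleftrightarrow> integrable lebesgue h" by (rule integrable_cong_AE[OF g h' eq])
  then show "integrable lebesgue g \<longleftrightarrow> integrable lborel h"
    using h by (simp add: integrable_completion)
  have "(\<integral>x. g x \<partial>lebesgue) = (\<integral>x. h x \<partial>lebesgue)" by (rule integral_cong_AE[OF g h' eq])
  then show "(\<integral>x. g x \<partial>lebesgue) = (\<integral>x. h x \<partial>lborel)"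
    using h by (simp add: integral_completion)
qed

text \<open>\<open>f'\<close> is a bounded Borel representative of \<open>f\<close>, so that Fubini's theorem on \<open>lborel\<close> applies.\<close>

locale fixed_point =
  fixes R0 :: real and f :: "real^'n \<Rightarrow> real^'n" and \<tau> :: real and u :: "real^'n \<Rightarrow> real^'n"
    and f' :: "real^'n \<Rightarrow> real^'n" and A :: real
  assumes card: "CARD('n) \<ge> 16" and R0: "R0 \<ge> 1" and f: "Linfty f"
    and \<tau>: "0 \<le> \<tau>" "\<tau> \<le> 1"
    and solenoidal: "decaying_solenoidal u (\<lambda>x e. jacobian u (at x) *v e) A"
    and f'_measurable [measurable]: "f' \<in> borel_measurable borel"
    and f'_eq: "AE x in lebesgue. f x = f' x"
    and f'_le: "\<And>x. norm (f' x) \<le> Linfty_norm f * indicator (ball 0 R0) x"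
begin

sublocale decaying_solenoidal u "\<lambda>x e. jacobian u (at x) *v e" A by (rule solenoidal)

abbreviation "\<Theta> \<equiv> theta (\<lambda>x. \<tau> *\<^sub>R f x) u"

lemma omega_pos: "0 < omega CARD('n)" by (simp add: omega_def)

lemma norm_force_le: "norm (f' x) \<le> Linfty_norm f"
  using f'_le[of x] Linfty_norm_bound(1)[OF f] by (cases "x \<in> ball 0 R0") auto

lemma integrable_force: "integrable lborel (\<lambda>x. \<tau> *\<^sub>R f' x)"
proof (intro integrable_scaleR_right)
  have "integrable lborel (\<lambda>x. Linfty_norm f * indicator (ball 0 R0) (x :: real^'n))"
    by (intro integrable_mult_right integrable_real_indicator) (use emeasure_lborel_ball_finite[of 0 R0] in auto)
  then show "integrable lborel f'"
    by (rule Bochner_Integration.integrable_bound) (auto intro!: always_eventually order_trans[OF f'_le])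
qed

lemma norm_scaled_force_le: "norm (\<tau> *\<^sub>R f' x) \<le> Linfty_norm f"
proof -
  have "\<tau> * norm (f' x) \<le> 1 * norm (f' x)" by (rule mult_right_mono[OF \<tau>(2)]) simp
  then show ?thesis using \<tau> norm_force_le[of x] by simp
qed

text \<open>Replacing \<open>f\<close> by \<open>f'\<close> changes the source on a null set only,
  so the pressure integrals agree at every x and not just almost everywhere.\<close>

lemma theta_eq: "\<Theta> x = (\<Sum>b\<in>Basis. \<integral>z. (norm (x - z) powr (- real DIM(real^'n)) * ((x - z) \<bullet> b)) *
    ((\<tau> *\<^sub>R f' z - jacobian u (at z) *v u z) \<bullet> b) \<partial>lborel) / omega DIM(real^'n) + (norm (u x))\<^sup>2 / 2"
proof -
  have "Defs.convolution (pressure_kernel j) (\<lambda>z. source (\<lambda>x. \<tau> *\<^sub>R f x) u z $ j) x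
     = (\<integral>z. (norm (x - z) powr (- real CARD('n)) * ((x - z) \<bullet> axis j 1)) *
        ((\<tau> *\<^sub>R f' z - jacobian u (at z) *v u z) \<bullet> axis j 1) \<partial>lborel) / omega CARD('n)" for j
  proof -
    let ?h = "\<lambda>z. (norm (x - z) powr (- real CARD('n)) * ((x - z) \<bullet> axis j 1)) *
        ((\<tau> *\<^sub>R f' z - jacobian u (at z) *v u z) \<bullet> axis j 1)"
    have "Defs.convolution (pressure_kernel j) (\<lambda>z. source (\<lambda>x. \<tau> *\<^sub>R f x) u z $ j) x = (\<integral>z. ?h z / omega CARD('n) \<partial>lborel)"
      unfolding Defs.convolution_def
    proof (rule lebesgue_integral_AE_borel(2))
      show "AE z in lebesgue. pressure_kernel j (x - z) * source (\<lambda>x. \<tau> *\<^sub>R f x) u z $ j = ?h z / omega CARD('n)"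
        using f'_eq by eventually_elim (simp add: pressure_kernel_powr source_def inner_axis)
    qed simp
    then show ?thesis by simp
  qed
  then show ?thesis
    by (simp add: theta_def pressure_def sum_Basis_vec sum_divide_distrib)
qed

lemmas theta_facts = bernoulli_potential[OF integrable_force norm_scaled_force_le, folded theta_eq, simplified DIM_cart DIM_real mult_1_right]

lemma theta_measurable [measurable]: "\<Theta> \<in> borel_measurable borel"
  using theta_facts(1) .

lemma newton_convolution_lborel:
  fixes a :: "real^'n \<Rightarrow> real"
  assumes [measurable]: "a \<in> borel_measurable borel"
  shows "convolution_converges newton_kernel a y \<longleftrightarrow> integrable lborel (\<lambda>x. norm (y - x) powr (2 - real CARD('n)) * a x)"
    and "inv_neg_laplace a y = (\<integral>x. norm (y - x) powr (2 - real CARD('n)) * a x \<partial>lborel) / ((real CARD('n) - 2) * omega CARD('n))"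
proof -
  let ?h = "\<lambda>x. inverse ((real CARD('n) - 2) * omega CARD('n)) * (norm (y - x) powr (2 - real CARD('n)) * a x)"
  have k: "newton_kernel (y - x) * a x = ?h x" for x
    using card by (simp add: newton_kernel_powr divide_inverse)
  have "convolution_converges newton_kernel a y \<longleftrightarrow> integrable lborel ?h"
    unfolding convolution_converges_def by (rule lebesgue_integral_AE_borel(1)) (auto simp: k)
  then show "convolution_converges newton_kernel a y \<longleftrightarrow> integrable lborel (\<lambda>x. norm (y - x) powr (2 - real CARD('n)) * a x)"
    using card omega_pos by simp
  have "inv_neg_laplace a y = (\<integral>x. ?h x \<partial>lborel)"
    unfolding Defs.convolution_def by (rule lebesgue_integral_AE_borel(2)) (auto simp: k)
  then show "inv_neg_laplace a y = (\<integral>x. norm (y - x) powr (2 - real CARD('n)) * a x \<partial>lborel) / ((real CARD('n) - 2) * omega CARD('n))"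
    by (simp add: divide_inverse mult.commute)
qed

section \<open>The force potential\<close>

definition \<kappa> :: real where "\<kappa> = 1 / (2 * (real CARD('n) - 2) * omega CARD('n))"

lemma \<kappa>_pos: "0 < \<kappa>"
  using card omega_pos by (simp add: \<kappa>_def)

lemma integrable_force_kernel:
  "integrable lborel (\<lambda>x. norm (y - x) powr (- (real CARD('n) - 3)) * indicator (ball 0 R0) (x::real^'n))"
proof -
  have "\<exists>C\<ge>0. \<forall>R>0. \<forall>y::real^'n. (\<integral>\<^sup>+x. ennreal (norm (y - x) powr (- (real CARD('n) - 3))) * indicator (ball 0 R) x \<partial>lborel)
      \<le> ennreal (C * R powr (DIM(real^'n) - (real CARD('n) - 3)))"
    using card by (intro nn_integral_riesz_ball_le) auto
  then obtain C where "\<And>y::real^'n. (\<integral>\<^sup>+x. ennreal (norm (y - x) powr (- (real CARD('n) - 3))) * indicator (ball 0 R0) x \<partial>lborel)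
      \<le> ennreal (C * R0 powr (DIM(real^'n) - (real CARD('n) - 3)))"
    using R0 by (meson less_le_trans zero_less_one)
  from this[of y] have fin: "(\<integral>\<^sup>+x. ennreal (norm (y - x) powr (- (real CARD('n) - 3))) * indicator (ball 0 R0) x \<partial>lborel) < \<infinity>"
    by (auto intro: order.strict_trans1)
  have "(\<integral>\<^sup>+x. ennreal (norm (y - x) powr (- (real CARD('n) - 3)) * indicator (ball 0 R0) x) \<partial>lborel)
     = (\<integral>\<^sup>+x. ennreal (norm (y - x) powr (- (real CARD('n) - 3))) * indicator (ball 0 R0) x \<partial>lborel)"
    by (intro nn_integral_cong) (auto simp: indicator_def)
  then show ?thesis using fin by (intro integrableI_nonneg) auto
qed

lemma force_integrand_le:
  "norm (y - x) powr (2 - real CARD('n)) * norm (y - x) * norm (f' x)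
    \<le> Linfty_norm f * (norm (y - x) powr (- (real CARD('n) - 3)) * indicator (ball 0 R0) x)"
proof -
  have "norm (y - x) powr (2 - real CARD('n)) * norm (y - x) * norm (f' x)
     \<le> norm (y - x) powr (2 - real CARD('n)) * norm (y - x) * (Linfty_norm f * indicator (ball 0 R0) x)"
    by (intro mult_left_mono f'_le) auto
  moreover have "norm (y - x) powr (2 - real CARD('n)) * norm (y - x) = norm (y - x) powr (- (real CARD('n) - 3))"
    by (simp add: powr_mult_self)
  ultimately show ?thesis by (simp only: mult.left_commute)
qed

lemma integrable_force_component:
  "integrable lborel (\<lambda>x. norm (y - x) powr (2 - real CARD('n)) * ((y - x) $ i) * (f' x $ i))"
proof (rule Bochner_Integration.integrable_bound)
  show "integrable lborel (\<lambda>x. Linfty_norm f * (norm (y - x) powr (- (real CARD('n) - 3)) * indicator (ball 0 R0) x))"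
    by (intro integrable_mult_right integrable_force_kernel)
  have "(\<lambda>v::real^'n. v $ i) \<in> borel_measurable borel"
    by (intro borel_measurable_continuous_onI continuous_intros)
  note [measurable] = measurable_compose[OF _ this]
  show "(\<lambda>x. norm (y - x) powr (2 - real CARD('n)) * ((y - x) $ i) * (f' x $ i)) \<in> borel_measurable lborel"
    by measurable
  have "\<bar>norm (y - x) powr (2 - real CARD('n)) * ((y - x) $ i) * (f' x $ i)\<bar>
     \<le> norm (y - x) powr (2 - real CARD('n)) * norm (y - x) * norm (f' x)" for x
    unfolding abs_mult using component_le_norm_cart[of "y - x" i] component_le_norm_cart[of "f' x" i]
    by (intro mult_mono) auto
  then have "\<bar>norm (y - x) powr (2 - real CARD('n)) * ((y - x) $ i) * (f' x $ i)\<bar>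
     \<le> Linfty_norm f * (norm (y - x) powr (- (real CARD('n) - 3)) * indicator (ball 0 R0) x)" for x
    using force_integrand_le by (rule order_trans)
  then show "AE x in lborel. norm (norm (y - x) powr (2 - real CARD('n)) * ((y - x) $ i) * (f' x $ i))
     \<le> norm (Linfty_norm f * (norm (y - x) powr (- (real CARD('n) - 3)) * indicator (ball 0 R0) x))"
    by (auto intro!: always_eventually intro: order_trans[OF _ abs_ge_self])
qed

text \<open>Away from \<open>x = y\<close> the kernel is -\<open>\<kappa>\<close> |y - x|^(2-n) (y -
  x)_i. At the pole the derivative of the kernel is unspecified, but this concerns a single
  point.\<close>

lemma force_convolution:
  shows "convolution_converges (partial_deriv i bilaplace_kernel) (\<lambda>x. f x $ i) y"
    and "Defs.convolution (partial_deriv i bilaplace_kernel) (\<lambda>x. f x $ i) y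
      = - \<kappa> * (\<integral>x. norm (y - x) powr (2 - real CARD('n)) * ((y - x) $ i) * (f' x $ i) \<partial>lborel)"
proof -
  let ?h = "\<lambda>x. - \<kappa> * (norm (y - x) powr (2 - real CARD('n)) * ((y - x) $ i) * (f' x $ i))"
  have int: "integrable lborel ?h"
    by (intro integrable_mult_right integrable_force_component)
  have AE: "AE x in lebesgue. partial_deriv i bilaplace_kernel (y - x) * f x $ i = ?h x"
    using f'_eq AE_completion[OF AE_lborel_singleton[of y]]
  proof eventually_elim
    case (elim x)
    then show ?case using card by (simp add: partial_deriv_bilaplace_kernel \<kappa>_def)
  qed
  have m: "?h \<in> borel_measurable borel" using borel_measurable_integrable[OF int] by simp
  show "convolution_converges (partial_deriv i bilaplace_kernel) (\<lambda>x. f x $ i) y"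
    unfolding convolution_converges_def using lebesgue_integral_AE_borel(1)[OF m AE] int by simp
  have "Defs.convolution (partial_deriv i bilaplace_kernel) (\<lambda>x. f x $ i) y = (\<integral>x. ?h x \<partial>lborel)"
    unfolding Defs.convolution_def by (rule lebesgue_integral_AE_borel(2)[OF m AE])
  then show "Defs.convolution (partial_deriv i bilaplace_kernel) (\<lambda>x. f x $ i) y
      = - \<kappa> * (\<integral>x. norm (y - x) powr (2 - real CARD('n)) * ((y - x) $ i) * (f' x $ i) \<partial>lborel)" by simp
qed

lemma force_potential_eq:
  "force_potential \<tau> f y = \<kappa> * (\<integral>x. norm (y - x) powr (2 - real CARD('n)) * ((y - x) \<bullet> (\<tau> *\<^sub>R f' x)) \<partial>lborel)"
proof -
  have "force_potential \<tau> f y = \<tau> * \<kappa> * (\<Sum>i\<in>UNIV. (\<integral>x. norm (y - x) powr (2 - real CARD('n)) * ((y - x) $ i) * (f' x $ i) \<partial>lborel))"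
    by (simp add: force_potential_def force_convolution(2) sum_negf sum_distrib_left mult.assoc)
  also have "\<dots> = \<tau> * \<kappa> * (\<integral>x. (\<Sum>i\<in>UNIV. norm (y - x) powr (2 - real CARD('n)) * ((y - x) $ i) * (f' x $ i)) \<partial>lborel)"
    by (subst Bochner_Integration.integral_sum) (auto intro: integrable_force_component simp del: vector_minus_component)
  also have "\<dots> = \<tau> * \<kappa> * (\<integral>x. norm (y - x) powr (2 - real CARD('n)) * ((y - x) \<bullet> f' x) \<partial>lborel)"
    by (simp add: inner_vec_def sum_distrib_left mult.assoc)
  also have "\<dots> = \<kappa> * (\<integral>x. \<tau> * (norm (y - x) powr (2 - real CARD('n)) * ((y - x) \<bullet> f' x)) \<partial>lborel)"
    by simp
  finally show ?thesis by (simp add: mult_ac)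
qed

lemma force_potential_measurable: "force_potential \<tau> f \<in> borel_measurable borel"
  unfolding force_potential_eq[abs_def] by measurable

text \<open>A kernel of order n - 3 integrated over a ball of radius \<open>R0\<close> contributes
  R0^3. The constant \<open>C\<close> is assumed rather than chosen here, so that the theorem can
  fix it before \<open>R0\<close>, \<open>f\<close> and \<open>u\<close> are given.\<close>

lemma force_potential_bound:
  assumes C: "\<And>R y. 0 < R \<Longrightarrow> (\<integral>\<^sup>+x. ennreal (norm (y - x) powr (- (real CARD('n) - 3))) * indicator (ball 0 R) (x::real^'n) \<partial>lborel)
      \<le> ennreal (C * R powr 3)" and C0: "0 \<le> C"
  shows "\<bar>force_potential \<tau> f y\<bar> \<le> \<kappa> * C * R0 ^ 3 * Linfty_norm f"
proof -
  let ?k = "\<lambda>x. norm (y - x) powr (- (real CARD('n) - 3)) * indicator (ball 0 R0) (x::real^'n) :: real"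
  have "ennreal (\<integral>x. ?k x \<partial>lborel) = (\<integral>\<^sup>+x. ennreal (?k x) \<partial>lborel)"
    by (rule nn_integral_eq_integral[OF integrable_force_kernel, symmetric]) auto
  also have "\<dots> = (\<integral>\<^sup>+x. ennreal (norm (y - x) powr (- (real CARD('n) - 3))) * indicator (ball 0 R0) (x::real^'n) \<partial>lborel)"
    by (intro nn_integral_cong) (auto simp: indicator_def)
  also have "\<dots> \<le> ennreal (C * R0 powr 3)" using R0 by (intro C) simp
  finally have k: "(\<integral>x. ?k x \<partial>lborel) \<le> C * R0 ^ 3"
    using C0 R0 by (simp add: powr_realpow[of R0 3, simplified])
  have "\<bar>\<integral>x. norm (y - x) powr (2 - real CARD('n)) * ((y - x) \<bullet> (\<tau> *\<^sub>R f' x)) \<partial>lborel\<bar> \<le> (\<integral>x. Linfty_norm f * ?k x \<partial>lborel)"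
  proof (rule integral_abs_bound_integral)
    have "integrable lborel (\<lambda>x. \<tau> * (\<Sum>i\<in>UNIV. norm (y - x) powr (2 - real CARD('n)) * ((y - x) $ i) * (f' x $ i)))"
      by (intro integrable_mult_right Bochner_Integration.integrable_sum integrable_force_component)
    then show "integrable lborel (\<lambda>x. norm (y - x) powr (2 - real CARD('n)) * ((y - x) \<bullet> (\<tau> *\<^sub>R f' x)))"
      by (simp add: inner_vec_def sum_distrib_left mult_ac)
    show "integrable lborel (\<lambda>x. Linfty_norm f * ?k x)"
      by (intro integrable_mult_right integrable_force_kernel)
    fix x
    have "\<bar>norm (y - x) powr (2 - real CARD('n)) * ((y - x) \<bullet> (\<tau> *\<^sub>R f' x))\<bar>
       = \<tau> * (norm (y - x) powr (2 - real CARD('n)) * \<bar>(y - x) \<bullet> f' x\<bar>)"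
      using \<tau> by (simp add: abs_mult)
    also have "\<dots> \<le> 1 * (norm (y - x) powr (2 - real CARD('n)) * (norm (y - x) * norm (f' x)))"
      using \<tau> by (intro mult_mono Cauchy_Schwarz_ineq2) auto
    also have "\<dots> \<le> Linfty_norm f * ?k x" using force_integrand_le[of y x] by (simp add: mult.assoc)
    finally show "\<bar>norm (y - x) powr (2 - real CARD('n)) * ((y - x) \<bullet> (\<tau> *\<^sub>R f' x))\<bar> \<le> Linfty_norm f * ?k x" .
  qed
  also have "\<dots> = Linfty_norm f * (\<integral>x. ?k x \<partial>lborel)" by (rule integral_mult_right_zero)
  also have "\<dots> \<le> Linfty_norm f * (C * R0 ^ 3)"
    using k Linfty_norm_bound(1)[OF f] by (rule mult_left_mono)
  finally have "\<kappa> * \<bar>\<integral>x. norm (y - x) powr (2 - real CARD('n)) * ((y - x) \<bullet> (\<tau> *\<^sub>R f' x)) \<partial>lborel\<bar> \<le> \<kappa> * (Linfty_norm f * (C * R0 ^ 3))"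
    using \<kappa>_pos by (intro mult_left_mono) auto
  then show ?thesis unfolding force_potential_eq using \<kappa>_pos by (simp add: abs_mult mult_ac)
qed

section \<open>The potential identity and the bound on M\<close>

definition J :: "real^'n \<Rightarrow> real" where
  "J y = (\<integral>z. norm (y - z) powr (- real CARD('n)) * ((y - z) \<bullet> u z)\<^sup>2 \<partial>lborel)"

lemma J_integrand: "\<bar>u x \<bullet> (x - y)\<bar>\<^sup>2 / norm (x - y) ^ CARD('n) = norm (y - x) powr (- real CARD('n)) * ((y - x) \<bullet> u x)\<^sup>2"
proof (cases "x = y")
  case False
  have "\<bar>u x \<bullet> (x - y)\<bar>\<^sup>2 = ((y - x) \<bullet> u x)\<^sup>2"
    by (simp add: inner_commute[of "u x"] inner_diff_left power2_commute)
  then show ?thesis using False by (simp add: powr_minus_divide powr_realpow norm_minus_commute)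
qed simp

lemma J_lebesgue:
  "integrable lebesgue (\<lambda>x. \<bar>u x \<bullet> (x - y)\<bar>\<^sup>2 / norm (x - y) ^ CARD('n))"
  "(LINT x|lebesgue. \<bar>u x \<bullet> (x - y)\<bar>\<^sup>2 / norm (x - y) ^ CARD('n)) = J y"
  unfolding J_integrand J_def using convective_potential(1)[of y]
  by (simp_all add: integrable_completion integral_completion)

lemma potential_identity:
  "inv_neg_laplace \<Theta> y = 1 / (2 * omega CARD('n)) * J y + force_potential \<tau> f y"
proof -
  have "inv_neg_laplace \<Theta> y = (((\<integral>z. norm (y - z) powr (2 - real CARD('n)) * ((y - z) \<bullet> (\<tau> *\<^sub>R f' z)) \<partial>lborel)
         + (real CARD('n) - 2) * J y) / 2) / ((real CARD('n) - 2) * omega CARD('n))"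
    unfolding newton_convolution_lborel(2)[OF theta_measurable] theta_facts(4) J_def by simp
  also have "((X + (real CARD('n) - 2) * Y) / 2) / ((real CARD('n) - 2) * omega CARD('n))
     = 1 / (2 * omega CARD('n)) * Y + \<kappa> * X" for X Y
    using card omega_pos by (simp add: \<kappa>_def divide_simps) (simp add: algebra_simps)
  finally show ?thesis by (simp only: force_potential_eq)
qed

lemma theta_pos_measurable [measurable]: "theta_pos (\<lambda>x. \<tau> *\<^sub>R f x) u \<in> borel_measurable borel"
  unfolding theta_pos_def[abs_def] by measurable

text \<open>\<open>Linfty_norm\<close>, and with it K, has a meaning on \<open>Linfty\<close> only.
  Boundedness follows from \<theta>_+ <= |\<theta>| and the uniform bound on the Newton potential of
  |\<theta>|.\<close>

lemma theta_pos_potential_bounded: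
  "Linfty (inv_neg_laplace (theta_pos (\<lambda>x. \<tau> *\<^sub>R f x) u))"
proof -
  let ?P = "theta_pos (\<lambda>x. \<tau> *\<^sub>R f x) u"
  let ?c = "(real CARD('n) - 2) * omega CARD('n)"
  have c: "0 < ?c" using card omega_pos by simp
  obtain B where B: "0 \<le> B" "\<And>y. (\<integral>\<^sup>+x. norm (y - x) powr (2 - real CARD('n)) * \<bar>\<Theta> x\<bar> \<partial>lborel) \<le> ennreal B"
    using theta_facts(3) by blast
  have "norm (inv_neg_laplace ?P y) \<le> B / ?c" for y
  proof -
    have "ennreal (\<integral>x. norm (y - x) powr (2 - real CARD('n)) * ?P x \<partial>lborel)
       = (\<integral>\<^sup>+x. norm (y - x) powr (2 - real CARD('n)) * ?P x \<partial>lborel)"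
    proof (rule nn_integral_eq_integral[symmetric])
      show "integrable lborel (\<lambda>x. norm (y - x) powr (2 - real CARD('n)) * ?P x)"
        by (rule Bochner_Integration.integrable_bound[OF theta_facts(2)[of y]])
          (auto simp: theta_pos_def abs_mult intro!: always_eventually mult_left_mono)
    qed (auto simp: theta_pos_def)
    also have "\<dots> \<le> (\<integral>\<^sup>+x. norm (y - x) powr (2 - real CARD('n)) * \<bar>\<Theta> x\<bar> \<partial>lborel)"
      by (intro nn_integral_mono ennreal_leI mult_left_mono) (auto simp: theta_pos_def)
    also have "\<dots> \<le> ennreal B" by (rule B)
    finally have "(\<integral>x. norm (y - x) powr (2 - real CARD('n)) * ?P x \<partial>lborel) \<le> B" using B(1) by simp
    moreover have "0 \<le> (\<integral>x. norm (y - x) powr (2 - real CARD('n)) * ?P x \<partial>lborel)"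
      by (intro Bochner_Integration.integral_nonneg) (auto simp: theta_pos_def)
    ultimately show ?thesis
      unfolding newton_convolution_lborel(2)[OF theta_pos_measurable] using c by (simp add: divide_right_mono)
  qed
  moreover have "inv_neg_laplace ?P \<in> borel_measurable lebesgue"
    unfolding newton_convolution_lborel(2)[OF theta_pos_measurable, abs_def]
    by (intro measurable_completion) measurable
  ultimately show ?thesis by (rule Linfty_bounded(1)[rotated])
qed

lemma theta_potential_le_pos: "inv_neg_laplace \<Theta> y \<le> inv_neg_laplace (theta_pos (\<lambda>x. \<tau> *\<^sub>R f x) u) y"
proof -
  let ?P = "theta_pos (\<lambda>x. \<tau> *\<^sub>R f x) u"
  have "(\<integral>x. norm (y - x) powr (2 - real CARD('n)) * \<Theta> x \<partial>lborel) \<le> (\<integral>x. norm (y - x) powr (2 - real CARD('n)) * ?P x \<partial>lborel)"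
  proof (rule integral_mono)
    show "integrable lborel (\<lambda>x. norm (y - x) powr (2 - real CARD('n)) * ?P x)"
      by (rule Bochner_Integration.integrable_bound[OF theta_facts(2)[of y]])
        (auto simp: theta_pos_def abs_mult intro!: always_eventually mult_left_mono)
  qed (auto intro: theta_facts(2) mult_left_mono simp: theta_pos_def)
  then show ?thesis
    unfolding newton_convolution_lborel(2)[OF theta_pos_measurable] newton_convolution_lborel(2)[OF theta_measurable]
    using card omega_pos by (intro divide_right_mono) auto
qed

text \<open>The Newton kernel is nonnegative, so J / (2 omega) <= Gamma * \<theta>_+ - F_tau <= K +
  N for almost every y, and \<open>ball_energy_le\<close> applies with D = 2 omega (K + N). The 32
  is the 16 of that lemma times this 2.\<close>

lemma M_quotient_le:
  assumes N: "\<And>y. \<bar>force_potential \<tau> f y\<bar> \<le> N" and q: "q \<in> M_quotients u"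
  shows "q \<le> 32 * omega CARD('n) * 8 ^ CARD('n) * (K_const (\<lambda>x. \<tau> *\<^sub>R f x) u + N)"
proof -
  define K where "K = K_const (\<lambda>x. \<tau> *\<^sub>R f x) u"
  note L = Linfty_norm_bound[OF theta_pos_potential_bounded]
  have K: "0 \<le> K" using L(1) by (simp add: K_def K_const_def)
  have N0: "0 \<le> N" using N[of 0] by linarith
  define D where "D = 2 * omega CARD('n) * (K + N)"
  have D: "0 \<le> D" using K N0 omega_pos by (simp add: D_def)
  have "AE y in lborel. norm (inv_neg_laplace (theta_pos (\<lambda>x. \<tau> *\<^sub>R f x) u) y) \<le> K"
    using L(2) unfolding K_def K_const_def by (simp add: AE_completion_iff)
  then have bound: "AE y in lborel. (\<integral>\<^sup>+x. norm (y - x) powr (- real DIM(real^'n)) * ((y - x) \<bullet> u x)\<^sup>2 \<partial>lborel) \<le> ennreal D"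
  proof eventually_elim
    case (elim y)
    have "1 / (2 * omega CARD('n)) * J y \<le> K + N"
      using elim potential_identity[of y] theta_potential_le_pos[of y] N[of y] by simp
    then have "J y \<le> D" using omega_pos by (simp add: D_def field_simps)
    moreover have "(\<integral>\<^sup>+x. norm (y - x) powr (- real CARD('n)) * ((y - x) \<bullet> u x)\<^sup>2 \<partial>lborel) = ennreal (J y)"
      unfolding J_def using convective_potential(1)[of y] by (intro nn_integral_eq_integral) auto
    ultimately show ?case by (simp add: ennreal_leI)
  qed
  obtain z r where r: "0 < r" and q: "q = r powi (2 - int CARD('n)) * (LINT x:ball z r|lebesgue. (norm (u x))\<^sup>2)"
    using q by (auto simp: M_quotients_def)
  have "(LINT x:ball z r|lebesgue. (norm (u x))\<^sup>2) = (\<integral>x. indicator (ball z r) x * (norm (u x))\<^sup>2 \<partial>lborel)"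
    unfolding set_lebesgue_integral_def by (subst integral_completion) simp_all
  also have "\<dots> = enn2real (\<integral>\<^sup>+x. ennreal (indicator (ball z r) x * (norm (u x))\<^sup>2) \<partial>lborel)"
    by (rule integral_eq_nn_integral) (auto intro!: borel_measurable_times borel_measurable_indicator)
  also have "(\<integral>\<^sup>+x. ennreal (indicator (ball z r) x * (norm (u x))\<^sup>2) \<partial>lborel) = (\<integral>\<^sup>+x. ennreal ((norm (u x))\<^sup>2) * indicator (ball z r) x \<partial>lborel)"
    by (intro nn_integral_cong) (auto simp: indicator_def)
  also have "enn2real \<dots> \<le> 16 * 8 ^ CARD('n) * D * r powr (real CARD('n) - 2)"
    using ball_energy_le[OF u_measurable D bound r, of z] D r by (intro enn2real_leI) auto
  finally have E: "(LINT x:ball z r|lebesgue. (norm (u x))\<^sup>2) \<le> 16 * 8 ^ CARD('n) * D * r powr (real CARD('n) - 2)" .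
  have "q \<le> r powr (2 - real CARD('n)) * (16 * 8 ^ CARD('n) * D * r powr (real CARD('n) - 2))"
    unfolding q using r E by (intro mult_mono) (auto simp: powi_eq_powr set_lebesgue_integral_def intro!: Bochner_Integration.integral_nonneg)
  also have "\<dots> = 16 * 8 ^ CARD('n) * D * (r powr (2 - real CARD('n)) * r powr (real CARD('n) - 2))"
    by (simp only: mult_ac)
  also have "r powr (2 - real CARD('n)) * r powr (real CARD('n) - 2) = 1"
    unfolding powr_add[symmetric] using r by simp
  finally show ?thesis by (simp add: D_def K_def algebra_simps)
qed

end

text \<open>Both constants are chosen before all data, in a dimension fixed by the type. Integrals,
  \<open>Linfty_norm\<close> and \<open>Sup\<close> are total functions, so the clauses on
  convergence, \<open>Linfty\<close> and \<open>bdd_above\<close> are what gives the equation and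
  the estimates their meaning.\<close>

theorem lemma3p2:
  assumes "CARD('n::finite) \<ge> 16"
  shows "\<exists>(C :: real) (Cf :: real \<Rightarrow> real \<Rightarrow> real).
    \<forall>(R0 :: real) (f :: real^'n \<Rightarrow> real^'n) (\<tau> :: real) (u :: real^'n \<Rightarrow> real^'n).
      R0 \<ge> 1 \<longrightarrow> Linfty f \<longrightarrow> ess_support f \<subseteq> ball 0 R0 \<longrightarrow> 0 \<le> \<tau> \<longrightarrow> \<tau> \<le> 1 \<longrightarrow>
      weighted_fixed_point (\<lambda>x. \<tau> *\<^sub>R f x) u \<longrightarrow>
      (\<forall>y.
         convolution_converges newton_kernel (theta (\<lambda>x. \<tau> *\<^sub>R f x) u) y \<and>
         integrable lebesgue (\<lambda>x. \<bar>u x \<bullet> (x - y)\<bar>\<^sup>2 / norm (x - y) ^ CARD('n)) \<and>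
         (\<forall>i. convolution_converges (partial_deriv i bilaplace_kernel) (\<lambda>x. f x $ i) y) \<and>
         inv_neg_laplace (theta (\<lambda>x. \<tau> *\<^sub>R f x) u) y =
           1 / (2 * omega CARD('n)) *
             (LINT x|lebesgue. \<bar>u x \<bullet> (x - y)\<bar>\<^sup>2 / norm (x - y) ^ CARD('n)) +
           force_potential \<tau> f y) \<and>
      Linfty (force_potential \<tau> f) \<and>
      Linfty_norm (force_potential \<tau> f) \<le> C * R0 ^ 3 * Linfty_norm f \<and>
      C * R0 ^ 3 * Linfty_norm f \<le> Cf R0 (Linfty_norm f) \<and>
      Linfty (inv_neg_laplace (theta_pos (\<lambda>x. \<tau> *\<^sub>R f x) u)) \<and>
      bdd_above (M_quotients u) \<and>
      M_const u \<le> Cf R0 (Linfty_norm f) * (1 + K_const (\<lambda>x. \<tau> *\<^sub>R f x) u)"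
proof -
  let ?n = "real CARD('n)"
  have om: "0 < omega CARD('n)" by (simp add: omega_def)
  have "\<exists>C\<ge>0. \<forall>R>0. \<forall>y::real^'n. (\<integral>\<^sup>+x. ennreal (norm (y - x) powr (- (?n - 3))) * indicator (ball 0 R) x \<partial>lborel)
      \<le> ennreal (C * R powr (DIM(real^'n) - (?n - 3)))"
    using assms by (intro nn_integral_riesz_ball_le) auto
  then obtain C0 where C0: "0 \<le> C0"
    "\<And>R y. 0 < R \<Longrightarrow> (\<integral>\<^sup>+x. ennreal (norm (y - x) powr (- (?n - 3))) * indicator (ball 0 R) (x::real^'n) \<partial>lborel)
      \<le> ennreal (C0 * R powr 3)"
    by auto
  \<comment> \<open>\<open>C0\<close> bounds the Riesz integral of order n - 3 over balls, and the
    other factor is the constant of d_i \<Psi>; both depend on n only.\<close>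
  define C where "C = 1 / (2 * (?n - 2) * omega CARD('n)) * C0"
  have C: "0 \<le> C" using C0(1) om assms by (simp add: C_def)
  define D where "D = 32 * omega CARD('n) * 8 ^ CARD('n)"
  have D: "0 \<le> D" using om by (simp add: D_def)
  \<comment> \<open>With N = C R^3 F, the value (1 + D) (1 + N) dominates N and, after
    multiplication by 1 + K, also D (K + N), the bound of \<open>M_quotient_le\<close>.\<close>
  define Cf where "Cf R F = (1 + D) * (1 + C * R ^ 3 * F)" for R F :: real
  show ?thesis
  proof (intro exI[of _ C] exI[of _ Cf] allI impI)
    fix R0 :: real and f :: "real^'n \<Rightarrow> real^'n" and \<tau> :: real and u :: "real^'n \<Rightarrow> real^'n"
    assume R0: "R0 \<ge> 1" and f: "Linfty f" and supp: "ess_support f \<subseteq> ball 0 R0"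
      and \<tau>: "0 \<le> \<tau>" "\<tau> \<le> 1" and u: "weighted_fixed_point (\<lambda>x. \<tau> *\<^sub>R f x) u"
    obtain A where A: "decaying_solenoidal u (\<lambda>x e. jacobian u (at x) *v e) A"
      using X_space_decaying_solenoidal[of u] u assms by (auto simp: weighted_fixed_point_def)
    obtain f' where f': "f' \<in> borel_measurable borel" "AE x in lebesgue. f x = f' x"
        "\<And>x. norm (f' x) \<le> Linfty_norm f * indicator (ball 0 R0) x"
      using Linfty_borel_representative[OF f supp] by blast
    interpret fp: fixed_point R0 f \<tau> u f' A
      using assms R0 f \<tau> A f' by (intro fixed_point.intro)
    define N where "N = C * R0 ^ 3 * Linfty_norm f"
    have F: "0 \<le> Linfty_norm f" using f by (rule Linfty_norm_bound)
    have N: "\<bar>force_potential \<tau> f y\<bar> \<le> N" for y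
      using fp.force_potential_bound[OF C0(2,1), of y] by (simp add: N_def C_def fp.\<kappa>_def)
    have N0: "0 \<le> N" using C R0 F by (simp add: N_def)
    have Cf: "Cf R0 (Linfty_norm f) = (1 + D) * (1 + N)" by (simp add: Cf_def N_def)
    have fm: "force_potential \<tau> f \<in> borel_measurable lebesgue"
      using fp.force_potential_measurable by (intro measurable_completion) simp
    let ?g = "\<lambda>x. \<tau> *\<^sub>R f x"
    have K: "0 \<le> K_const ?g u"
      unfolding K_const_def using fp.theta_pos_potential_bounded by (rule Linfty_norm_bound)
    have M: "q \<le> Cf R0 (Linfty_norm f) * (1 + K_const ?g u)" if "q \<in> M_quotients u" for q
    proof -
      have "q \<le> D * (K_const ?g u + N)" using fp.M_quotient_le[OF N that] by (simp add: D_def)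
      also have "\<dots> \<le> (1 + D) * ((1 + N) * (1 + K_const ?g u))"
        using D N0 K by (intro mult_mono) (auto simp: algebra_simps)
      finally show ?thesis by (simp add: Cf mult.assoc)
    qed
    have ne: "M_quotients u \<noteq> {}" unfolding M_quotients_def using zero_less_one by blast
    have id: "convolution_converges newton_kernel (theta ?g u) y \<and>
         integrable lebesgue (\<lambda>x. \<bar>u x \<bullet> (x - y)\<bar>\<^sup>2 / norm (x - y) ^ CARD('n)) \<and>
         (\<forall>i. convolution_converges (partial_deriv i bilaplace_kernel) (\<lambda>x. f x $ i) y) \<and>
         inv_neg_laplace (theta ?g u) y =
           1 / (2 * omega CARD('n)) *
             (LINT x|lebesgue. \<bar>u x \<bullet> (x - y)\<bar>\<^sup>2 / norm (x - y) ^ CARD('n)) +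
           force_potential \<tau> f y" for y
      using fp.theta_facts(2)[of y] fp.newton_convolution_lborel(1)[OF fp.theta_measurable]
        fp.J_lebesgue fp.force_convolution(1) fp.potential_identity by simp
    have "N \<le> (1 + D) * (1 + N)" using D N0 by (simp add: algebra_simps)
    then have "N \<le> Cf R0 (Linfty_norm f)" by (simp add: Cf)
    moreover have "bdd_above (M_quotients u)" using M by (rule bdd_aboveI)
    moreover have "M_const u \<le> Cf R0 (Linfty_norm f) * (1 + K_const ?g u)"
      unfolding M_const_def using ne M by (rule cSup_least)
    moreover have "Linfty (force_potential \<tau> f)" "Linfty_norm (force_potential \<tau> f) \<le> N"
      using Linfty_bounded[OF fm, of N] N by simp_all
    ultimately show "(\<forall>y.
         convolution_converges newton_kernel (theta ?g u) y \<and>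
         integrable lebesgue (\<lambda>x. \<bar>u x \<bullet> (x - y)\<bar>\<^sup>2 / norm (x - y) ^ CARD('n)) \<and>
         (\<forall>i. convolution_converges (partial_deriv i bilaplace_kernel) (\<lambda>x. f x $ i) y) \<and>
         inv_neg_laplace (theta ?g u) y =
           1 / (2 * omega CARD('n)) *
             (LINT x|lebesgue. \<bar>u x \<bullet> (x - y)\<bar>\<^sup>2 / norm (x - y) ^ CARD('n)) +
           force_potential \<tau> f y) \<and>
      Linfty (force_potential \<tau> f) \<and>
      Linfty_norm (force_potential \<tau> f) \<le> C * R0 ^ 3 * Linfty_norm f \<and>
      C * R0 ^ 3 * Linfty_norm f \<le> Cf R0 (Linfty_norm f) \<and>
      Linfty (inv_neg_laplace (theta_pos ?g u)) \<and>
      bdd_above (M_quotients u) \<and>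
      M_const u \<le> Cf R0 (Linfty_norm f) * (1 + K_const ?g u)"
      unfolding N_def[symmetric] using id fp.theta_pos_potential_bounded by blast
  qed
qed

end
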